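(* Let $n\ge 0$ and $x\ge 1$ be integers. The number of centered vertically symmetric rhombus tilings of a $(2n+1,2x,2n+1)$ hexagon equals $Q(n+1,x)\cdot ST(2n+1,2x,2n+1)$.
   Context: For positive integers $a,b,c$, an $(a,b,c)$ hexagon is the equi-angular hexagon (on the triangular lattice) with side lengths $a,b,c,a,b,c$ in clockwise order starting from the southwestern side, so that the sides of length $b$ are vertical. A rhombus tiling is a tiling of the hexagon by unit rhombi (lozenges) with angles $60^\circ$ and $120^\circ$. A tiling is vertically symmetric if it is invariant under reflection in the vertical symmetry axis of the hexagon. When $a$ and $b$ have opposite parity, an $(a,b,a)$ hexagon has a central rhombus (the unit rhombus centered at the center of the hexagon); a tiling is centered if it contains this central rhombus. Notation: $(a)_k=a(a+1)\cdots(a+k-1)$ for $k\ge1$, $(a)_0=1$; $ST(a,b,a)=\prod_{i=1}^a\frac{2i+b-1}{2i-1}\prod_{1\le i<j\le a}\frac{i+j+b-1}{i+j-1}$ (the number of vertically symmetric rhombus tilings of an $(a,b,a)$ hexagon); and for nonnegative integers $n,x$, $Q(n,x)=\frac12\frac{(2n)!^2(2x)!(x+2n-1)!}{n!^2\,x!\,(2x+4n-2)!}\sum_{i=0}^{n-1}\frac{(-1)^{n-i-1}}{2n-2i-1}\frac{(x+n-i)_{2i}}{i!^2}$. *)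

theory Defs
  imports Complex_Main
begin

text \<open>Triangular lattice: the point (i,j) is i*e1 + j*e2 with e1 = (sqrt 3/2, 1/2)
  and e2 = (0,1) (vertical).  Lattice edges have directions e1, e2, e1-e2.
  A unit triangle is represented by its set of three vertices.\<close>

definition right_tri :: "int \<Rightarrow> int \<Rightarrow> (int \<times> int) set" where
  "right_tri i j = {(i,j), (i+1,j), (i,j+1)}"

definition left_tri :: "int \<Rightarrow> int \<Rightarrow> (int \<times> int) set" where
  "left_tri i j = {(i+1,j), (i+1,j+1), (i,j+1)}"

definition unit_tri :: "(int \<times> int) set \<Rightarrow> bool" where
  "unit_tri t \<longleftrightarrow> (\<exists>i j. t = right_tri i j \<or> t = left_tri i j)"

text \<open>The (a,b,c) hexagon, with vertices (0,0), (0,b), (c,b), (c+a,b-a), (c+a,-a), (a,-a):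
  SW side a, W (vertical) side b, NW side c, NE side a, E (vertical) side b, SE side c.\<close>

definition in_hex :: "nat \<Rightarrow> nat \<Rightarrow> nat \<Rightarrow> int \<times> int \<Rightarrow> bool" where
  "in_hex a b c p \<longleftrightarrow> (case p of (i,j) \<Rightarrow>
      0 \<le> i \<and> i \<le> int a + int c \<and> - int a \<le> j \<and> j \<le> int b \<and>
      0 \<le> i + j \<and> i + j \<le> int b + int c)"

definition hex_tri :: "nat \<Rightarrow> nat \<Rightarrow> nat \<Rightarrow> (int \<times> int) set \<Rightarrow> bool" where
  "hex_tri a b c t \<longleftrightarrow> unit_tri t \<and> (\<forall>p\<in>t. in_hex a b c p)"

definition lozenge :: "(int \<times> int) set set \<Rightarrow> bool" where
  "lozenge L \<longleftrightarrow> (\<exists>t1 t2. L = {t1, t2} \<and> unit_tri t1 \<and> unit_tri t2 \<and> t1 \<noteq> t2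
      \<and> card (t1 \<inter> t2) = 2)"

definition rhombus_tiling :: "nat \<Rightarrow> nat \<Rightarrow> nat \<Rightarrow> (int \<times> int) set set set \<Rightarrow> bool" where
  "rhombus_tiling a b c T \<longleftrightarrow>
     (\<forall>L\<in>T. lozenge L \<and> (\<forall>t\<in>L. hex_tri a b c t)) \<and>
     (\<forall>t. hex_tri a b c t \<longrightarrow> (\<exists>!L. L \<in> T \<and> t \<in> L))"

text \<open>Reflection in the vertical symmetry axis of the (a,b,a) hexagon (the line i = a).\<close>

definition refl_pt :: "nat \<Rightarrow> int \<times> int \<Rightarrow> int \<times> int" where
  "refl_pt a p = (case p of (i,j) \<Rightarrow> (2 * int a - i, i + j - int a))"

definition refl_tiling :: "nat \<Rightarrow> (int \<times> int) set set set \<Rightarrow> (int \<times> int) set set set" where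
  "refl_tiling a T = (\<lambda>L. (\<lambda>t. refl_pt a ` t) ` L) ` T"

definition vsym_tiling :: "nat \<Rightarrow> nat \<Rightarrow> (int \<times> int) set set set \<Rightarrow> bool" where
  "vsym_tiling a b T \<longleftrightarrow> rhombus_tiling a b a T \<and> refl_tiling a T = T"

text \<open>Central rhombus of the (a,b,a) hexagon (a, b of opposite parity): the lozenge whose
  short diagonal is the vertical edge from (a,j0) to (a,j0+1), j0 = (b-a-1)/2, whose
  midpoint (a,(b-a)/2) is the centre of the hexagon.\<close>

definition central_rhombus :: "nat \<Rightarrow> nat \<Rightarrow> (int \<times> int) set set" where
  "central_rhombus a b =
     (let j0 = (int b - int a - 1) div 2 in {left_tri (int a - 1) j0, right_tri (int a) j0})"

definition ST :: "nat \<Rightarrow> nat \<Rightarrow> real" where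
  "ST a b = (\<Prod>i\<in>{1..a}. real (2*i + b - 1) / real (2*i - 1)) *
            (\<Prod>(i,j)\<in>{(i,j). 1 \<le> i \<and> i < j \<and> j \<le> a}. real (i + j + b - 1) / real (i + j - 1))"

definition Q :: "nat \<Rightarrow> nat \<Rightarrow> real" where
  "Q n x = 1/2 * (fact (2*n))^2 * fact (2*x) * fact (x + 2*n - 1)
             / ((fact n)^2 * fact x * fact (2*x + 4*n - 2)) *
           (\<Sum>i=0..<n. (-1)^(n - i - 1) / real (2*n - 2*i - 1) *
               pochhammer (real (x + n - i)) (2*i) / (fact i)^2)"

end

theory Submission
  imports Defs "Jordan_Normal_Form.Determinant" "HOL-Library.FuncSet"
begin

text \<open>A vertically symmetric tiling is determined by its left half, which is a tower of interlacing
  sets: the edges crossed by lozenges on each vertical lattice line.  The number of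
  towers with top \<open>S\<close> is \<open>\<Prod>\<^bsub>p<q\<in>S\<^esub> (q - p)\<close> divided by a superfactorial, so (centering the axis at \<open>0\<close>)
  one has to sum the Vandermonde product over all \<open>S \<subseteq> {-M..M}\<close> of size \<open>2n+1\<close> that contain \<open>0\<close>, where \<open>M = n + x\<close>.

  Order the elements of \<open>S\<close> by absolute value.  The sign of the Vandermonde determinant is then
  \<open>\<Prod>\<^sub>j sgn (z\<^sub>j)\<^sup>j\<close>, and summing over all signs of the entries leaves a checkerboard matrix; its
  determinant factors into one in the entries of even index and one in those of odd index.  Summing out
  the latter, which interlace the former, yields \<open>\<Sum> (\<Prod>\<^bsub>i<j\<^esub> (u\<^sub>j\<^sup>2 - u\<^sub>i\<^sup>2))\<^sup>2\<close> over
  \<open>0 = u\<^sub>0 < \<dots> < u\<^sub>n \<le> M\<close>.  In terms of the even discrete Chebyshev polynomials \<open>P\<^bsub>2k\<^esub>\<close> with norms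
  \<open>h\<^bsub>2k\<^esub>\<close> this is a multiple of \<open>(\<Prod>h\<^bsub>2k\<^esub>) (\<Sum>P\<^bsub>2k\<^esub>(0)\<^sup>2 / h\<^bsub>2k\<^esub>)\<close>; the product gives \<open>ST\<close>, and the sum
  gives \<open>Q\<close> because both satisfy the same first-order recurrence in \<open>n\<close> for fixed \<open>M\<close>.\<close>

section \<open>Determinants indexed by natural numbers\<close>

text \<open>The obstacle is that the Vandermonde product enters as an absolute value to the first
  power, so there is no second determinant to pair it with and orthogonality cannot be applied at
  once. Ordering by absolute value makes the sign a product over single entries. The price is that a
  set containing both v and -v has no unique such order, hence a weight 1/2 for every tie. The same
  halves turn out to be the endpoint weights of the trapezoid rule, and exactly for that rule the
  sum over an entry of odd index between its two even neighbours telescopes. This second determinant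
  equals the first up to a constant, which is where the square comes from. In the squared sum the
  entry pinned at 0 leaves one column of the Gram matrix that orthogonality does not reduce; summing
  over the polynomial placed in that column gives the Christoffel kernel at (0,0). The half-length M
  of the axis is the natural parameter: when n grows by 1 with M fixed, the vertical side 2(M - n)
  drops by 2 while the other sides grow by 2, and all closed forms are compared along this
  direction.\<close>

definition dt :: "nat \<Rightarrow> (nat \<Rightarrow> nat \<Rightarrow> real) \<Rightarrow> real" where
  "dt m f = det (mat m m (\<lambda>(i,j). f i j))"

definition vdm :: "nat \<Rightarrow> (nat \<Rightarrow> real) \<Rightarrow> real" where
  "vdm m x = (\<Prod>j<m. \<Prod>i<j. (x j - x i))"

lemma dt_leibniz: "dt m f = (\<Sum>p | p permutes {..<m}. signof p * (\<Prod>j<m. f (p j) j))"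
proof -
  have "dt m f = (\<Sum>p | p permutes {0..<m}. signof p * (\<Prod>j<m. mat m m (\<lambda>(i,j). f i j) $$ (p j, j)))"
    unfolding dt_def by (rule det_col) simp
  also have "\<dots> = (\<Sum>p | p permutes {0..<m}. signof p * (\<Prod>j<m. f (p j) j))"
  proof (intro sum.cong refl arg_cong2[where f="(*)"] prod.cong)
    fix p j assume "p \<in> {p. p permutes {0..<m}}" "j \<in> {..<m}"
    then have "p j < m" using permutes_in_image[of p "{0..<m}" j] by auto
    with \<open>j \<in> {..<m}\<close> show "mat m m (\<lambda>(i,j). f i j) $$ (p j, j) = f (p j) j" by simp
  qed
  finally show ?thesis by (simp add: atLeast0LessThan)
qed

lemma dt_cong:
  assumes "\<And>i j. i < m \<Longrightarrow> j < m \<Longrightarrow> f i j = g i j"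
  shows "dt m f = dt m g"
  unfolding dt_def using assms by (intro arg_cong[where f=det] cong_mat) auto

lemma dt_transpose: "dt m (\<lambda>i j. f j i) = dt m f"
proof -
  have "mat m m (\<lambda>(i,j). f j i) = transpose_mat (mat m m (\<lambda>(i,j). f i j))"
    by (intro eq_matI) auto
  then show ?thesis unfolding dt_def by (metis det_transpose mat_carrier)
qed

lemma dt_mult: "dt m (\<lambda>i j. \<Sum>k<m. f i k * g k j) = dt m f * dt m g"
proof -
  have "mat m m (\<lambda>(i,j). \<Sum>k<m. f i k * g k j) = mat m m (\<lambda>(i,j). f i j) * mat m m (\<lambda>(i,j). g i j)"
    by (intro eq_matI) (auto simp: scalar_prod_def atLeast0LessThan)
  then show ?thesis unfolding dt_def by (metis det_mult mat_carrier)
qed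

text \<open>Multilinearity in the columns. Read from right to left, it collapses a sum over tuples
  into one determinant whenever the ranges and weights of the entries are independent; the sums over
  gaps, over signs, over odd-indexed entries and over points of the Gram matrix are all taken this
  way.\<close>

lemma dt_sum_columns:
  assumes "\<And>j. j < m \<Longrightarrow> finite (A j)"
  shows "dt m (\<lambda>i j. \<Sum>y\<in>A j. w j y * f i j y) =
    (\<Sum>z\<in>PiE {..<m} A. (\<Prod>j<m. w j (z j)) * dt m (\<lambda>i j. f i j (z j)))"
proof -
  have "dt m (\<lambda>i j. \<Sum>y\<in>A j. w j y * f i j y) =
    (\<Sum>p | p permutes {..<m}. signof p * (\<Sum>z\<in>PiE {..<m} A. \<Prod>j<m. w j (z j) * f (p j) j (z j)))"
    unfolding dt_leibniz
    by (intro sum.cong refl arg_cong2[where f="(*)"] prod_sum_PiE) (use assms in auto)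
  also have "\<dots> = (\<Sum>z\<in>PiE {..<m} A. (\<Prod>j<m. w j (z j)) * dt m (\<lambda>i j. f i j (z j)))"
    unfolding dt_leibniz sum_distrib_left
    by (subst sum.swap) (simp add: prod.distrib mult_ac)
  finally show ?thesis .
qed

lemma dt_scale_columns: "dt m (\<lambda>i j. c j * f i j) = (\<Prod>j<m. c j) * dt m f"
  unfolding dt_leibniz by (simp add: prod.distrib sum_distrib_left mult_ac)

lemma dt_scale_rows: "dt m (\<lambda>i j. c i * f i j) = (\<Prod>j<m. c j) * dt m f"
  using dt_scale_columns[of m c "\<lambda>i j. f j i"] dt_transpose[of m "\<lambda>i j. c i * f i j"]
    dt_transpose[of m f] by simp

lemma dt_upper_triangular:
  assumes "\<And>i j. j < i \<Longrightarrow> i < m \<Longrightarrow> f i j = 0"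
  shows "dt m f = (\<Prod>i<m. f i i)"
proof -
  have "dt m f = prod_list (diag_mat (mat m m (\<lambda>(i,j). f i j)))"
    unfolding dt_def by (rule det_upper_triangular[of _ m]) (auto simp: assms)
  also have "diag_mat (mat m m (\<lambda>(i,j). f i j)) = map (\<lambda>i. f i i) [0..<m]"
    unfolding diag_mat_def by (intro map_cong) auto
  finally show ?thesis
    by (simp add: prod.distinct_set_conv_list[symmetric] atLeast0LessThan)
qed

lemma dt_lower_triangular:
  assumes "\<And>i j. i < j \<Longrightarrow> j < m \<Longrightarrow> f i j = 0"
  shows "dt m f = (\<Prod>i<m. f i i)"
  using dt_upper_triangular[of m "\<lambda>i j. f j i"] assms dt_transpose[of m f] by simp

lemma dt_permute_rows:
  assumes p: "p permutes {..<m}"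
  shows "dt m (\<lambda>i j. f (p i) j) = signof p * dt m f"
proof -
  have "mat m m (\<lambda>(i,j). f (p i) j) = mat m m (\<lambda>(i,j). mat m m (\<lambda>(i,j). f i j) $$ (p i, j))"
    using permutes_in_image[OF p] by (intro eq_matI) auto
  then show ?thesis unfolding dt_def
    using det_permute_rows[of "mat m m (\<lambda>(i,j). f i j)" m p] p
    by (simp add: atLeast0LessThan)
qed

lemma dt_permute:
  assumes p: "p permutes {..<m}"
  shows "dt m (\<lambda>i j. f (p i) (p j)) = dt m f"
proof -
  have "dt m (\<lambda>i j. f (p i) (p j)) = signof p * dt m (\<lambda>i j. f i (p j))"
    by (rule dt_permute_rows[OF p])
  also have "dt m (\<lambda>i j. f i (p j)) = signof p * dt m f"
    using dt_permute_rows[OF p, of "\<lambda>i j. f j i"] dt_transpose[of m f] dt_transpose[of m "\<lambda>i j. f i (p j)"]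
    by simp
  finally show ?thesis by (simp add: sign_def)
qed

lemma dt_block:
  assumes "\<And>i j. i < k \<Longrightarrow> k \<le> j \<Longrightarrow> j < k + l \<Longrightarrow> f i j = 0"
  shows "dt (k + l) f = dt k f * dt l (\<lambda>i j. f (k + i) (k + j))"
proof -
  let ?A = "mat k k (\<lambda>(i,j). f i j)" and ?D = "mat l l (\<lambda>(i,j). f (k+i) (k+j))"
    and ?C = "mat l k (\<lambda>(i,j). f (k+i) j)"
  have "mat (k+l) (k+l) (\<lambda>(i,j). f i j) = four_block_mat ?A (0\<^sub>m k l) ?C ?D"
    using assms by (intro eq_matI) (auto simp: four_block_mat_def Let_def)
  then show ?thesis unfolding dt_def
    by (metis det_four_block_mat_upper_right_zero mat_carrier)
qed

lemma dt_checkerboard: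
  assumes "\<And>i j. i < 2*n+1 \<Longrightarrow> j < 2*n+1 \<Longrightarrow> odd (i + j) \<Longrightarrow> f i j = 0"
  shows "dt (2*n+1) f = dt (n+1) (\<lambda>i j. f (2*i) (2*j)) * dt n (\<lambda>i j. f (2*i+1) (2*j+1))"
proof -
  \<comment> \<open>\<open>p\<close> lists the even indices 0, 2, ..., 2n and then the odd ones.
    Applied to rows and columns alike it costs no sign and makes the two off-diagonal blocks
    vanish.\<close>
  define p where "p i = (if i \<le> n then 2*i else if i < 2*n+1 then 2*(i-n-1)+1 else i)" for i :: nat
  have "p permutes {..<2*n+1}"
  proof (rule bij_imp_permutes)
    have "inj_on p {..<2*n+1}" unfolding p_def inj_on_def by (auto split: if_splits) presburger+
    moreover have "p ` {..<2*n+1} \<subseteq> {..<2*n+1}" unfolding p_def by (auto split: if_splits)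
    ultimately show "bij_betw p {..<2*n+1} {..<2*n+1}"
      by (simp add: bij_betw_def endo_inj_surj)
    show "p i = i" if "i \<notin> {..<2*n+1}" for i using that by (auto simp: p_def)
  qed
  then have "dt (2*n+1) f = dt (2*n+1) (\<lambda>i j. f (p i) (p j))" by (rule dt_permute[symmetric])
  also have "\<dots> = dt ((n+1)+n) (\<lambda>i j. f (p i) (p j))" by (simp add: mult_2)
  also have "\<dots> = dt (n+1) (\<lambda>i j. f (p i) (p j)) * dt n (\<lambda>i j. f (p (n+1+i)) (p (n+1+j)))"
    by (rule dt_block) (auto simp: p_def intro!: assms)
  also have "dt (n+1) (\<lambda>i j. f (p i) (p j)) = dt (n+1) (\<lambda>i j. f (2*i) (2*j))"
    by (rule dt_cong) (auto simp: p_def)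
  also have "dt n (\<lambda>i j. f (p (n+1+i)) (p (n+1+j))) = dt n (\<lambda>i j. f (2*i+1) (2*j+1))"
    by (rule dt_cong) (auto simp: p_def)
  finally show ?thesis .
qed

text \<open>Subtracting from each column its left neighbour turns the top row of ones into (1, 0,
  ..., 0), so the determinant drops one size. \<open>U\<close> is this unitriangular column
  operation and \<open>G\<close> is its result. Used backwards, it reassembles a larger determinant
  from telescoped sums.\<close>

lemma dt_column_differences:
  assumes "\<And>j. j \<le> n \<Longrightarrow> F 0 j = 1"
  shows "dt n (\<lambda>i j. F (Suc i) (Suc j) - F (Suc i) j) = dt (Suc n) F"
proof -
  define U where "U k j = (if k = j then 1 else if Suc k = j then - 1 else 0 :: real)" for k j :: nat
  define G where "G i j = (case j of 0 \<Rightarrow> F i 0 | Suc j' \<Rightarrow> F i (Suc j') - F i j')" for i j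
  have "dt (Suc n) F = dt (Suc n) F * dt (Suc n) U"
    by (subst dt_upper_triangular[of _ U]) (auto simp: U_def)
  also have "\<dots> = dt (Suc n) (\<lambda>i j. \<Sum>k<Suc n. F i k * U k j)" by (rule dt_mult[symmetric])
  also have "\<dots> = dt (Suc n) G"
  proof (rule dt_cong)
    fix i j assume "i < Suc n" "j < Suc n"
    have eq: "F i k * U k j = (if k = j then F i k else 0) + (if j \<noteq> 0 \<and> k = j - 1 then - F i k else 0)" for k
      by (auto simp: U_def)
    show "(\<Sum>k<Suc n. F i k * U k j) = G i j"
      unfolding eq sum.distrib G_def using \<open>j < Suc n\<close>
      by (cases j) (auto simp: sum.delta simp del: sum.lessThan_Suc)
  qed
  also have "\<dots> = dt (1 + n) G" by simp
  also have "\<dots> = dt 1 G * dt n (\<lambda>i j. G (1+i) (1+j))"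
    using assms by (intro dt_block) (auto simp: G_def split: nat.split)
  also have "dt 1 G = 1" using assms[of 0] by (subst dt_upper_triangular) (auto simp: G_def)
  finally show ?thesis by (simp add: G_def)
qed

section \<open>Vandermonde determinants in an arbitrary monic basis\<close>

lemma poly_newton_expansion:
  fixes p :: "real poly"
  assumes "degree p \<le> d"
  shows "\<exists>c. \<forall>t. poly p t = coeff p d * (\<Prod>l<d. t - x l) + (\<Sum>l<d. c l * (\<Prod>k<l. t - x k))"
  using assms
proof (induction d arbitrary: p)
  case 0
  then obtain a where "p = [:a:]" by (metis degree_eq_zeroE le_zero_eq)
  then show ?case by simp
next
  case (Suc d)
  define N where "N = (\<Prod>l<Suc d. [:- x l, 1:])"
  define r where "r = p - smult (coeff p (Suc d)) N"
  have degN: "degree N = Suc d" unfolding N_def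
    by (subst degree_prod_eq_sum_degree) auto
  have "lead_coeff N = 1" unfolding N_def by (simp add: lead_coeff_prod del: prod.lessThan_Suc)
  then have "coeff r (Suc d) = 0" using degN by (simp add: r_def)
  moreover have "degree r \<le> Suc d" unfolding r_def
    using Suc.prems degN by (intro degree_diff_le) (auto intro: order.trans[OF degree_smult_le])
  ultimately have "degree r \<le> d"
    by (metis Suc_leI eq_zero_or_degree_less less_Suc_eq_le degree_0 le0 order_le_less)
  then obtain c where c: "\<forall>t. poly r t = coeff r d * (\<Prod>l<d. t - x l) + (\<Sum>l<d. c l * (\<Prod>k<l. t - x k))"
    using Suc.IH by blast
  have "poly p t = coeff p (Suc d) * (\<Prod>l<Suc d. t - x l) + poly r t" for t
    by (simp add: r_def N_def poly_prod algebra_simps del: prod.lessThan_Suc)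
  then show ?case using c
    by (intro exI[of _ "\<lambda>l. if l = d then coeff r d else c l"]) simp
qed

text \<open>Expand each row in the Newton basis at the nodes \<open>x\<close> themselves. The change
  of basis \<open>U\<close> is unitriangular because the polynomials are monic, and \<open>V\<close>
  is triangular because a Newton polynomial vanishes at all earlier nodes. The freedom in the choice
  of basis is what every later summation exploits.\<close>

lemma dt_monic_vdm:
  fixes b :: "nat \<Rightarrow> real poly"
  assumes "\<And>i. i < m \<Longrightarrow> degree (b i) = i" and "\<And>i. i < m \<Longrightarrow> coeff (b i) i = 1"
  shows "dt m (\<lambda>i j. poly (b i) (x j)) = vdm m x"
proof -
  have "\<forall>i. \<exists>c. i < m \<longrightarrow> (\<forall>t. poly (b i) t = (\<Prod>l<i. t - x l) + (\<Sum>l<i. c l * (\<Prod>k<l. t - x k)))"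
  proof
    fix i
    show "\<exists>c. i < m \<longrightarrow> (\<forall>t. poly (b i) t = (\<Prod>l<i. t - x l) + (\<Sum>l<i. c l * (\<Prod>k<l. t - x k)))"
      using poly_newton_expansion[of "b i" i x] assms[of i] by (cases "i < m") auto
  qed
  then obtain c where c: "\<And>i t. i < m \<Longrightarrow>
      poly (b i) t = (\<Prod>l<i. t - x l) + (\<Sum>l<i. c i l * (\<Prod>k<l. t - x k))" by metis
  define U where "U i k = (if k = i then 1 else if k < i then c i k else 0)" for i k
  define V where "V k j = (\<Prod>l<k. x j - x l)" for k j
  have "dt m (\<lambda>i j. poly (b i) (x j)) = dt m (\<lambda>i j. \<Sum>k<m. U i k * V k j)"
  proof (rule dt_cong)
    fix i j assume "i < m" "j < m"
    have "(\<Sum>k<m. U i k * V k j) = (\<Sum>k<Suc i. U i k * V k j)"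
      using \<open>i < m\<close> by (intro sum.mono_neutral_right) (auto simp: U_def)
    then show "poly (b i) (x j) = (\<Sum>k<m. U i k * V k j)"
      using c[OF \<open>i < m\<close>] by (simp add: U_def V_def)
  qed
  also have "\<dots> = dt m U * dt m V" by (rule dt_mult)
  also have "dt m U = 1" by (subst dt_lower_triangular) (auto simp: U_def)
  also have "dt m V = vdm m x"
    unfolding vdm_def by (subst dt_upper_triangular) (auto simp: V_def)
  finally show ?thesis by simp
qed

lemma vdm_eq_0_iff: "vdm m x = 0 \<longleftrightarrow> \<not> inj_on x {..<m}"
proof -
  have "vdm m x = 0 \<longleftrightarrow> (\<exists>j<m. \<exists>i<j. x j = x i)" by (auto simp: vdm_def)
  also have "\<dots> \<longleftrightarrow> \<not> inj_on x {..<m}"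
  proof
    assume "\<exists>j<m. \<exists>i<j. x j = x i"
    then obtain i j where "j < m" "i < j" "x j = x i" by blast
    then show "\<not> inj_on x {..<m}" using inj_onD[of x "{..<m}" j i] by auto
  next
    assume "\<not> inj_on x {..<m}"
    then obtain i j where "i < m" "j < m" "x i = x j" "i \<noteq> j" by (auto simp: inj_on_def)
    then show "\<exists>j<m. \<exists>i<j. x j = x i" by (cases i j rule: linorder_cases) metis+
  qed
  finally show ?thesis .
qed

section \<open>Towers of interlacing sets\<close>

definition set_vdm :: "int set \<Rightarrow> real" where
  "set_vdm S = (\<Prod>(p,q)\<in>{(p,q). p \<in> S \<and> q \<in> S \<and> p < q}. real_of_int (q - p))"

definition below :: "int set \<Rightarrow> int \<Rightarrow> nat" where
  "below X j = card {x\<in>X. x < j}"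

text \<open>If y_0 < ... < y_k are the elements of \<open>Y\<close>, this says that \<open>X\<close>
  has exactly one element in each half-open gap y_i < x <= y_(i+1). The asymmetry comes from the
  skew coordinates. Counting below a height is the form in which a strip of the tiling delivers the
  condition.\<close>

definition interlaces :: "int set \<Rightarrow> int set \<Rightarrow> bool" where
  "interlaces X Y \<longleftrightarrow> finite X \<and> card Y = Suc (card X) \<and>
     (\<forall>j. below X (j+1) \<le> below Y j \<and> below Y j \<le> Suc (below X j))"

text \<open>These are Gelfand-Tsetlin patterns written as sets. The value {} above level
  \<open>k\<close> makes a tower, as a function on all of nat, determined by its levels, so that
  towers can be counted.\<close>

definition towers :: "nat \<Rightarrow> int set \<Rightarrow> (nat \<Rightarrow> int set) set" where
  "towers k Y = {X. X k = Y \<and> (\<forall>i>k. X i = {}) \<and> X 0 = {} \<and> (\<forall>i<k. interlaces (X i) (X (Suc i)))}"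

lemma abs_vdm_eq_set_vdm:
  assumes inj: "inj_on z {..<m}"
  shows "\<bar>vdm m (\<lambda>i. real_of_int (z i))\<bar> = set_vdm (z ` {..<m})"
proof -
  let ?P = "{(j,i). j < m \<and> i < j}"
  let ?f = "\<lambda>(j,i). (min (z j) (z i), max (z j) (z i))"
  have eq: "z i = z j \<longleftrightarrow> i = j" if "i < m" "j < m" for i j
    using inj that by (auto simp: inj_on_def)
  have P: "?P = (SIGMA j:{..<m}. {..<j})" by auto
  have "\<bar>vdm m (\<lambda>i. real_of_int (z i))\<bar> = (\<Prod>(j,i)\<in>?P. \<bar>real_of_int (z j) - real_of_int (z i)\<bar>)"
    unfolding vdm_def abs_prod P by (subst prod.Sigma) auto
  also have "\<dots> = (\<Prod>(j,i)\<in>?P. real_of_int (max (z j) (z i) - min (z j) (z i)))"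
    by (intro prod.cong) (auto simp: max_def min_def)
  also have "\<dots> = set_vdm (z ` {..<m})"
  proof -
    let ?R = "{(p,q). p \<in> z ` {..<m} \<and> q \<in> z ` {..<m} \<and> p < q}"
    have "inj_on ?f ?P"
    proof (rule inj_onI, clarify)
      fix j i j' i' assume "j < m" "i < j" "j' < m" "i' < j'"
        and e: "min (z j) (z i) = min (z j') (z i')" "max (z j) (z i) = max (z j') (z i')"
      from e have "z j = z j' \<and> z i = z i' \<or> z j = z i' \<and> z i = z j'"
        by (auto simp: max_def min_def split: if_splits)
      then show "j = j' \<and> i = i'"
        using eq \<open>j < m\<close> \<open>i < j\<close> \<open>j' < m\<close> \<open>i' < j'\<close> by (metis less_trans not_less_iff_gr_or_eq)
    qed
    moreover have "?f ` ?P = ?R"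
    proof
      have "min (z j) (z i) < max (z j) (z i)" if "j < m" "i < j" for i j
        using that eq[of i j] by (auto simp: min_def max_def)
      then show "?f ` ?P \<subseteq> ?R" by (auto simp: min_def max_def)
      show "?R \<subseteq> ?f ` ?P"
      proof clarify
        fix i j assume "i < m" "j < m" "z i < z j"
        then show "(z i, z j) \<in> ?f ` ?P"
          using image_eqI[of "(z i, z j)" ?f "(max i j, min i j)" ?P]
          by (cases i j rule: linorder_cases) auto
      qed
    qed
    ultimately have "bij_betw ?f ?P ?R" by (simp add: bij_betw_def)
    from prod.reindex_bij_betw[OF this, of "\<lambda>(p,q). real_of_int (q - p)"]
    show ?thesis by (simp add: set_vdm_def case_prod_unfold)
  qed
  finally show ?thesis .
qed

lemma vdm_nonneg:
  assumes "\<And>i j. i < j \<Longrightarrow> j < m \<Longrightarrow> x i \<le> x j"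
  shows "0 \<le> vdm m x"
  unfolding vdm_def using assms by (intro prod_nonneg ballI) simp

lemma ex_enumeration:
  fixes Y :: "int set"
  assumes "finite Y" "card Y = m"
  obtains y where "y ` {..<m} = Y" "\<And>i j. i < j \<Longrightarrow> j < m \<Longrightarrow> y i < y j"
proof
  let ?y = "\<lambda>i. sorted_list_of_set Y ! i"
  have len: "length (sorted_list_of_set Y) = m" using assms by simp
  show "?y ` {..<m} = Y"
    using assms len set_sorted_list_of_set[of Y] by (auto simp: set_conv_nth image_def) 
  show "?y i < ?y j" if "i < j" "j < m" for i j
    using strict_sorted_list_of_set[of Y] that len by (auto simp: sorted_wrt_iff_nth_less)
qed

section \<open>Interlacing sets as one choice from each gap\<close>

context
  fixes Y :: "int set" and y :: "nat \<Rightarrow> int" and k :: nat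
  assumes Y: "y ` {..<Suc k} = Y" and mono: "\<And>i j. i < j \<Longrightarrow> j < Suc k \<Longrightarrow> y i < y j"
begin

lemma mono_eq: "i < Suc k \<Longrightarrow> j < Suc k \<Longrightarrow> y i < y j \<longleftrightarrow> i < j"
  using mono[of i j] mono[of j i] by (cases i j rule: linorder_cases) auto

lemma inj_y: "inj_on y {..<Suc k}"
  using mono_eq by (intro inj_onI) (metis lessThan_iff linorder_neqE_nat order_less_irrefl)

lemma below_Y: "below Y j = card {i. i < Suc k \<and> y i < j}"
proof -
  have "{p \<in> Y. p < j} = y ` {i. i < Suc k \<and> y i < j}" using Y by auto
  moreover have "inj_on y {i. i < Suc k \<and> y i < j}" by (rule inj_on_subset[OF inj_y]) auto
  ultimately show ?thesis by (simp add: below_def card_image)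
qed

abbreviation "gaps \<equiv> PiE {..<k} (\<lambda>i. {y i<..y (Suc i)})"

lemma gaps_mono:
  assumes "z \<in> gaps" "i < j" "j < k"
  shows "z i < z j"
proof -
  have "z i \<le> y (Suc i)" "y j < z j" using assms by (auto simp: PiE_def Pi_def)
  moreover have "y (Suc i) \<le> y j" using mono[of "Suc i" j] assms by (cases "Suc i = j") auto
  ultimately show ?thesis by linarith
qed

lemma gaps_inj: "z \<in> gaps \<Longrightarrow> inj_on z {..<k}"
  using gaps_mono[of z] by (intro inj_onI) (metis lessThan_iff linorder_neqE_nat order_less_irrefl)

lemma gaps_bij: "bij_betw (\<lambda>z. z ` {..<k}) gaps {X. interlaces X Y}"
proof (rule bij_betw_imageI)
  show "inj_on (\<lambda>z. z ` {..<k}) gaps"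
  proof (rule inj_onI)
    fix z w assume z: "z \<in> gaps" and w: "w \<in> gaps" and e: "z ` {..<k} = w ` {..<k}"
    show "z = w"
    proof (rule PiE_ext[OF z w])
      fix i assume i: "i \<in> {..<k}"
      then obtain j where j: "j < k" "z i = w j" using e by (metis imageE imageI lessThan_iff)
      have "y i < z i" "z i \<le> y (Suc i)" "y j < w j" "w j \<le> y (Suc j)"
        using z w i j by (auto simp: PiE_def Pi_def)
      then have "y i < y (Suc j)" "y j < y (Suc i)" using j by auto
      then have "i = j" using mono_eq[of i "Suc j"] mono_eq[of j "Suc i"] i j by auto
      then show "z i = w i" using j by simp
    qed
  qed
  show "(\<lambda>z. z ` {..<k}) ` gaps = {X. interlaces X Y}"
  proof (intro equalityI subsetI)
    fix X assume "X \<in> (\<lambda>z. z ` {..<k}) ` gaps"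
    then obtain z where z: "z \<in> gaps" and X: "X = z ` {..<k}" by blast
    have zi: "y i < z i" "z i \<le> y (Suc i)" if "i < k" for i using z that by (auto simp: PiE_def Pi_def)
    have bX: "below X j = card {i. i < k \<and> z i < j}" for j
    proof -
      have "{p \<in> X. p < j} = z ` {i. i < k \<and> z i < j}" using X by auto
      moreover have "inj_on z {i. i < k \<and> z i < j}" by (rule inj_on_subset[OF gaps_inj[OF z]]) auto
      ultimately show ?thesis by (simp add: below_def card_image)
    qed
    have "below X (j+1) \<le> below Y j" for j
      unfolding bX below_Y using zi by (intro card_mono) (auto simp: less_Suc_eq, fastforce)
    moreover have "below Y j \<le> Suc (below X j)" for j
    proof -
      have "{i. i < Suc k \<and> y i < j} \<subseteq> insert 0 (Suc ` {i. i < k \<and> z i < j})"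
      proof
        fix i assume i: "i \<in> {i. i < Suc k \<and> y i < j}"
        show "i \<in> insert 0 (Suc ` {i. i < k \<and> z i < j})"
          using i zi[of "i - 1"] by (cases i) auto
      qed
      then have "below Y j \<le> card (insert 0 (Suc ` {i. i < k \<and> z i < j}))"
        unfolding below_Y by (intro card_mono) auto
      also have "\<dots> \<le> Suc (below X j)"
        unfolding bX by (rule order.trans[OF card_insert_le_m1]) (auto simp: card_image)
      finally show ?thesis .
    qed
    moreover have "card Y = Suc (card X)"
      using card_image[OF inj_y] card_image[OF gaps_inj[OF z]] Y X by simp
    ultimately show "X \<in> {X. interlaces X Y}" using X by (simp add: interlaces_def)
  next
    fix X assume "X \<in> {X. interlaces X Y}"
    then have fin: "finite X" and cX: "card X = k"
      and b1: "\<And>j. below X (j+1) \<le> below Y j" and b2: "\<And>j. below Y j \<le> Suc (below X j)"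
      using card_image[OF inj_y] Y by (auto simp: interlaces_def)
    have Yi: "below Y (y i) = i" "below Y (y i + 1) = Suc i" if "i < Suc k" for i
    proof -
      have le: "y i' \<le> y i \<longleftrightarrow> i' \<le> i" if "i' < Suc k" for i'
        using mono_eq[OF \<open>i < Suc k\<close> that] by auto
      have "{i'. i' < Suc k \<and> y i' < y i} = {..<i}" using mono_eq that by auto
      then show "below Y (y i) = i" by (simp add: below_Y)
      have "{i'. i' < Suc k \<and> y i' < y i + 1} = {..i}" using le that by auto
      then show "below Y (y i + 1) = Suc i" by (simp add: below_Y)
    qed
    \<comment> \<open>The upper bound of interlacing at height \<open>y i\<close> and the lower one
      at \<open>y i + 1\<close> squeeze this count to \<open>i\<close>; consecutive values then
      force an element of \<open>X\<close> into every gap.\<close>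
    have Xi: "below X (y i + 1) = i" if "i < Suc k" for i
      using b1[of "y i"] b2[of "y i + 1"] Yi[OF that] by simp
    have "\<exists>z. z \<in> X \<and> y i < z \<and> z \<le> y (Suc i)" if "i < k" for i
    proof -
      have "{x\<in>X. x < y i + 1} \<noteq> {x\<in>X. x < y (Suc i) + 1}"
        using Xi[of i] Xi[of "Suc i"] that unfolding below_def by auto
      moreover have "y i < y (Suc i)" using mono that by simp
      ultimately show ?thesis by fastforce
    qed
    then obtain z0 where z0: "\<And>i. i < k \<Longrightarrow> z0 i \<in> X \<and> y i < z0 i \<and> z0 i \<le> y (Suc i)" by metis
    define z where "z = restrict z0 {..<k}"
    have z: "z \<in> gaps" using z0 by (auto simp: z_def)
    have "z ` {..<k} \<subseteq> X" using z0 by (auto simp: z_def)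
    moreover have "card (z ` {..<k}) = card X" using card_image[OF gaps_inj[OF z]] cX by simp
    ultimately have "z ` {..<k} = X" using fin by (simp add: card_subset_eq)
    then show "X \<in> (\<lambda>z. z ` {..<k}) ` gaps" using z by blast
  qed
qed


text \<open>Rising factorials are the basis to use, since their sum over a half-open gap is exactly
  a difference of the next rising factorial at the two ends. Each column becomes such a difference,
  the differences reassemble into a Vandermonde determinant with one more point, and the constants
  1/(i+1) multiply to 1/k!.\<close>

lemma sum_gaps_vdm: "(\<Sum>z\<in>gaps. vdm k (\<lambda>i. real_of_int (z i))) = vdm (Suc k) (\<lambda>i. real_of_int (y i)) / fact k"
proof -
  define p :: "nat \<Rightarrow> real poly" where "p i = (\<Prod>l<i. [:real l, 1:])" for i
  have p_poch: "poly (p i) t = pochhammer t i" for i t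
    by (simp add: p_def poly_prod pochhammer_prod atLeast0LessThan add.commute)
  have deg: "degree (p i) = i" for i unfolding p_def by (subst degree_prod_eq_sum_degree) auto
  have lead: "coeff (p i) i = 1" for i
  proof -
    have "lead_coeff (p i) = 1" unfolding p_def by (simp add: lead_coeff_prod)
    then show ?thesis by (simp add: deg)
  qed
  have step: "pochhammer (t + 1) (Suc i) - pochhammer t (Suc i) = real (Suc i) * pochhammer (t + 1) i"
    for t :: real and i
    by (subst pochhammer_rec[of t], subst pochhammer_Suc[of "t+1"]) (simp add: algebra_simps)
  have "(\<Sum>t\<in>{a<..a + int d}. pochhammer (real_of_int t) i) =
      (pochhammer (real_of_int (a + int d)) (Suc i) - pochhammer (real_of_int a) (Suc i)) / real (Suc i)"
    for a d i
  proof (induction d)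
    case (Suc d)
    have "{a<..a + int (Suc d)} = insert (a + int d + 1) {a<..a + int d}" by auto
    then show ?case using Suc.IH step[of "real_of_int (a + int d)" i]
      by (simp add: field_simps)
  qed simp
  then have gap: "(\<Sum>t\<in>{a<..b}. pochhammer (real_of_int t) i) =
      (pochhammer (real_of_int b) (Suc i) - pochhammer (real_of_int a) (Suc i)) / real (Suc i)"
    if "a \<le> b" for a b i using that by (metis zle_iff_zadd)
  have "(\<Sum>z\<in>gaps. vdm k (\<lambda>i. real_of_int (z i))) =
     (\<Sum>z\<in>gaps. (\<Prod>j<k. 1) * dt k (\<lambda>i j. poly (p i) (real_of_int (z j))))"
    by (subst dt_monic_vdm) (auto simp: deg lead)
  also have "\<dots> = dt k (\<lambda>i j. \<Sum>t\<in>{y j<..y (Suc j)}. 1 * poly (p i) (real_of_int t))"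
    by (rule dt_sum_columns[symmetric]) simp
  also have "\<dots> = dt k (\<lambda>i j. (1 / real (Suc i)) *
      (poly (p (Suc i)) (real_of_int (y (Suc j))) - poly (p (Suc i)) (real_of_int (y j))))"
    using mono by (intro dt_cong) (simp add: p_poch gap less_imp_le del: of_nat_Suc)
  also have "\<dots> = (\<Prod>i<k. 1 / real (Suc i)) * dt (Suc k) (\<lambda>i j. poly (p i) (real_of_int (y j)))"
    by (subst dt_scale_rows, subst dt_column_differences) (auto simp: p_def)
  also have "dt (Suc k) (\<lambda>i j. poly (p i) (real_of_int (y j))) = vdm (Suc k) (\<lambda>i. real_of_int (y i))"
    by (rule dt_monic_vdm) (auto simp: deg lead)
  also have "(\<Prod>i<k. 1 / real (Suc i)) = 1 / fact k"
    by (simp add: fact_prod_Suc prod_dividef atLeast0LessThan)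
  finally show ?thesis by simp
qed

end

lemma finite_interlaces: "finite Y \<Longrightarrow> finite {X. interlaces X Y}"
proof (cases "card Y")
  case 0
  then show ?thesis by (simp add: interlaces_def)
next
  case (Suc k)
  assume "finite Y"
  from ex_enumeration[OF this Suc] obtain y where y: "y ` {..<Suc k} = Y"
    "\<And>i j. i < j \<Longrightarrow> j < Suc k \<Longrightarrow> y i < y j" by metis
  have "finite (PiE {..<k} (\<lambda>i. {y i<..y (Suc i)}))" by (intro finite_PiE) auto
  then show ?thesis using bij_betw_finite[OF gaps_bij[OF y]] by blast
qed

lemma sum_interlaces_set_vdm:
  assumes "finite Y" "card Y = Suc k"
  shows "(\<Sum>X | interlaces X Y. set_vdm X) = set_vdm Y / fact k"
proof -
  from ex_enumeration[OF assms] obtain y where y: "y ` {..<Suc k} = Y"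
    "\<And>i j. i < j \<Longrightarrow> j < Suc k \<Longrightarrow> y i < y j" by metis
  let ?G = "PiE {..<k} (\<lambda>i. {y i<..y (Suc i)})"
  have "(\<Sum>X | interlaces X Y. set_vdm X) = (\<Sum>z\<in>?G. set_vdm (z ` {..<k}))"
    using sum.reindex_bij_betw[OF gaps_bij[OF y], of set_vdm] by simp
  also have "\<dots> = (\<Sum>z\<in>?G. vdm k (\<lambda>i. real_of_int (z i)))"
  proof (rule sum.cong[OF refl])
    fix z assume z: "z \<in> ?G"
    have "0 \<le> vdm k (\<lambda>i. real_of_int (z i))"
      using gaps_mono[OF y z] by (intro vdm_nonneg) (simp add: less_imp_le)
    then show "set_vdm (z ` {..<k}) = vdm k (\<lambda>i. real_of_int (z i))"
      using abs_vdm_eq_set_vdm[OF gaps_inj[OF y z]] by simp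
  qed
  also have "\<dots> = vdm (Suc k) (\<lambda>i. real_of_int (y i)) / fact k" by (rule sum_gaps_vdm[OF y])
  also have "vdm (Suc k) (\<lambda>i. real_of_int (y i)) = set_vdm Y"
  proof -
    have "0 \<le> vdm (Suc k) (\<lambda>i. real_of_int (y i))"
      using y(2) by (intro vdm_nonneg) (simp add: less_imp_le)
    then show ?thesis using abs_vdm_eq_set_vdm[OF inj_y[OF y]] y(1) by simp
  qed
  finally show ?thesis .
qed

text \<open>Induction on the height: remove the top level and sum over all sets interlacing with it.
  Passing from size k to size k+1 contributes the factor 1/k!, whence the superfactorial.\<close>

lemma card_towers:
  assumes "finite Y" "card Y = k"
  shows "finite (towers k Y) \<and> real (card (towers k Y)) = set_vdm Y / (\<Prod>r<k. fact r)"
  using assms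
proof (induction k arbitrary: Y)
  case 0
  have "X = (\<lambda>_. {})" if "X \<in> towers 0 Y" for X
  proof (rule ext)
    fix i show "X i = {}" using 0 that by (cases "i = 0") (auto simp: towers_def)
  qed
  then have "towers 0 Y = {\<lambda>_. {}}" using 0 by (auto simp: towers_def)
  then show ?case using 0 by (simp add: set_vdm_def)
next
  case (Suc k)
  let ?g = "\<lambda>X. X(Suc k := Y)"
  have eq: "towers (Suc k) Y = (\<Union>Z\<in>{Z. interlaces Z Y}. ?g ` towers k Z)"
  proof (intro equalityI subsetI)
    fix X assume X: "X \<in> towers (Suc k) Y"
    let ?X = "X(Suc k := {})"
    have "?X \<in> towers k (X k)" "interlaces (X k) Y" "?g ?X = X" using X by (auto simp: towers_def)
    then show "X \<in> (\<Union>Z\<in>{Z. interlaces Z Y}. ?g ` towers k Z)"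
      by (metis (mono_tags, lifting) UN_I image_eqI mem_Collect_eq)
  next
    fix X assume "X \<in> (\<Union>Z\<in>{Z. interlaces Z Y}. ?g ` towers k Z)"
    then obtain Z X' where "interlaces Z Y" "X' \<in> towers k Z" "X = ?g X'" by blast
    then show "X \<in> towers (Suc k) Y" by (auto simp: towers_def less_Suc_eq)
  qed
  have Z: "finite Z" "card Z = k" if "interlaces Z Y" for Z using that Suc.prems by (auto simp: interlaces_def)
  have inj: "inj_on ?g (towers k Z)" for Z
  proof (rule inj_onI)
    fix X X' assume "X \<in> towers k Z" "X' \<in> towers k Z" and e: "?g X = ?g X'"
    then have "X (Suc k) = X' (Suc k)" by (simp add: towers_def)
    then show "X = X'" using e by (metis fun_upd_triv fun_upd_upd)
  qed
  have fin: "finite (?g ` towers k Z)" if "interlaces Z Y" for Z using Suc.IH[OF Z[OF that]] by simp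
  have disj: "?g ` towers k Z \<inter> ?g ` towers k Z' = {}" if "Z \<noteq> Z'" for Z Z'
  proof (rule ccontr)
    assume "?g ` towers k Z \<inter> ?g ` towers k Z' \<noteq> {}"
    then obtain X X' where "X \<in> towers k Z" "X' \<in> towers k Z'" "?g X = ?g X'" by blast
    moreover from this have "X k = X' k" by (metis fun_upd_other n_not_Suc_n)
    ultimately show False using that by (simp add: towers_def)
  qed
  have "card (towers (Suc k) Y) = (\<Sum>Z | interlaces Z Y. card (?g ` towers k Z))"
    unfolding eq using finite_interlaces[OF Suc.prems(1)] fin disj by (intro card_UN_disjoint) auto
  also have "\<dots> = (\<Sum>Z | interlaces Z Y. card (towers k Z))"
    by (simp add: card_image inj)
  finally have "real (card (towers (Suc k) Y)) = (\<Sum>Z | interlaces Z Y. set_vdm Z / (\<Prod>r<k. fact r))"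
    using Suc.IH[OF Z] by simp
  also have "\<dots> = set_vdm Y / fact k / (\<Prod>r<k. fact r)"
    using sum_interlaces_set_vdm[OF Suc.prems] by (simp add: sum_divide_distrib[symmetric])
  finally show ?case
    unfolding eq using finite_interlaces[OF Suc.prems(1)] fin by auto
qed

section \<open>Summing over signs\<close>

text \<open>A set with \<open>r\<close> pairs \<open>\<plusminus>v\<close> has \<open>2 ^ r\<close> enumerations by weakly increasing absolute value; the
  factor \<open>1/2\<close> per tie makes their weights add up to \<open>1\<close>.\<close>

definition abs_enums :: "int set \<Rightarrow> (nat \<Rightarrow> int) set" where
  "abs_enums S = {z \<in> extensional {..<card S}. z ` {..<card S} = S \<and>
     (\<forall>i j. i < j \<longrightarrow> j < card S \<longrightarrow> \<bar>z i\<bar> \<le> \<bar>z j\<bar>)}"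

definition tie :: "int \<Rightarrow> int \<Rightarrow> real" where
  "tie a b = (if \<bar>a\<bar> = \<bar>b\<bar> then 1/2 else 1)"

definition tie_weight :: "nat \<Rightarrow> (nat \<Rightarrow> int) \<Rightarrow> real" where
  "tie_weight m z = (\<Prod>j<m-1. tie (z j) (z (Suc j)))"

lemma abs_enums_inj: "z \<in> abs_enums S \<Longrightarrow> inj_on z {..<card S}"
  by (rule eq_card_imp_inj_on) (auto simp: abs_enums_def)

lemma finite_abs_enums: "finite S \<Longrightarrow> finite (abs_enums S)"
  by (rule finite_subset[OF _ finite_PiE[of "{..<card S}" "\<lambda>_. S"]]) (auto simp: abs_enums_def PiE_def)

lemma abs_enums_insert:
  assumes fin: "finite S" and t: "t \<in> S" and max: "\<And>s. s \<in> S \<Longrightarrow> \<bar>s\<bar> \<le> \<bar>t\<bar>" and card: "card S = Suc k"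
  shows "bij_betw (\<lambda>z. z(k := t)) (abs_enums (S - {t})) {z \<in> abs_enums S. z k = t}"
proof (rule bij_betw_imageI)
  have card': "card (S - {t}) = k" using card t fin by simp
  show "inj_on (\<lambda>z. z(k := t)) (abs_enums (S - {t}))"
  proof (rule inj_onI)
    fix z w assume "z \<in> abs_enums (S - {t})" "w \<in> abs_enums (S - {t})" and e: "z(k := t) = w(k := t)"
    then have "z k = w k" by (simp add: abs_enums_def card' extensional_def)
    then show "z = w" using e by (metis fun_upd_triv fun_upd_upd)
  qed
  show "(\<lambda>z. z(k := t)) ` abs_enums (S - {t}) = {z \<in> abs_enums S. z k = t}"
  proof (intro equalityI subsetI)
    fix z assume "z \<in> (\<lambda>z. z(k := t)) ` abs_enums (S - {t})"
    then obtain w where w: "w \<in> abs_enums (S - {t})" and z: "z = w(k := t)" by blast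
    have im: "w ` {..<k} = S - {t}" using w by (simp add: abs_enums_def card')
    have "z ` {..<Suc k} = S"
      using im t z by (auto simp: lessThan_Suc image_def less_Suc_eq)
    moreover have "\<bar>z i\<bar> \<le> \<bar>z j\<bar>" if "i < j" "j < Suc k" for i j
    proof (cases "j = k")
      case True
      have "w i \<in> S" using im that True by auto
      then show ?thesis using True that z max by auto
    next
      case False
      then show ?thesis using w that z by (auto simp: abs_enums_def card')
    qed
    moreover have "z \<in> extensional {..<Suc k}" using w z by (auto simp: abs_enums_def card' extensional_def)
    ultimately show "z \<in> {z \<in> abs_enums S. z k = t}" using z by (simp add: abs_enums_def card)
  next
    fix z assume "z \<in> {z \<in> abs_enums S. z k = t}"
    then have z: "z \<in> abs_enums S" and zk: "z k = t" by auto
    have inj: "inj_on z {..<Suc k}" using abs_enums_inj[OF z] card by simp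
    have im: "z ` {..<Suc k} = S" using z card by (simp add: abs_enums_def)
    define w where "w = z(k := undefined)"
    have "w ` {..<k} = z ` {..<k}" by (auto simp: w_def)
    also have "\<dots> = z ` ({..<Suc k} - {k})" by (auto intro!: arg_cong[where f="image z"])
    also have "\<dots> = S - {t}" using inj im zk by (subst inj_on_image_set_diff[OF inj]) auto
    finally have "w \<in> abs_enums (S - {t})"
      using z by (auto simp: abs_enums_def card card' w_def extensional_def)
    moreover have "z = w(k := t)" using zk by (auto simp: w_def)
    ultimately show "z \<in> (\<lambda>z. z(k := t)) ` abs_enums (S - {t})" by blast
  qed
qed

text \<open>The last entry can be any element of \<open>Top\<close>, the elements of largest
  absolute value, of which there are at most two, t and -t. If there are two, the one not chosen
  must come immediately before, so the last tie factor is 1/2; otherwise it is 1. In both cases it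
  is 1 / card \<open>Top\<close>, and these shares add up to 1.\<close>

lemma sum_tie_weight_abs_enums:
  assumes "finite S"
  shows "(\<Sum>z\<in>abs_enums S. tie_weight (card S) z) = 1"
  using assms
proof (induction "card S" arbitrary: S)
  case 0
  then have "abs_enums S = {\<lambda>_. undefined}" by (auto simp: abs_enums_def extensional_def)
  with 0 show ?case by (simp add: tie_weight_def)
next
  case (Suc k)
  have card: "card S = Suc k" and fin: "finite S" using Suc by auto
  define Top where "Top = {t\<in>S. \<forall>s\<in>S. \<bar>s\<bar> \<le> \<bar>t\<bar>}"
  have finTop: "finite Top" using fin by (simp add: Top_def)
  obtain t0 where t0: "t0 \<in> Top"
  proof -
    have "Max (abs ` S) \<in> abs ` S" using fin card by (intro Max_in) auto
    then obtain t where "t \<in> S" "\<bar>t\<bar> = Max (abs ` S)" by auto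
    then show ?thesis using that[of t] fin by (auto simp: Top_def)
  qed
  have Top_sub: "Top \<subseteq> {t0, - t0}" using t0 by (force simp: Top_def abs_if split: if_splits)
  have last_Top: "z k \<in> Top" if z: "z \<in> abs_enums S" for z
  proof -
    have im: "z ` {..<Suc k} = S" and le: "\<And>i j. i < j \<Longrightarrow> j < Suc k \<Longrightarrow> \<bar>z i\<bar> \<le> \<bar>z j\<bar>"
      using z card by (auto simp: abs_enums_def)
    have "\<bar>s\<bar> \<le> \<bar>z k\<bar>" if "s \<in> S" for s
      using that im le[of _ k] by (metis imageE lessI lessThan_iff less_Suc_eq order_refl)
    then show ?thesis using im by (auto simp: Top_def)
  qed
  have S': "card (S - {t}) = k" "finite (S - {t})" if "t \<in> Top" for t
    using that card fin by (auto simp: Top_def)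
  have part: "(\<Sum>z\<in>{z\<in>abs_enums S. z k = t}. tie_weight (Suc k) z) = 1 / real (card Top)"
    if t: "t \<in> Top" for t
  proof -
    have w: "tie_weight (Suc k) (z(k := t)) = tie_weight k z * (1 / real (card Top))"
      if z: "z \<in> abs_enums (S - {t})" for z
    proof (cases k)
      case 0
      then have "S = {t}" using card t by (auto simp: Top_def card_Suc_eq)
      then have "Top = {t}" using t by (auto simp: Top_def)
      then show ?thesis using 0 by (simp add: tie_weight_def)
    next
      case (Suc k')
      have im: "z ` {..<k} = S - {t}" and le: "\<And>i j. i < j \<Longrightarrow> j < k \<Longrightarrow> \<bar>z i\<bar> \<le> \<bar>z j\<bar>"
        using z S'[OF t] by (auto simp: abs_enums_def)
      have zk': "z k' \<in> S - {t}" using im Suc by auto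
      have "tie (z k') t = 1 / real (card Top)"
      proof (cases "Top = {t}")
        case True
        have "z k' \<notin> Top" using zk' True by auto
        then have "\<bar>z k'\<bar> \<noteq> \<bar>t\<bar>" using zk' t by (auto simp: Top_def)
        then show ?thesis using True by (simp add: tie_def)
      next
        case False
        then obtain t' where t': "t' \<in> Top" "t' \<noteq> t" using t by auto
        then have Top: "Top = {t, t'}" using t Top_sub by auto
        have "t' \<in> S - {t}" using t' by (auto simp: Top_def)
        then obtain i where "i < k" "z i = t'" using im by (metis imageE lessThan_iff)
        then have "\<bar>t'\<bar> \<le> \<bar>z k'\<bar>" using le[of i k'] Suc by (cases "i = k'") auto
        moreover have "\<bar>z k'\<bar> \<le> \<bar>t\<bar>" using zk' t by (auto simp: Top_def)
        moreover have "\<bar>t\<bar> \<le> \<bar>t'\<bar>" using t t' by (auto simp: Top_def)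
        ultimately show ?thesis using Top t' by (simp add: tie_def)
      qed
      then show ?thesis using Suc by (simp add: tie_weight_def)
    qed
    have "(\<Sum>z\<in>{z\<in>abs_enums S. z k = t}. tie_weight (Suc k) z) =
        (\<Sum>z\<in>abs_enums (S - {t}). tie_weight (Suc k) (z(k := t)))"
      using t fin card by (intro sum.reindex_bij_betw[OF abs_enums_insert, symmetric]) (auto simp: Top_def)
    also have "\<dots> = (\<Sum>z\<in>abs_enums (S - {t}). tie_weight k z) * (1 / real (card Top))"
      unfolding sum_distrib_right by (rule sum.cong[OF refl]) (rule w)
    also have "\<dots> = 1 / real (card Top)" using Suc(1)[of "S - {t}"] S'[OF t] by simp
    finally show ?thesis .
  qed
  have "(\<Sum>z\<in>abs_enums S. tie_weight (card S) z) =
      (\<Sum>t\<in>Top. \<Sum>z\<in>{z\<in>abs_enums S. z k = t}. tie_weight (Suc k) z)"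
    using last_Top by (subst sum.group) (auto simp: finite_abs_enums fin finTop card)
  also have "\<dots> = 1" using part finTop t0 by (simp add: card_gt_0_iff) auto
  finally show ?case .
qed

text \<open>The later entry dominates in absolute value, so each difference z_j - z_i is either zero
  or has the sign of z_j; the j differences ending in z_j contribute the j-th power of that
  sign.\<close>

lemma abs_vdm_sgn:
  fixes z :: "nat \<Rightarrow> int"
  assumes "\<And>i j. i < j \<Longrightarrow> j < m \<Longrightarrow> \<bar>z i\<bar> \<le> \<bar>z j\<bar>"
  shows "\<bar>vdm m (\<lambda>i. real_of_int (z i))\<bar> = (\<Prod>j<m. real_of_int (sgn (z j)) ^ j) * vdm m (\<lambda>i. real_of_int (z i))"
proof -
  have "\<bar>real_of_int (z j) - real_of_int (z i)\<bar> =
      real_of_int (sgn (z j)) * (real_of_int (z j) - real_of_int (z i))" if "i < j" "j < m" for i j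
    using assms[OF that] by (auto simp: sgn_if abs_if split: if_splits)
  then have "\<bar>vdm m (\<lambda>i. real_of_int (z i))\<bar> =
      (\<Prod>j<m. \<Prod>i<j. real_of_int (sgn (z j)) * (real_of_int (z j) - real_of_int (z i)))"
    unfolding vdm_def abs_prod by (intro prod.cong) auto
  also have "\<dots> = (\<Prod>j<m. real_of_int (sgn (z j)) ^ j) * vdm m (\<lambda>i. real_of_int (z i))"
    by (simp add: vdm_def prod.distrib)
  finally show ?thesis .
qed

section \<open>Sequences sorted by absolute value, and their signs\<close>

definition abs_sorted :: "nat \<Rightarrow> int \<Rightarrow> (nat \<Rightarrow> int) set" where
  "abs_sorted m M = {z \<in> PiE {..<m} (\<lambda>j. if j = 0 then {0} else {-M..M} - {0}).
     \<forall>i j. i < j \<longrightarrow> j < m \<longrightarrow> \<bar>z i\<bar> \<le> \<bar>z j\<bar>}"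

definition nonneg_sorted :: "nat \<Rightarrow> int \<Rightarrow> (nat \<Rightarrow> int) set" where
  "nonneg_sorted m M = {s \<in> PiE {..<m} (\<lambda>j. if j = 0 then {0} else {1..M}).
     \<forall>i j. i < j \<longrightarrow> j < m \<longrightarrow> s i \<le> s j}"

lemma finite_abs_sorted: "finite (abs_sorted m M)"
  unfolding abs_sorted_def by (rule finite_subset[OF Collect_restrict]) (auto intro: finite_PiE)

lemma finite_nonneg_sorted: "finite (nonneg_sorted m M)"
  unfolding nonneg_sorted_def by (rule finite_subset[OF Collect_restrict]) (auto intro: finite_PiE)

lemma sum_set_vdm_eq_abs_sorted:
  assumes "0 < m" "0 \<le> M"
  shows "(\<Sum>S | S \<subseteq> {-M..M} \<and> card S = m \<and> 0 \<in> S. set_vdm S) =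
    (\<Sum>z\<in>abs_sorted m M. tie_weight m z * \<bar>vdm m (\<lambda>i. real_of_int (z i))\<bar>)"
proof -
  let ?F = "{S. S \<subseteq> {-M..M} \<and> card S = m \<and> 0 \<in> S}"
  let ?I = "{z \<in> abs_sorted m M. inj_on z {..<m}}"
  let ?g = "\<lambda>z. tie_weight m z * \<bar>vdm m (\<lambda>i. real_of_int (z i))\<bar>"
  have finF: "finite ?F" by (rule finite_subset[of _ "Pow {-M..M}"]) auto
  have fib: "{z \<in> ?I. z ` {..<m} = S} = abs_enums S" if S: "S \<in> ?F" for S
  proof (intro equalityI subsetI)
    fix z assume "z \<in> {z \<in> ?I. z ` {..<m} = S}"
    then show "z \<in> abs_enums S" using S by (auto simp: abs_enums_def abs_sorted_def PiE_def)
  next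
    fix z assume z: "z \<in> abs_enums S"
    then have inj: "inj_on z {..<m}" using abs_enums_inj S by blast
    have im: "z ` {..<m} = S" and le: "\<And>i j. i < j \<Longrightarrow> j < m \<Longrightarrow> \<bar>z i\<bar> \<le> \<bar>z j\<bar>"
      using z S by (auto simp: abs_enums_def)
    obtain j where "j < m" "z j = 0" using im S by (metis (mono_tags, lifting) imageE lessThan_iff mem_Collect_eq)
    then have z0: "z 0 = 0" using le[of 0 j] by (cases j) auto
    then have "z j \<noteq> 0" if "0 < j" "j < m" for j
      using inj_onD[OF inj, of j 0] that by auto
    moreover have "z j \<in> {-M..M}" if "j < m" for j using im S that by blast
    ultimately show "z \<in> {z \<in> ?I. z ` {..<m} = S}"
      using inj im z z0 S by (auto simp: abs_sorted_def abs_enums_def PiE_def Pi_def)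
  qed
  have img: "z ` {..<m} \<in> ?F" if "z \<in> ?I" for z
  proof -
    have "z 0 = 0" "z ` {..<m} \<subseteq> {-M..M}"
      using that assms by (auto simp: abs_sorted_def PiE_def Pi_def split: if_splits)
    then show ?thesis using that assms by (auto simp: card_image image_iff)
  qed
  have "(\<Sum>z\<in>abs_sorted m M. ?g z) = (\<Sum>z\<in>?I. ?g z)"
  proof (rule sum.mono_neutral_right)
    have "vdm m (\<lambda>i. real_of_int (z i)) = 0" if "\<not> inj_on z {..<m}" for z
      using that by (auto simp: vdm_eq_0_iff inj_on_def)
    then show "\<forall>z\<in>abs_sorted m M - ?I. ?g z = 0" by auto
  qed (auto simp: finite_abs_sorted)
  also have "\<dots> = (\<Sum>S\<in>?F. \<Sum>z\<in>{z \<in> ?I. z ` {..<m} = S}. ?g z)"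
    using img finF finite_abs_sorted by (intro sum.group[symmetric]) auto
  also have "\<dots> = (\<Sum>S\<in>?F. \<Sum>z\<in>abs_enums S. tie_weight (card S) z * set_vdm S)"
  proof (rule sum.cong[OF refl], rule sum.cong)
    fix S z assume S: "S \<in> ?F" and z: "z \<in> abs_enums S"
    then show "?g z = tie_weight (card S) z * set_vdm S"
      using abs_vdm_eq_set_vdm[of z m] abs_enums_inj[OF z] by (auto simp: abs_enums_def)
  qed (use fib in auto)
  also have "\<dots> = (\<Sum>S\<in>?F. set_vdm S)"
    using finite_subset[of _ "{-M..M}"]
    by (intro sum.cong) (auto simp: sum_distrib_right[symmetric] sum_tie_weight_abs_enums)
  finally show ?thesis by simp
qed

text \<open>The condition \<open>P\<close> on the absolute values is kept abstract because it serves
  twice: as weak monotonicity here, and as injectivity when squares of Vandermonde products are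
  summed.\<close>

lemma sum_PiE_signs:
  fixes M :: int and m :: nat
  assumes P: "\<And>z w. (\<And>j. j < m \<Longrightarrow> z j = w j) \<Longrightarrow> P z = P w"
  shows "(\<Sum>z | z \<in> PiE {..<m} (\<lambda>j. if j = 0 then {0} else {-M..M} - {0}) \<and> P (\<lambda>j. \<bar>z j\<bar>). g z) =
    (\<Sum>s | s \<in> PiE {..<m} (\<lambda>j. if j = 0 then {0} else {1..M}) \<and> P s. \<Sum>z\<in>PiE {..<m} (\<lambda>j. {s j, - s j}). g z)"
proof -
  let ?A = "{z. z \<in> PiE {..<m} (\<lambda>j. if j = 0 then {0} else {-M..M} - {0}) \<and> P (\<lambda>j. \<bar>z j\<bar>)}"
  let ?S = "{s. s \<in> PiE {..<m} (\<lambda>j. if j = 0 then {0} else {1..M}) \<and> P s}"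
  define f where "f z = restrict (\<lambda>j. \<bar>z j\<bar>) {..<m}" for z :: "nat \<Rightarrow> int"
  have im: "f z \<in> ?S" if z: "z \<in> ?A" for z
  proof -
    have "\<bar>z j\<bar> \<in> (if j = 0 then {0} else {1..M})" if "j < m" for j
    proof -
      have "z j \<in> (if j = 0 then {0} else {-M..M} - {0})" using z that by (auto simp: PiE_def Pi_def)
      then show ?thesis by (auto split: if_splits)
    qed
    then have "f z \<in> PiE {..<m} (\<lambda>j. if j = 0 then {0} else {1..M})"
      unfolding f_def by (intro restrict_PiE_iff[THEN iffD2] ballI) simp
    moreover have "P (f z) = P (\<lambda>j. \<bar>z j\<bar>)" by (rule P) (simp add: f_def)
    ultimately show ?thesis using z by simp
  qed
  have fib: "{z \<in> ?A. f z = s} = PiE {..<m} (\<lambda>j. {s j, - s j})" if s: "s \<in> ?S" for s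
  proof (intro equalityI subsetI)
    fix z assume z: "z \<in> {z \<in> ?A. f z = s}"
    then have fz: "f z = s" and zE: "z \<in> PiE {..<m} (\<lambda>j. if j = 0 then {0} else {-M..M} - {0})" by simp_all
    have "s j = \<bar>z j\<bar>" if "j < m" for j using that by (simp add: f_def fz[symmetric])
    then have "z j \<in> {s j, - s j}" if "j < m" for j using that by (simp add: abs_if)
    then show "z \<in> PiE {..<m} (\<lambda>j. {s j, - s j})" using zE by (auto simp: PiE_def)
  next
    fix z assume z: "z \<in> PiE {..<m} (\<lambda>j. {s j, - s j})"
    have s0: "s j \<in> (if j = 0 then {0} else {1..M})" if "j < m" for j
      using s that by (auto simp: PiE_def Pi_def)
    have sz: "\<bar>z j\<bar> = s j" if "j < m" for j
      using z that s0[OF that] by (auto simp: PiE_def Pi_def split: if_splits)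
    have "z j \<in> (if j = 0 then {0} else {-M..M} - {0})" if "j < m" for j
      using s0[OF that] sz[OF that] by (auto split: if_splits)
    moreover have "P (\<lambda>j. \<bar>z j\<bar>) = P s" by (rule P) (simp add: sz)
    moreover have "z \<in> extensional {..<m}" using z by (simp add: PiE_def)
    ultimately have "z \<in> ?A" using s by (simp add: PiE_def Pi_def)
    moreover have "f z = s"
      using sz s by (intro ext) (auto simp: f_def PiE_def extensional_def restrict_def)
    ultimately show "z \<in> {z \<in> ?A. f z = s}" by simp
  qed
  have "finite ?A" by (rule finite_subset[OF _ finite_PiE[of "{..<m}" "\<lambda>j. if j = 0 then {0} else {-M..M} - {0}"]]) auto
  moreover have "finite ?S" by (rule finite_subset[OF _ finite_PiE[of "{..<m}" "\<lambda>j. if j = 0 then {0} else {1..M}"]]) auto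
  ultimately have "(\<Sum>z\<in>?A. g z) = (\<Sum>s\<in>?S. \<Sum>z\<in>{z \<in> ?A. f z = s}. g z)"
    using im by (intro sum.group[symmetric]) auto
  then show ?thesis using fib by simp
qed

lemma sum_abs_sorted_signs:
  "(\<Sum>z\<in>abs_sorted m M. g z) = (\<Sum>s\<in>nonneg_sorted m M. \<Sum>z\<in>PiE {..<m} (\<lambda>j. {s j, - s j}). g z)"
  unfolding abs_sorted_def nonneg_sorted_def
  by (rule sum_PiE_signs[where P = "\<lambda>s. \<forall>i j. i < j \<longrightarrow> j < m \<longrightarrow> s i \<le> s j"]) simp

section \<open>Even and odd bases, and the sum over signs\<close>

definition even_basis :: "nat \<Rightarrow> real \<Rightarrow> real" where
  "even_basis i u = (\<Prod>l<i. u\<^sup>2 - (real l)\<^sup>2)"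

text \<open>Together with \<open>even_basis\<close>, the central-factorial analogues of v^(2i+1) and
  u^(2i). They are chosen so that a trapezoid sum of an odd one is exactly a difference of even
  ones, as the integral of v^(2i+1) is for powers.\<close>

definition odd_basis :: "nat \<Rightarrow> real \<Rightarrow> real" where
  "odd_basis i v = v * (\<Prod>l<i. v\<^sup>2 - (real (Suc l))\<^sup>2)"

definition parity_basis :: "nat \<Rightarrow> real poly" where
  "parity_basis r = (if even r then \<Prod>l<r div 2. [:- (real l)\<^sup>2, 0, 1:]
            else [:0, 1:] * (\<Prod>l<r div 2. [:- (real (Suc l))\<^sup>2, 0, 1:]))"

lemma poly_parity_basis: "poly (parity_basis (2*i)) t = even_basis i t" "poly (parity_basis (Suc (2*i))) t = odd_basis i t"
  by (simp_all add: parity_basis_def even_basis_def odd_basis_def poly_prod power2_eq_square algebra_simps)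

lemma degree_parity_basis: "degree (parity_basis r) = r"
proof -
  have d: "degree (\<Prod>l<k. [:- c l, 0, 1:]) = 2 * k" "(\<Prod>l<k. [:- c l, 0, 1:]) \<noteq> 0" for k and c :: "nat \<Rightarrow> real"
    by (subst degree_prod_eq_sum_degree) auto
  show ?thesis unfolding parity_basis_def by (cases "even r") (auto simp: d degree_mult_eq simp del: mult_pCons_left)
qed

lemma coeff_parity_basis: "coeff (parity_basis r) r = 1"
proof -
  have "lead_coeff (\<Prod>l<k. [:- c l, 0, 1:]) = 1" for k and c :: "nat \<Rightarrow> real"
    by (simp add: lead_coeff_prod)
  then have "lead_coeff (parity_basis r) = 1" unfolding parity_basis_def by (simp only: lead_coeff_mult if_distrib) simp
  then show ?thesis by (simp add: degree_parity_basis)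
qed

lemma even_basis_minus: "even_basis i (- u) = even_basis i u"
  by (simp add: even_basis_def)

lemma odd_basis_minus: "odd_basis i (- u) = - odd_basis i u"
  by (simp add: odd_basis_def)

lemma dt_even_basis: "dt m (\<lambda>i j. even_basis i (x j)) = vdm m (\<lambda>j. (x j)\<^sup>2)"
proof -
  define p :: "nat \<Rightarrow> real poly" where "p i = (\<Prod>l<i. [:- (real l)\<^sup>2, 1:])" for i
  have "dt m (\<lambda>i j. poly (p i) ((x j)\<^sup>2)) = vdm m (\<lambda>j. (x j)\<^sup>2)"
  proof (rule dt_monic_vdm)
    have "lead_coeff (p i) = 1" for i by (simp add: p_def lead_coeff_prod)
    moreover show "degree (p i) = i" for i by (simp add: p_def degree_prod_eq_sum_degree)
    ultimately show "coeff (p i) i = 1" for i by metis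
  qed
  then show ?thesis by (simp add: p_def even_basis_def poly_prod algebra_simps)
qed

text \<open>In a monic basis of definite parity, summing column j over the sign of its entry
  multiplies row i by 1 + (-1)^(i+j). This leaves the checkerboard pattern and a factor 2 for each
  of the 2n nonzero entries.\<close>

lemma sum_signs_vdm:
  assumes s: "s \<in> nonneg_sorted (2*n+1) M"
  shows "(\<Sum>z\<in>PiE {..<2*n+1} (\<lambda>j. {s j, - s j}).
      (\<Prod>j<2*n+1. real_of_int (sgn (z j)) ^ j) * vdm (2*n+1) (\<lambda>i. real_of_int (z i))) =
    4 ^ n * vdm (Suc n) (\<lambda>k. (real_of_int (s (2*k)))\<^sup>2) * dt n (\<lambda>i k. odd_basis i (real_of_int (s (2*k+1))))"
proof -
  let ?m = "2*n+1"
  \<comment> \<open>Column 0 gets 1 instead of 2 because \<open>{s 0, - s 0}\<close> is the single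
    choice {0}; its odd rows vanish since odd polynomials are 0 there.\<close>
  define c where "c j = (if j = 0 then 1 else 2 :: real)" for j :: nat
  define f where "f i j = (if even (i + j) then poly (parity_basis i) (real_of_int (s j)) else 0)" for i j
  have par: "poly (parity_basis i) (- t) = (- 1) ^ i * poly (parity_basis i) t" for i t
    using poly_parity_basis[of "i div 2"] by (cases "even i") (auto elim!: evenE oddE simp: poly_parity_basis even_basis_minus odd_basis_minus)
  have "(\<Sum>z\<in>PiE {..<?m} (\<lambda>j. {s j, - s j}).
      (\<Prod>j<?m. real_of_int (sgn (z j)) ^ j) * vdm ?m (\<lambda>i. real_of_int (z i))) =
    (\<Sum>z\<in>PiE {..<?m} (\<lambda>j. {s j, - s j}).
      (\<Prod>j<?m. real_of_int (sgn (z j)) ^ j) * dt ?m (\<lambda>i j. poly (parity_basis i) (real_of_int (z j))))"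
    by (subst dt_monic_vdm) (simp_all only: degree_parity_basis coeff_parity_basis)
  also have "\<dots> = dt ?m (\<lambda>i j. \<Sum>y\<in>{s j, - s j}. real_of_int (sgn y) ^ j * poly (parity_basis i) (real_of_int y))"
    by (rule dt_sum_columns[symmetric]) simp
  also have "\<dots> = dt ?m (\<lambda>i j. c j * f i j)"
  proof (rule dt_cong)
    fix i j assume ij: "i < ?m" "j < ?m"
    have sj: "s j \<in> (if j = 0 then {0} else {1..M})" using s ij by (auto simp: nonneg_sorted_def PiE_def Pi_def)
    show "(\<Sum>y\<in>{s j, - s j}. real_of_int (sgn y) ^ j * poly (parity_basis i) (real_of_int y)) = c j * f i j"
    proof (cases "j = 0")
      case True
      have "poly (parity_basis i) 0 = 0" if "odd i" using that by (auto elim!: oddE simp: poly_parity_basis odd_basis_def)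
      then show ?thesis using sj True by (auto simp: c_def f_def)
    next
      case False
      then have "s j > 0" "s j \<noteq> - s j" using sj by auto
      then have "(\<Sum>y\<in>{s j, - s j}. real_of_int (sgn y) ^ j * poly (parity_basis i) (real_of_int y)) =
          (1 + (-1) ^ j * (-1) ^ i) * poly (parity_basis i) (real_of_int (s j))"
        by (simp add: par algebra_simps)
      then show ?thesis using False by (auto simp: c_def f_def power_add[symmetric] add.commute)
    qed
  qed
  also have "\<dots> = (\<Prod>j<?m. c j) * dt ?m f" by (rule dt_scale_columns)
  also have "(\<Prod>j<?m. c j) = 4 ^ n"
    by (simp add: c_def prod.lessThan_Suc_shift power_mult del: prod.lessThan_Suc)
  also have "dt ?m f = dt (n+1) (\<lambda>i j. f (2*i) (2*j)) * dt n (\<lambda>i j. f (2*i+1) (2*j+1))"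
    by (rule dt_checkerboard) (simp add: f_def)
  also have "dt (n+1) (\<lambda>i j. f (2*i) (2*j)) = vdm (Suc n) (\<lambda>k. (real_of_int (s (2*k)))\<^sup>2)"
    by (simp add: f_def poly_parity_basis dt_even_basis)
  also have "dt n (\<lambda>i j. f (2*i+1) (2*j+1)) = dt n (\<lambda>i k. odd_basis i (real_of_int (s (2*k+1))))"
    by (rule dt_cong) (simp add: f_def poly_parity_basis del: add_2_eq_Suc')
  finally show ?thesis by simp
qed


text \<open>The two tie factors give weight 1/2 at both ends and 1 inside, which is the trapezoid
  rule. For this rule the sum telescopes, because the average of \<open>odd_basis\<close> at
  neighbouring integers is a difference of \<open>even_basis\<close>. With p = q the single point
  would have weight 1/4, which is why strict inequality is assumed. The excluded point 0 would add
  nothing, as odd polynomials vanish there.\<close>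

lemma odd_basis_trapezoid_sum:
  fixes p q :: int
  assumes "0 \<le> p" "p < q"
  shows "(\<Sum>v\<in>{p..q} - {0}. tie p v * tie v q * odd_basis i (real_of_int v)) =
    (1 / (2 * real (Suc i))) * (even_basis (Suc i) (real_of_int q) - even_basis (Suc i) (real_of_int p))"
proof -
  define b where "b v = odd_basis i (real_of_int v)" for v
  define h where "h v = even_basis (Suc i) (real_of_int v) / (2 * real (Suc i))" for v
  have o: "odd_basis i (t + 1) + odd_basis i t = (even_basis (Suc i) (t + 1) - even_basis (Suc i) t) / real (Suc i)" for t
  proof -
    have e: "even_basis (Suc i) t = t * odd_basis i t" for t
      by (simp add: even_basis_def odd_basis_def prod.lessThan_Suc_shift power2_eq_square del: prod.lessThan_Suc)
    \<comment> \<open>Written in linear factors, the values at t and t + 1 share all factors but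
      one: t - i for the former, t + 1 + i for the latter. Cross-multiplication gives
      \<open>pr\<close>.\<close>
    have "odd_basis i t = (\<Prod>l<i. t + 1 + real l) * (\<Prod>l<i. t - real l) * (t - real i)
        \<and> odd_basis i (t + 1) = (\<Prod>l<i. t + 1 + real l) * (\<Prod>l<i. t - real l) * (t + 1 + real i)"
    proof (induction i)
      case (Suc i)
      define A B where "A = (\<Prod>l<i. t + 1 + real l)" and "B = (\<Prod>l<i. t - real l)"
      have "odd_basis (Suc i) t = odd_basis i t * (t\<^sup>2 - (real (Suc i))\<^sup>2)"
        and "odd_basis (Suc i) (t + 1) = odd_basis i (t + 1) * ((t + 1)\<^sup>2 - (real (Suc i))\<^sup>2)"
        by (simp_all only: odd_basis_def prod.lessThan_Suc mult.assoc)
      then show ?case using Suc.IH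
        by (simp only: prod.lessThan_Suc A_def[symmetric] B_def[symmetric])
          (simp add: power2_eq_square algebra_simps)
    qed (simp add: odd_basis_def)
    then have pr: "odd_basis i t * (t + 1 + real i) = odd_basis i (t + 1) * (t - real i)" by simp
    from pr have "real (Suc i) * (odd_basis i (t + 1) + odd_basis i t) = even_basis (Suc i) (t + 1) - even_basis (Suc i) t"
      unfolding e by (simp add: algebra_simps)
    then show ?thesis by (simp add: field_simps)
  qed
  have step: "(b (v + 1) + b v) / 2 = h (v + 1) - h v" for v
  proof -
    have "b (v + 1) + b v = (even_basis (Suc i) (real_of_int (v + 1)) - even_basis (Suc i) (real_of_int v)) / real (Suc i)"
      using o[of "real_of_int v"] by (simp add: b_def del: of_nat_Suc)
    then show ?thesis by (simp add: h_def diff_divide_distrib mult.commute del: of_nat_Suc)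
  qed
  have tot: "(\<Sum>v\<in>{p..p + int d}. b v) = h (p + int d) - h p + (b p + b (p + int d)) / 2" for d
  proof (induction d)
    case (Suc d)
    have "{p..p + int (Suc d)} = insert (p + int d + 1) {p..p + int d}" by auto
    then show ?case using Suc.IH step[of "p + int d"] by (simp add: field_simps add.commute)
  qed simp
  have "(\<Sum>v\<in>{p..q} - {0}. tie p v * tie v q * b v) = (\<Sum>v\<in>{p..q}. tie p v * tie v q * b v)"
    by (rule sum.mono_neutral_left) (auto simp: b_def odd_basis_def)
  also have "{p..q} = insert p (insert q {p<..<q})" using assms by auto
  also have "(\<Sum>v\<in>\<dots>. tie p v * tie v q * b v) = b p / 2 + (b q / 2 + (\<Sum>v\<in>{p<..<q}. b v))"
    using assms by (simp add: tie_def)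
  also have "\<dots> = (\<Sum>v\<in>insert p (insert q {p<..<q}). b v) - (b p + b q) / 2"
    using assms by (simp add: field_simps)
  also have "insert p (insert q {p<..<q}) = {p..p + int (nat (q - p))}" using assms by auto
  also have "(\<Sum>v\<in>\<dots>. b v) - (b p + b q) / 2 = h q - h p" using assms by (subst tot) simp
  finally show ?thesis using assms by (simp add: b_def h_def diff_divide_distrib less_imp_le)
qed

text \<open>The same mechanism as for gaps of interlacing sets, now with trapezoid sums: each column
  telescopes between consecutive \<open>u\<close>, and the differences form a Vandermonde
  determinant in the squares of the \<open>u\<close>.\<close>

lemma sum_odd_basis_interlacing:
  fixes u :: "nat \<Rightarrow> int"
  assumes "\<And>k. k \<le> n \<Longrightarrow> 0 \<le> u k" "\<And>k. k < n \<Longrightarrow> u k < u (Suc k)"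
  shows "(\<Sum>v\<in>PiE {..<n} (\<lambda>k. {u k..u (Suc k)} - {0}).
      (\<Prod>k<n. tie (u k) (v k) * tie (v k) (u (Suc k))) * dt n (\<lambda>i k. odd_basis i (real_of_int (v k)))) =
    vdm (Suc n) (\<lambda>k. (real_of_int (u k))\<^sup>2) / (2 ^ n * fact n)"
proof -
  have "(\<Sum>v\<in>PiE {..<n} (\<lambda>k. {u k..u (Suc k)} - {0}).
      (\<Prod>k<n. tie (u k) (v k) * tie (v k) (u (Suc k))) * dt n (\<lambda>i k. odd_basis i (real_of_int (v k)))) =
    dt n (\<lambda>i k. \<Sum>y\<in>{u k..u (Suc k)} - {0}. tie (u k) y * tie y (u (Suc k)) * odd_basis i (real_of_int y))"
    by (rule dt_sum_columns[symmetric]) simp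
  also have "\<dots> = dt n (\<lambda>i k. (1 / (2 * real (Suc i))) *
      (even_basis (Suc i) (real_of_int (u (Suc k))) - even_basis (Suc i) (real_of_int (u k))))"
    using assms by (intro dt_cong odd_basis_trapezoid_sum) auto
  also have "\<dots> = (\<Prod>i<n. 1 / (2 * real (Suc i))) * dt (Suc n) (\<lambda>i k. even_basis i (real_of_int (u k)))"
    by (subst dt_scale_rows, subst dt_column_differences) (auto simp: even_basis_def)
  also have "(\<Prod>i<n. 1 / (2 * real (Suc i))) = 1 / (2 ^ n * fact n)"
    by (simp add: prod_dividef prod.distrib fact_prod_Suc atLeast0LessThan del: of_nat_Suc)
  finally show ?thesis by (simp add: dt_even_basis)
qed

section \<open>Separating entries of even and odd index\<close>

definition strict_seqs :: "nat \<Rightarrow> int \<Rightarrow> (nat \<Rightarrow> int) set" where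
  "strict_seqs m M = {u \<in> PiE {..<m} (\<lambda>j. if j = 0 then {0} else {1..M}). \<forall>i j. i < j \<longrightarrow> j < m \<longrightarrow> u i < u j}"

lemma steps_imp_mono:
  fixes f :: "nat \<Rightarrow> int"
  assumes "\<And>j. Suc j < m \<Longrightarrow> f j \<le> f (Suc j)" "i \<le> j" "j < m"
  shows "f i \<le> f j"
  using assms(2,3)
proof (induction j rule: dec_induct)
  case (step j)
  then show ?case using assms(1)[of j] by simp
qed simp

text \<open>Weak monotonicity says precisely that the odd-indexed entries lie between consecutive
  even-indexed ones. The congruence assumption lets \<open>g\<close> be evaluated at reindexed
  functions whose values outside the range are arbitrary.\<close>

lemma nonneg_sorted_split:
  "(\<Sum>s\<in>nonneg_sorted (2*n+1) M. g (\<lambda>k. s (2*k)) (\<lambda>k. s (2*k+1))) =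
   (\<Sum>u\<in>nonneg_sorted (Suc n) M. \<Sum>v\<in>PiE {..<n} (\<lambda>k. {u k..u (Suc k)} - {0}). g u v)"
  if cong: "\<And>u u' v v'. (\<And>k. k \<le> n \<Longrightarrow> u k = u' k) \<Longrightarrow> (\<And>k. k < n \<Longrightarrow> v k = v' k) \<Longrightarrow> g u v = g u' v'"
proof -
  let ?V = "\<lambda>u. PiE {..<n} (\<lambda>k. {u k..u (Suc k)} - {0 :: int})"
  let ?W = "SIGMA u:nonneg_sorted (Suc n) M. ?V u"
  define f where "f s = (restrict (\<lambda>k. s (2*k)) {..<Suc n}, restrict (\<lambda>k. s (2*k+1)) {..<n})" for s :: "nat \<Rightarrow> int"
  define h where "h = (\<lambda>(u, v). restrict (\<lambda>j. if even j then u (j div 2) else v (j div 2) :: int) {..<2*n+1})"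
  have "(\<Sum>s\<in>nonneg_sorted (2*n+1) M. g (\<lambda>k. s (2*k)) (\<lambda>k. s (2*k+1))) = (\<Sum>(u,v)\<in>?W. g u v)"
  proof (rule sum.reindex_bij_witness[where j = f and i = h])
    fix s assume s: "s \<in> nonneg_sorted (2*n+1) M"
    have s0: "s j \<in> (if j = 0 then {0} else {1..M})" if "j < 2*n+1" for j
      using s that by (auto simp: nonneg_sorted_def PiE_def Pi_def)
    have sm: "s i \<le> s j" if "i < j" "j < 2*n+1" for i j
      using s that by (auto simp: nonneg_sorted_def)
    show "h (f s) = s"
    proof (rule ext)
      fix j show "h (f s) j = s j"
        using s by (auto simp: h_def f_def nonneg_sorted_def PiE_def extensional_def elim!: evenE oddE)
    qed
    have "restrict (\<lambda>k. s (2*k)) {..<Suc n} \<in> nonneg_sorted (Suc n) M"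
    proof -
      have "s (2*k) \<in> (if k = 0 then {0} else {1..M})" if "k < Suc n" for k using s0[of "2*k"] that by simp
      moreover have "s (2*i) \<le> s (2*j)" if "i < j" "j < Suc n" for i j using sm[of "2*i" "2*j"] that by simp
      ultimately show ?thesis unfolding nonneg_sorted_def by (simp add: PiE_def Pi_def)
    qed
    moreover have "restrict (\<lambda>k. s (2*k+1)) {..<n} \<in> ?V (restrict (\<lambda>k. s (2*k)) {..<Suc n})"
    proof -
      have "s (2*k) \<le> s (2*k+1) \<and> s (2*k+1) \<le> s (2 * Suc k) \<and> s (2*k+1) \<noteq> 0" if "k < n" for k
        using sm[of "2*k" "2*k+1"] sm[of "2*k+1" "2 * Suc k"] s0[of "2*k+1"] that by simp
      then show ?thesis by (simp add: PiE_def Pi_def)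
    qed
    ultimately show "f s \<in> ?W" by (simp add: f_def)
    show "(case f s of (u, v) \<Rightarrow> g u v) = g (\<lambda>k. s (2*k)) (\<lambda>k. s (2*k+1))"
      unfolding f_def by (auto intro!: cong)
  next
    fix w assume "w \<in> ?W"
    then obtain u v where w: "w = (u, v)" and u: "u \<in> nonneg_sorted (Suc n) M" and v: "v \<in> ?V u" by blast
    have u0: "u j \<in> (if j = 0 then {0} else {1..M})" if "j < Suc n" for j
      using u that by (auto simp: nonneg_sorted_def PiE_def Pi_def)
    have v0: "u k \<le> v k" "v k \<le> u (Suc k)" "v k \<noteq> 0" if "k < n" for k
      using v that by (auto simp: PiE_def Pi_def)
    have he: "h w (2*k) = u k" if "k < Suc n" for k using that by (simp add: w h_def)
    have ho: "h w (2*k+1) = v k" if "k < n" for k using that by (simp add: w h_def)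
    show "f (h w) = w"
    proof -
      have "restrict (\<lambda>k. h w (2*k)) {..<Suc n} = u"
        using he u by (intro ext) (auto simp: nonneg_sorted_def PiE_def extensional_def)
      moreover have "restrict (\<lambda>k. h w (2*k+1)) {..<n} = v"
        using ho v by (intro ext) (auto simp: PiE_def extensional_def)
      ultimately show ?thesis by (simp add: f_def w)
    qed
    have rng: "h w j \<in> (if j = 0 then {0} else {1..M})" if "j < 2*n+1" for j
    proof (cases "even j")
      case True
      then obtain k where "j = 2*k" by (elim evenE)
      then show ?thesis using he[of k] u0[of k] that by auto
    next
      case False
      then obtain k where k: "j = 2*k+1" by (elim oddE)
      then have "k < n" using that by simp
      then show ?thesis using k ho[of k] u0[of k] u0[of "Suc k"] v0[of k] by (auto split: if_splits)
    qed
    have "h w j \<le> h w (Suc j)" if "Suc j < 2*n+1" for j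
    proof (cases "even j")
      case True
      then obtain k where k: "j = 2*k" by (elim evenE)
      then have "k < n" using that by simp
      then show ?thesis using k he[of k] ho[of k] v0[of k] by simp
    next
      case False
      then obtain k where k: "j = 2*k+1" by (elim oddE)
      then have "k < n" "Suc j = 2 * Suc k" using that by simp_all
      then show ?thesis using k he[of "Suc k"] ho[of k] v0[of k] by simp
    qed
    then have "h w i \<le> h w j" if "i < j" "j < 2*n+1" for i j
      using steps_imp_mono[of "2*n+1" "h w" i j] that by simp
    moreover have "h w \<in> extensional {..<2*n+1}" by (simp add: h_def w)
    ultimately show "h w \<in> nonneg_sorted (2*n+1) M"
      using rng by (auto simp: nonneg_sorted_def PiE_def Pi_def)
  qed
  also have "\<dots> = (\<Sum>u\<in>nonneg_sorted (Suc n) M. \<Sum>v\<in>?V u. g u v)"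
    by (rule sum.Sigma[symmetric]) (auto simp: finite_nonneg_sorted intro!: finite_PiE)
  finally show ?thesis .
qed

lemma tie_weight_split:
  "tie_weight (2*n+1) s = (\<Prod>k<n. tie (s (2*k)) (s (2*k+1)) * tie (s (2*k+1)) (s (2 * Suc k)))"
proof (induction n)
  case (Suc n)
  then show ?case by (simp add: tie_weight_def)
qed (simp add: tie_weight_def)

text \<open>The even block gives one factor \<open>?D u\<close>, and summing out the odd block gives
  \<open>?D u\<close> once more. The constant combines 4^n from the signs with 1/(2^n n!) from the
  odd entries.\<close>

lemma sum_set_vdm_zero_mem:
  assumes "0 \<le> M"
  shows "(\<Sum>S | S \<subseteq> {-M..M} \<and> card S = 2*n+1 \<and> 0 \<in> S. set_vdm S) =
    2 ^ n / fact n * (\<Sum>u\<in>strict_seqs (Suc n) M. (vdm (Suc n) (\<lambda>k. (real_of_int (u k))\<^sup>2))\<^sup>2)"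
proof -
  let ?m = "2*n+1"
  let ?D = "\<lambda>u. vdm (Suc n) (\<lambda>k. (real_of_int (u k))\<^sup>2)"
  let ?w = "\<lambda>u v k. tie (u k) (v k) * tie (v k) (u (Suc k))"
  let ?o = "\<lambda>v. dt n (\<lambda>i k. odd_basis i (real_of_int (v k)))"
  let ?V = "\<lambda>u. PiE {..<n} (\<lambda>k. {u k..u (Suc k)} - {0 :: int})"
  have "(\<Sum>S | S \<subseteq> {-M..M} \<and> card S = ?m \<and> 0 \<in> S. set_vdm S) =
      (\<Sum>z\<in>abs_sorted ?m M. tie_weight ?m z *
        ((\<Prod>j<?m. real_of_int (sgn (z j)) ^ j) * vdm ?m (\<lambda>i. real_of_int (z i))))"
  proof (subst sum_set_vdm_eq_abs_sorted)
    show "(\<Sum>z\<in>abs_sorted ?m M. tie_weight ?m z * \<bar>vdm ?m (\<lambda>i. real_of_int (z i))\<bar>) =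
      (\<Sum>z\<in>abs_sorted ?m M. tie_weight ?m z *
        ((\<Prod>j<?m. real_of_int (sgn (z j)) ^ j) * vdm ?m (\<lambda>i. real_of_int (z i))))"
      by (intro sum.cong refl arg_cong2[where f="(*)"] abs_vdm_sgn) (auto simp: abs_sorted_def)
  qed (use assms in auto)
  also have "\<dots> = (\<Sum>s\<in>nonneg_sorted ?m M. tie_weight ?m s *
      (\<Sum>z\<in>PiE {..<?m} (\<lambda>j. {s j, - s j}). (\<Prod>j<?m. real_of_int (sgn (z j)) ^ j) * vdm ?m (\<lambda>i. real_of_int (z i))))"
    unfolding sum_abs_sorted_signs sum_distrib_left
  proof (intro sum.cong refl arg_cong2[where f="(*)"])
    fix s z :: "nat \<Rightarrow> int" assume "z \<in> PiE {..<?m} (\<lambda>j. {s j, - s j})"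
    then have "\<bar>z j\<bar> = \<bar>s j\<bar>" if "j < ?m" for j using that by (auto simp: PiE_def Pi_def abs_if)
    then show "tie_weight ?m z = tie_weight ?m s" by (auto simp: tie_weight_def tie_def intro!: prod.cong)
  qed
  also have "\<dots> = (\<Sum>s\<in>nonneg_sorted ?m M. 4 ^ n * ((\<Prod>k<n. ?w (\<lambda>k. s (2*k)) (\<lambda>k. s (2*k+1)) k) *
      ?D (\<lambda>k. s (2*k)) * ?o (\<lambda>k. s (2*k+1))))"
    by (intro sum.cong refl) (subst sum_signs_vdm, assumption, subst tie_weight_split, simp only: mult_ac)
  also have "\<dots> = (\<Sum>u\<in>nonneg_sorted (Suc n) M. \<Sum>v\<in>?V u. 4 ^ n * ((\<Prod>k<n. ?w u v k) * ?D u * ?o v))"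
  proof (rule nonneg_sorted_split)
    fix u u' v v' :: "nat \<Rightarrow> int"
    assume "\<And>k. k \<le> n \<Longrightarrow> u k = u' k" "\<And>k. k < n \<Longrightarrow> v k = v' k"
    then show "4 ^ n * ((\<Prod>k<n. ?w u v k) * ?D u * ?o v) = 4 ^ n * ((\<Prod>k<n. ?w u' v' k) * ?D u' * ?o v')"
      by (intro arg_cong2[where f="(*)"] refl prod.cong dt_cong) (auto simp: vdm_def intro!: prod.cong)
  qed
  also have "\<dots> = (\<Sum>u\<in>nonneg_sorted (Suc n) M. 4 ^ n * ?D u * (\<Sum>v\<in>?V u. (\<Prod>k<n. ?w u v k) * ?o v))"
    by (simp add: sum_distrib_left mult_ac)
  \<comment> \<open>If two even-indexed entries coincide, the factor \<open>?D u\<close> is already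
    0, so only the strict sequences required by the trapezoid sum remain.\<close>
  also have "\<dots> = (\<Sum>u\<in>strict_seqs (Suc n) M. 4 ^ n * ?D u * (\<Sum>v\<in>?V u. (\<Prod>k<n. ?w u v k) * ?o v))"
  proof (rule sum.mono_neutral_right)
    show "strict_seqs (Suc n) M \<subseteq> nonneg_sorted (Suc n) M"
      by (auto simp: strict_seqs_def nonneg_sorted_def less_imp_le)
    show "\<forall>u\<in>nonneg_sorted (Suc n) M - strict_seqs (Suc n) M.
        4 ^ n * ?D u * (\<Sum>v\<in>?V u. (\<Prod>k<n. ?w u v k) * ?o v) = 0"
    proof
      fix u assume u: "u \<in> nonneg_sorted (Suc n) M - strict_seqs (Suc n) M"
      then have le: "u i \<le> u j" if "i < j" "j < Suc n" for i j using that by (simp add: nonneg_sorted_def)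
      from u have "\<exists>i j. i < j \<and> j < Suc n \<and> \<not> u i < u j" by (simp add: strict_seqs_def nonneg_sorted_def)
      then obtain i j where ij: "i < j" "j < Suc n" "\<not> u i < u j" by blast
      then have "u i = u j" using le[of i j] by simp
      have "\<not> inj_on (\<lambda>k. (real_of_int (u k))\<^sup>2) {..<Suc n}"
      proof
        assume "inj_on (\<lambda>k. (real_of_int (u k))\<^sup>2) {..<Suc n}"
        from inj_onD[OF this, of i j] show False using ij \<open>u i = u j\<close> by simp
      qed
      then have "?D u = 0" by (simp add: vdm_eq_0_iff)
      then show "4 ^ n * ?D u * (\<Sum>v\<in>?V u. (\<Prod>k<n. ?w u v k) * ?o v) = 0" by simp
    qed
  qed (rule finite_nonneg_sorted)
  also have "\<dots> = (\<Sum>u\<in>strict_seqs (Suc n) M. 4 ^ n * ?D u * (?D u / (2 ^ n * fact n)))"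
  proof (intro sum.cong refl arg_cong2[where f="(*)"] sum_odd_basis_interlacing)
    fix u k assume u: "u \<in> strict_seqs (Suc n) M"
    show "0 \<le> u k" if "k \<le> n"
    proof -
      have "u k \<in> (if k = 0 then {0} else {1..M})" using u that by (auto simp: strict_seqs_def PiE_def Pi_def)
      then show ?thesis by (auto split: if_splits)
    qed
    show "u k < u (Suc k)" if "k < n" using u that by (auto simp: strict_seqs_def)
  qed
  also have "\<dots> = 2 ^ n / fact n * (\<Sum>u\<in>strict_seqs (Suc n) M. (?D u)\<^sup>2)"
  proof -
    have "4 ^ n = 2 ^ n * (2 ^ n :: real)" by (simp add: power_mult_distrib[symmetric])
    then show ?thesis by (simp add: sum_distrib_left power2_eq_square)
  qed
  finally show ?thesis .
qed

section \<open>Discrete Chebyshev polynomials\<close>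

text \<open>The recurrence coefficient is the classical \<open>m\<^sup>2 (N\<^sup>2 - m\<^sup>2) / (4 (4 m\<^sup>2 - 1))\<close> for monic discrete
  Chebyshev (Gram) polynomials on \<open>N = 2 M + 1\<close> points, here the points \<open>-M, \<dots>, M\<close>.\<close>

definition gram_coeff :: "nat \<Rightarrow> nat \<Rightarrow> real" where
  "gram_coeff M m = (real m)\<^sup>2 * ((2 * real M + 1)\<^sup>2 - (real m)\<^sup>2) / (4 * (4 * (real m)\<^sup>2 - 1))"

fun gram :: "nat \<Rightarrow> nat \<Rightarrow> real \<Rightarrow> real" where
  "gram M 0 x = 1"
| "gram M (Suc 0) x = x"
| "gram M (Suc (Suc m)) x = x * gram M (Suc m) x - gram_coeff M (Suc m) * gram M m x"

definition gram_weight :: "nat \<Rightarrow> real \<Rightarrow> real" where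
  "gram_weight M x = (real M - x) * (real M + 1 + x)"

text \<open>A second-order difference operator of Sturm-Liouville type; the recursively defined
  polynomials will be its eigenfunctions. Its weight vanishes at M and at -M-1, which removes both
  boundary terms in summation by parts over -M, ..., M.\<close>

definition gram_op :: "nat \<Rightarrow> (real \<Rightarrow> real) \<Rightarrow> real \<Rightarrow> real" where
  "gram_op M f x = gram_weight M x * (f (x + 1) - f x) - gram_weight M (x - 1) * (f x - f (x - 1))"

text \<open>This is the relation between consecutive coefficients that closes the induction for the
  structure relation in \<open>gram_difference_equations\<close>. After cancellation both
  coefficient terms have denominator 2(2m+3), which makes it a polynomial identity.\<close>

lemma gram_coeff_rec:
  "(4 * real m + 10) * gram_coeff M (m + 2) =
   (4 * real m + 2) * gram_coeff M (m + 1) + 2 * real M * (real M + 1) - (real m + 1) * (real m + 2)"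
proof -
  define k where "k = real m"
  have k: "k \<ge> 0" by (simp add: k_def)
  have a: "(4*k+10) * gram_coeff M (m+2) = (k+2)^2 * ((2 * real M + 1)^2 - (k+2)^2) / (2 * (2*k+3))"
  proof -
    have "gram_coeff M (m+2) = (k+2)^2 * ((2 * real M + 1)^2 - (k+2)^2) / ((4*k+10) * (2 * (2*k+3)))"
      by (simp add: gram_coeff_def k_def power2_eq_square algebra_simps)
    then show ?thesis using k by simp
  qed
  have b: "(4*k+2) * gram_coeff M (m+1) = (k+1)^2 * ((2 * real M + 1)^2 - (k+1)^2) / (2 * (2*k+3))"
  proof -
    have "gram_coeff M (m+1) = (k+1)^2 * ((2 * real M + 1)^2 - (k+1)^2) / ((4*k+2) * (2 * (2*k+3)))"
      by (simp add: gram_coeff_def k_def power2_eq_square algebra_simps)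
    then show ?thesis using k by simp
  qed
  have "(k+2)^2 * ((2 * real M + 1)^2 - (k+2)^2) =
    (k+1)^2 * ((2 * real M + 1)^2 - (k+1)^2) + (2 * (2*k+3)) * (2 * real M * (real M + 1) - (k+1) * (k+2))"
    by (simp add: power2_eq_square algebra_simps)
  then have "(4*k+10) * gram_coeff M (m+2) = (4*k+2) * gram_coeff M (m+1) +
     (2 * (2*k+3)) * (2 * real M * (real M + 1) - (k+1) * (k+2)) / (2 * (2*k+3))"
    unfolding a b by (simp add: add_divide_distrib)
  then show ?thesis using k by (simp add: k_def)
qed

text \<open>The second identity is the structure relation needed to carry the eigenvalue equation through
  the induction.\<close>

lemma gram_difference_equations:
  "(\<forall>x. gram_op M (gram M m) x = - real m * (real m + 1) * gram M m x) \<and>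
   (\<forall>x. gram_weight M x * gram M m (x + 1) - gram_weight M (x - 1) * gram M m (x - 1) =
      2 * real m * x * gram M m x - (4 * real m + 2) * gram M (Suc m) x)"
proof (induction m rule: induct_nat_012)
  case 0
  show ?case by (simp add: gram_op_def gram_weight_def algebra_simps)
next
  case 1
  show ?case by (simp add: gram_op_def gram_weight_def gram_coeff_def power2_eq_square field_simps)
next
  case (ge2 m)
  define P0 where "P0 = gram M m"
  define P1 where "P1 = gram M (Suc m)"
  define b where "b = gram_coeff M (Suc m)"
  define b' where "b' = gram_coeff M (Suc (Suc m))"
  define k where "k = real m"
  have P2: "gram M (Suc (Suc m)) x = x * P1 x - b * P0 x" for x by (simp add: P1_def P0_def b_def)
  have P3: "gram M (Suc (Suc (Suc m))) x = x * (x * P1 x - b * P0 x) - b' * P1 x" for x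
    by (simp add: P1_def P0_def b_def b'_def)
  have bb: "(4 * k + 10) * b' = (4 * k + 2) * b + 2 * real M * (real M + 1) - (k + 1) * (k + 2)"
    using gram_coeff_rec[of m M] by (simp add: b_def b'_def k_def)
  show ?case
  proof (intro conjI allI)
    fix x
    define u v where "u = gram_weight M x" and "v = gram_weight M (x - 1)"
    define p q r s where "p = P1 (x+1)" and "q = P1 (x-1)" and "r = P0 (x+1)" and "s = P0 (x-1)"
    have uv: "u + v = 2 * real M * (real M + 1) - 2 * x^2"
      by (simp add: u_def v_def gram_weight_def power2_eq_square algebra_simps)
    have L0: "u * (r - P0 x) - v * (P0 x - s) = - k * (k + 1) * P0 x"
      using ge2(1) by (simp add: gram_op_def P0_def k_def u_def v_def r_def s_def)
    have "u * (p - P1 x) - v * (P1 x - q) = - real (Suc m) * (real (Suc m) + 1) * P1 x"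
      using ge2(2) by (simp add: gram_op_def P1_def u_def v_def p_def q_def del: of_nat_Suc)
    then have L1: "u * (p - P1 x) - v * (P1 x - q) = - (k + 1) * (k + 2) * P1 x"
      by (simp add: k_def algebra_simps)
    have K0: "u * r - v * s = 2 * k * x * P0 x - (4 * k + 2) * P1 x"
      using ge2(1) by (simp add: P0_def P1_def k_def u_def v_def r_def s_def)
    have "u * p - v * q = 2 * real (Suc m) * x * P1 x - (4 * real (Suc m) + 2) * gram M (Suc (Suc m)) x"
      using ge2(2) by (simp add: P1_def u_def v_def p_def q_def del: of_nat_Suc gram.simps)
    then have K1: "u * p - v * q = 2 * (k + 1) * x * P1 x - (4 * k + 6) * (x * P1 x - b * P0 x)"
      unfolding P2 by (simp add: k_def algebra_simps)
    \<comment> \<open>Multiplication by x does not commute with the operator: the shifts to x + 1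
      and x - 1 leave the extra term u p - v q, and the structure relation \<open>K1\<close>
      evaluates it.\<close>
    have "gram_op M (gram M (Suc (Suc m))) x =
        x * (u * (p - P1 x) - v * (P1 x - q)) + (u * p - v * q) - b * (u * (r - P0 x) - v * (P0 x - s))"
      unfolding gram_op_def P2 by (simp add: u_def v_def p_def q_def r_def s_def algebra_simps)
    also have "\<dots> = - (k + 2) * (k + 3) * (x * P1 x - b * P0 x)"
      unfolding L0 L1 K1 by (simp add: algebra_simps)
    finally show "gram_op M (gram M (Suc (Suc m))) x =
        - real (Suc (Suc m)) * (real (Suc (Suc m)) + 1) * gram M (Suc (Suc m)) x"
      unfolding P2 by (simp add: k_def algebra_simps)
    have "gram_weight M x * gram M (Suc (Suc m)) (x + 1) - gram_weight M (x - 1) * gram M (Suc (Suc m)) (x - 1) =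
        x * (u * p - v * q) + (u * (p - P1 x) - v * (P1 x - q)) + (u + v) * P1 x - b * (u * r - v * s)"
      unfolding P2 by (simp add: u_def v_def p_def q_def r_def s_def algebra_simps)
    also have "\<dots> = 2 * (k + 2) * x * (x * P1 x - b * P0 x) - (4 * k + 10) * (x * (x * P1 x - b * P0 x))
        + ((4 * k + 2) * b + 2 * real M * (real M + 1) - (k + 1) * (k + 2)) * P1 x"
      unfolding K0 K1 L1 uv by (simp add: power2_eq_square algebra_simps)
    also have "\<dots> = 2 * (k + 2) * x * (x * P1 x - b * P0 x) - (4 * k + 10) * (x * (x * P1 x - b * P0 x) - b' * P1 x)"
      unfolding bb[symmetric] by (simp add: algebra_simps)
    finally show "gram_weight M x * gram M (Suc (Suc m)) (x + 1) - gram_weight M (x - 1) * gram M (Suc (Suc m)) (x - 1) =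
      2 * real (Suc (Suc m)) * x * gram M (Suc (Suc m)) x - (4 * real (Suc (Suc m)) + 2) * gram M (Suc (Suc (Suc m))) x"
      unfolding P2 P3 by (simp add: k_def algebra_simps)
  qed
qed

section \<open>Orthogonality and norms\<close>

definition gram_ip :: "nat \<Rightarrow> (real \<Rightarrow> real) \<Rightarrow> (real \<Rightarrow> real) \<Rightarrow> real" where
  "gram_ip M f g = (\<Sum>x\<in>{-int M..int M}. f (real_of_int x) * g (real_of_int x))"

lemma gram_op_self_adjoint: "gram_ip M (gram_op M f) g = gram_ip M f (gram_op M g)"
proof -
  \<comment> \<open>The weighted discrete Wronskian of \<open>f\<close> and \<open>g\<close>. The
    difference of the two inner products telescopes in it, and it vanishes at M and at -M-1 because
    the weight does.\<close>
  define W where "W x = gram_weight M x * (f (x + 1) * g x - f x * g (x + 1))" for x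
  have tele: "(\<Sum>x\<in>{a..a + int d}. W (real_of_int x) - W (real_of_int x - 1)) = W (real_of_int (a + int d)) - W (real_of_int a - 1)"
    for a d
  proof (induction d)
    case (Suc d)
    have "{a..a + int (Suc d)} = insert (a + int d + 1) {a..a + int d}" by auto
    then show ?case using Suc.IH by (simp add: ac_simps)
  qed simp
  have "gram_ip M (gram_op M f) g - gram_ip M f (gram_op M g) =
     (\<Sum>x\<in>{-int M..-int M + int (2 * M)}. W (real_of_int x) - W (real_of_int x - 1))"
    unfolding gram_ip_def sum_subtractf[symmetric]
    by (intro sum.cong) (auto simp: gram_op_def W_def algebra_simps)
  also have "\<dots> = 0" unfolding tele by (simp add: W_def gram_weight_def)
  finally show ?thesis by simp
qed

text \<open>Eigenfunctions of a self-adjoint operator for distinct eigenvalues: m(m+1) - k(k+1) =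
  (m-k)(m+k+1) is nonzero.\<close>

lemma gram_orthogonal: "m \<noteq> k \<Longrightarrow> gram_ip M (gram M m) (gram M k) = 0"
proof -
  assume "m \<noteq> k"
  let ?I = "gram_ip M (gram M m) (gram M k)"
  have "gram_ip M (gram_op M (gram M m)) (gram M k) = - (real m * (real m + 1)) * ?I"
    unfolding gram_ip_def by (simp add: gram_difference_equations sum_distrib_left mult_ac)
  moreover have "gram_ip M (gram M m) (gram_op M (gram M k)) = - (real k * (real k + 1)) * ?I"
    unfolding gram_ip_def by (simp add: gram_difference_equations sum_distrib_left mult_ac)
  ultimately have "(real m * (real m + 1) - real k * (real k + 1)) * ?I = 0"
    using gram_op_self_adjoint[of M "gram M m" "gram M k"] by (simp add: algebra_simps)
  moreover have "real m * (real m + 1) - real k * (real k + 1) = (real m - real k) * (real m + real k + 1)"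
    by (simp add: algebra_simps)
  ultimately show ?thesis using \<open>m \<noteq> k\<close> by simp
qed

text \<open>Expand one factor by the recurrence, move the multiplication by x to the other factor
  and expand that one; orthogonality removes everything except the coefficient term.\<close>

lemma gram_norm_Suc: "gram_ip M (gram M (Suc m)) (gram M (Suc m)) = gram_coeff M (Suc m) * gram_ip M (gram M m) (gram M m)"
proof -
  define c where "c = (if m = 0 then 0 else gram_coeff M m)"
  have rec: "gram M (Suc m) x = x * gram M m x - c * gram M (m - 1) x" for x
    by (cases m) (auto simp: c_def)
  have "gram_ip M (gram M (Suc m)) (gram M (Suc m)) =
      gram_ip M (\<lambda>x. x * gram M m x) (gram M (Suc m)) - c * gram_ip M (gram M (m - 1)) (gram M (Suc m))"
    unfolding gram_ip_def by (subst rec) (simp add: sum_distrib_left sum_subtractf[symmetric] algebra_simps)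
  also have "\<dots> = gram_ip M (gram M m) (\<lambda>x. x * gram M (Suc m) x)"
    by (simp add: gram_orthogonal) (simp add: gram_ip_def mult_ac)
  also have "\<dots> = gram_ip M (gram M m) (\<lambda>x. gram M (Suc (Suc m)) x + gram_coeff M (Suc m) * gram M m x)"
    by (simp add: gram_ip_def)
  also have "\<dots> = gram_ip M (gram M m) (gram M (Suc (Suc m))) + gram_coeff M (Suc m) * gram_ip M (gram M m) (gram M m)"
    unfolding gram_ip_def by (simp only: distrib_left sum.distrib sum_distrib_left mult_ac)
  finally show ?thesis by (simp add: gram_orthogonal)
qed

lemma gram_coeff_pos: "0 < m \<Longrightarrow> m \<le> 2 * M \<Longrightarrow> 0 < gram_coeff M m"
proof -
  assume m: "0 < m" "m \<le> 2 * M"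
  have "(real m)^2 < (2 * real M + 1)^2" using m by (intro power_strict_mono) auto
  moreover have "1 \<le> (real m)^2" using m by (intro one_le_power) simp
  then have "0 < 4 * (real m)^2 - 1" by linarith
  ultimately show ?thesis unfolding gram_coeff_def by (intro divide_pos_pos mult_pos_pos) (use m in auto)
qed

definition gram_norm :: "nat \<Rightarrow> nat \<Rightarrow> real" where
  "gram_norm M m = gram_ip M (gram M m) (gram M m)"

lemma gram_norm_0: "gram_norm M 0 = 2 * real M + 1"
  by (simp add: gram_norm_def gram_ip_def)

lemma gram_norm_rec: "gram_norm M (Suc m) = gram_coeff M (Suc m) * gram_norm M m"
  unfolding gram_norm_def by (rule gram_norm_Suc)

lemma gram_norm_pos: "m \<le> 2 * M \<Longrightarrow> 0 < gram_norm M m"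
  by (induction m) (simp_all add: gram_norm_0 gram_norm_rec gram_coeff_pos)

text \<open>The recurrence alternates parity, so the induction carries the odd polynomials as well,
  in the form x times a monic polynomial in x^2.\<close>

lemma gram_even_poly:
  "\<exists>q. degree q = k \<and> coeff q k = 1 \<and> (\<forall>x. gram M (2*k) x = poly q (x\<^sup>2))"
proof -
  have "(\<exists>q. degree q \<le> k \<and> coeff q k = 1 \<and> (\<forall>x. gram M (2*k) x = poly q (x\<^sup>2))) \<and>
    (\<exists>r. degree r \<le> k \<and> coeff r k = 1 \<and> (\<forall>x. gram M (2*k+1) x = x * poly r (x\<^sup>2)))"
  proof (induction k)
    case 0
    show ?case by (intro conjI exI[of _ 1]) auto
  next
    case (Suc k)
    then obtain q r where q: "degree q \<le> k" "coeff q k = 1" "\<forall>x. gram M (2*k) x = poly q (x\<^sup>2)"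
      and r: "degree r \<le> k" "coeff r k = 1" "\<forall>x. gram M (2*k+1) x = x * poly r (x\<^sup>2)" by blast
    let ?q = "pCons 0 r - smult (gram_coeff M (2*k+1)) q"
    let ?r = "?q - smult (gram_coeff M (2*k+2)) r"
    have "coeff q (Suc k) = 0" "coeff r (Suc k) = 0" using q r by (auto intro: coeff_eq_0)
    moreover have "degree ?q \<le> Suc k" "degree ?r \<le> Suc k"
      using q r by (auto intro!: degree_diff_le degree_pCons_le[THEN order.trans] degree_smult_le[THEN order.trans])
    moreover have "gram M (2 * Suc k) x = poly ?q (x\<^sup>2)" for x
      using q r by (simp add: power2_eq_square algebra_simps)
    moreover from this have "gram M (2 * Suc k + 1) x = x * poly ?r (x\<^sup>2)" for x
      using q r by (simp add: algebra_simps)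
    ultimately show ?case using r
      by (intro conjI exI[of _ ?q] exI[of _ ?r]) auto
  qed
  then obtain q where "degree q \<le> k" "coeff q k = 1" "\<forall>x. gram M (2*k) x = poly q (x\<^sup>2)" by blast
  then show ?thesis by (metis le_antisym le_degree zero_neq_one)
qed

lemma dt_gram: "dt m (\<lambda>i j. gram M (2*i) (x j)) = vdm m (\<lambda>j. (x j)\<^sup>2)"
proof -
  obtain q where q: "\<And>k. degree (q k) = k \<and> coeff (q k) k = 1 \<and> (\<forall>x. gram M (2*k) x = poly (q k) (x\<^sup>2))"
    using gram_even_poly[of _ M] by metis
  then have "dt m (\<lambda>i j. gram M (2*i) (x j)) = dt m (\<lambda>i j. poly (q i) ((x j)\<^sup>2))" by simp
  also have "\<dots> = vdm m (\<lambda>j. (x j)\<^sup>2)" by (rule dt_monic_vdm) (use q in auto)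
  finally show ?thesis .
qed

section \<open>The sum as a Christoffel kernel\<close>

text \<open>An injective tuple is its increasing rearrangement composed with a permutation. Index 0
  stays fixed because its entry is the pinned value 0, smaller than all others.\<close>

lemma sum_strict_seqs_permutations:
  fixes g :: "(nat \<Rightarrow> int) \<Rightarrow> real"
  shows "(\<Sum>w | w \<in> PiE {..<Suc n} (\<lambda>j. if j = 0 then {0} else {1..M}) \<and> inj_on w {..<Suc n}. g w) =
    (\<Sum>u\<in>strict_seqs (Suc n) M. \<Sum>p | p permutes {1..<Suc n}. g (u \<circ> p))"
proof -
  let ?I = "{..<Suc n}"
  let ?R = "\<lambda>j::nat. if j = 0 then {0} else {1..M}"
  let ?W = "{w. w \<in> PiE ?I ?R \<and> inj_on w ?I}"
  let ?P = "{p. p permutes {1..<Suc n}}"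
  have uR: "u j \<in> ?R j" if "u \<in> strict_seqs (Suc n) M" "j < Suc n" for u j
    using that by (simp add: strict_seqs_def PiE_def Pi_def)
  have ueq: "u i = u j \<longleftrightarrow> i = j" if "u \<in> strict_seqs (Suc n) M" "i < Suc n" "j < Suc n" for u i j
  proof -
    have "i < j \<Longrightarrow> j < Suc n \<Longrightarrow> u i < u j" for i j using that(1) by (simp add: strict_seqs_def)
    from this[of i j] this[of j i] show ?thesis using that by (cases i j rule: linorder_cases) auto
  qed
  have pl: "p j < Suc n \<longleftrightarrow> j < Suc n" "p 0 = 0" "p j = 0 \<longleftrightarrow> j = 0" if "p \<in> ?P" for p j
  proof -
    have p: "p permutes {1..<Suc n}" using that by simp
    show p0: "p 0 = 0" using p by (rule permutes_not_in) simp
    show "p j = 0 \<longleftrightarrow> j = 0" using permutes_inj[OF p] p0 by (metis injD)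
    show "p j < Suc n \<longleftrightarrow> j < Suc n"
      using permutes_in_image[OF p, of j] permutes_not_in[OF p, of j] p0 by (cases "j = 0") auto
  qed
  have "bij_betw (\<lambda>(u,p). u \<circ> p) (strict_seqs (Suc n) M \<times> ?P) ?W"
  proof (rule bij_betw_imageI)
    show "inj_on (\<lambda>(u,p). u \<circ> p) (strict_seqs (Suc n) M \<times> ?P)"
    proof (rule inj_onI, clarify)
      fix u p u' p'
      assume u: "u \<in> strict_seqs (Suc n) M" "u' \<in> strict_seqs (Suc n) M"
        and p: "p permutes {1..<Suc n}" "p' permutes {1..<Suc n}" and e: "u \<circ> p = u' \<circ> p'"
      have im: "u ` ?I = u' ` ?I"
      proof -
        have "v ` ?I = ?I" if "v permutes {1..<Suc n}" for v
          by (rule permutes_image, rule permutes_subset[OF that]) auto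
        from this[OF p(1)] this[OF p(2)] have "p ` ?I = ?I" "p' ` ?I = ?I" .
        then show ?thesis using e by (metis image_comp)
      qed
      have u_eq: "u j = u' j" if "j < Suc n" for j
        using that
      proof (induction j rule: less_induct)
        case (less j)
        \<comment> \<open>Two increasing sequences with the same image that agree before j: the
          value \<open>v' j\<close> occurs in \<open>v\<close>, but not before j, so it is at least
          \<open>v j\<close>. Exchanging the roles gives equality.\<close>
        have *: "v j \<le> v' j" if v: "v \<in> strict_seqs (Suc n) M" "v' \<in> strict_seqs (Suc n) M"
          and "v ` ?I = v' ` ?I" and IH: "\<And>i. i < j \<Longrightarrow> v i = v' i" for v v'
        proof -
          have "v' j \<in> v ` ?I" using that(3) less.prems by auto
          then obtain i where i: "i < Suc n" "v' j = v i" by auto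
          have "\<not> i < j" using IH[of i] i ueq[OF v(2), of i j] less.prems by auto
          then show ?thesis using i v by (cases "i = j") (auto simp: strict_seqs_def less_imp_le)
        qed
        show ?case using *[OF u im] *[OF u(2,1) im[symmetric]] less.IH less.prems by (metis antisym less_trans)
      qed
      have uu: "u = u'"
      proof
        fix j show "u j = u' j" using u_eq u by (cases "j < Suc n") (auto simp: strict_seqs_def PiE_def extensional_def)
      qed
      moreover have "p = p'"
      proof
        fix j
        show "p j = p' j"
        proof (cases "j < Suc n")
          case True
          have "u (p j) = u (p' j)" using fun_cong[OF e, of j] uu by simp
          then show ?thesis using ueq[OF u(1)] pl(1)[of p j] pl(1)[of p' j] p True by simp
        next
          case False
          then show ?thesis using permutes_not_in[OF p(1)] permutes_not_in[OF p(2)] by simp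
        qed
      qed
      ultimately show "u = u' \<and> p = p'" by simp
    qed
    show "(\<lambda>(u,p). u \<circ> p) ` (strict_seqs (Suc n) M \<times> ?P) = ?W"
    proof (intro equalityI subsetI)
      fix w assume "w \<in> (\<lambda>(u,p). u \<circ> p) ` (strict_seqs (Suc n) M \<times> ?P)"
      then obtain u p where u: "u \<in> strict_seqs (Suc n) M" and p: "p \<in> ?P" and w: "w = u \<circ> p" by auto
      have "w j \<in> ?R j" if "j < Suc n" for j using uR[OF u, of "p j"] pl(1)[OF p, of j] pl(3)[OF p, of j] that w by simp
      moreover have "w j = undefined" if "\<not> j < Suc n" for j
        using pl(1)[OF p, of j] that u w by (simp add: strict_seqs_def PiE_def extensional_def)
      moreover have "inj_on w ?I"
      proof (rule inj_onI)
        fix i j assume "i \<in> ?I" "j \<in> ?I" "w i = w j"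
        then have "p i = p j" using ueq[OF u, of "p i" "p j"] pl[OF p] w by simp
        then show "i = j" using p permutes_inj by (metis injD mem_Collect_eq)
      qed
      ultimately show "w \<in> ?W" by (simp add: PiE_def Pi_def extensional_def)
    next
      fix w assume w: "w \<in> ?W"
      then have wR: "w j \<in> ?R j" if "j < Suc n" for j using that by (simp add: PiE_def Pi_def)
      have inj: "inj_on w ?I" using w by simp
      from ex_enumeration[of "w ` ?I" "Suc n"] inj obtain y where y: "y ` ?I = w ` ?I"
        "\<And>i j. i < j \<Longrightarrow> j < Suc n \<Longrightarrow> y i < y j" by (auto simp: card_image simp del: lessThan_Suc)
      define u where "u = restrict y ?I"
      define p where "p j = (if j < Suc n then the_inv_into ?I y (w j) else j)" for j
      have injy: "inj_on y ?I"
        using y(2) by (intro inj_onI) (metis lessThan_iff linorder_neqE_nat order_less_irrefl)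
      have yp: "y (p j) = w j" "p j < Suc n" if "j < Suc n" for j
      proof -
        have "w j \<in> y ` ?I" using y(1) that by blast
        then show "y (p j) = w j" "p j < Suc n"
          using f_the_inv_into_f[OF injy] the_inv_into_into[OF injy, of "w j" ?I] that by (auto simp: p_def)
      qed
      have y0: "y 0 = 0"
      proof -
        have nn: "0 \<le> y i" if "i < Suc n" for i
        proof -
          have "y i \<in> w ` ?I" using y(1) that by blast
          then obtain j where "j < Suc n" "y i = w j" by auto
          then show ?thesis using wR[of j] by (auto split: if_splits)
        qed
        have w0: "w 0 = 0" using wR[of 0] by simp
        have "y (p 0) = 0" using yp(1)[of 0] w0 by simp
        then show ?thesis using nn[of 0] y(2)[of 0 "p 0"] yp(2)[of 0] by (cases "p 0 = 0") auto
      qed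
      have "p permutes {1..<Suc n}"
      proof (rule bij_imp_permutes)
        have pne: "p j \<noteq> 0" if "j \<in> {1..<Suc n}" for j
        proof
          assume "p j = 0"
          then have "w j = 0" using yp[of j] y0 that by simp
          then show False using wR[of j] that by simp
        qed
        have "inj_on p {1..<Suc n}"
        proof (rule inj_onI)
          fix i j assume "i \<in> {1..<Suc n}" "j \<in> {1..<Suc n}" "p i = p j"
          then show "i = j" using yp(1)[of i] yp(1)[of j] inj_onD[OF inj, of i j] by simp
        qed
        moreover have "p ` {1..<Suc n} \<subseteq> {1..<Suc n}" using yp(2) pne by fastforce
        ultimately show "bij_betw p {1..<Suc n} {1..<Suc n}" by (simp add: bij_betw_def endo_inj_surj)
        fix j assume "j \<notin> {1..<Suc n}"
        then show "p j = j"
          using yp[of 0] y0 wR[of 0] inj_onD[OF injy, of "p 0" 0] by (cases "j = 0") (auto simp: p_def)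
      qed
      moreover have "u \<in> strict_seqs (Suc n) M"
      proof -
        have "y j \<in> ?R j" if "j < Suc n" for j
        proof (cases "j = 0")
          case True
          then show ?thesis using y0 by simp
        next
          case False
          have "y j \<in> w ` ?I" using y(1) that by blast
          then obtain i where i: "i < Suc n" "y j = w i" by auto
          have "0 < y j" using y(2)[of 0 j] y0 that False by simp
          then show ?thesis using i wR[of i] False by (auto split: if_splits)
        qed
        then show ?thesis using y(2) by (simp add: strict_seqs_def u_def PiE_def Pi_def)
      qed
      moreover have "w = u \<circ> p"
      proof
        fix j show "w j = (u \<circ> p) j"
          using yp[of j] w by (cases "j < Suc n") (auto simp: u_def p_def PiE_def extensional_def)
      qed
      ultimately show "w \<in> (\<lambda>(u,p). u \<circ> p) ` (strict_seqs (Suc n) M \<times> ?P)" by force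
    qed
  qed
  from sum.reindex_bij_betw[OF this, of g] show ?thesis
    by (simp add: sum.cartesian_product case_prod_unfold)
qed


lemma vdm_square_permute:
  assumes p: "p permutes {..<m}"
  shows "(vdm m (\<lambda>j. (x (p j))\<^sup>2))\<^sup>2 = (vdm m (\<lambda>j. (x j)\<^sup>2))\<^sup>2"
proof -
  have "dt m (\<lambda>i j. even_basis i (x (p j))) = signof p * dt m (\<lambda>i j. even_basis i (x j))"
    using dt_permute_rows[OF p, of "\<lambda>j i. even_basis i (x j)"] dt_transpose[of m "\<lambda>i j. even_basis i (x j)"]
      dt_transpose[of m "\<lambda>i j. even_basis i (x (p j))"] by simp
  then show ?thesis by (simp add: dt_even_basis power_mult_distrib sign_def)
qed

text \<open>Makes the unpinned entries independent, as orthogonality requires. Each increasing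
  sequence is counted once for each of the 2^n signs and n! orders, while tuples with coinciding
  squares contribute 0.\<close>

lemma sum_tuples_vdm_square:
  fixes M :: int
  assumes M: "0 \<le> M"
  shows "(\<Sum>z\<in>PiE {..<Suc n} (\<lambda>j. if j = 0 then {0} else {-M..M}). (vdm (Suc n) (\<lambda>j. (real_of_int (z j))\<^sup>2))\<^sup>2) =
    2 ^ n * fact n * (\<Sum>u\<in>strict_seqs (Suc n) M. (vdm (Suc n) (\<lambda>j. (real_of_int (u j))\<^sup>2))\<^sup>2)"
proof -
  let ?I = "{..<Suc n}"
  let ?g = "\<lambda>z. (vdm (Suc n) (\<lambda>j. (real_of_int (z j))\<^sup>2))\<^sup>2"
  let ?P = "\<lambda>s :: nat \<Rightarrow> int. inj_on s ?I"
  let ?A = "{z. z \<in> PiE ?I (\<lambda>j. if j = 0 then {0} else {-M..M} - {0}) \<and> ?P (\<lambda>j. \<bar>z j\<bar>)}"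
  have "(\<Sum>z\<in>PiE ?I (\<lambda>j. if j = 0 then {0} else {-M..M}). ?g z) = (\<Sum>z\<in>?A. ?g z)"
  proof (rule sum.mono_neutral_right)
    show "finite (PiE ?I (\<lambda>j. if j = 0 then {0} else {-M..M}))" by (intro finite_PiE) auto
    show "?A \<subseteq> PiE ?I (\<lambda>j. if j = 0 then {0} else {-M..M})" by (fastforce simp: PiE_def Pi_def)
    show "\<forall>z\<in>PiE ?I (\<lambda>j. if j = 0 then {0} else {-M..M}) - ?A. ?g z = 0"
    proof (intro ballI, rule ccontr)
      fix z assume z: "z \<in> PiE ?I (\<lambda>j. if j = 0 then {0} else {-M..M}) - ?A" and "?g z \<noteq> 0"
      then have inj: "inj_on (\<lambda>j. (real_of_int (z j))\<^sup>2) ?I" using vdm_eq_0_iff[of "Suc n"] by auto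
      have abs_inj: "?P (\<lambda>j. \<bar>z j\<bar>)"
      proof (rule inj_onI)
        fix i j assume ij: "i \<in> ?I" "j \<in> ?I" "\<bar>z i\<bar> = \<bar>z j\<bar>"
        then have "(real_of_int (z i))\<^sup>2 = (real_of_int (z j))\<^sup>2" by (auto simp: abs_eq_iff)
        then show "i = j" using inj_onD[OF inj, of i j] ij by simp
      qed
      have zR: "z j \<in> (if j = 0 then {0} else {-M..M})" if "j < Suc n" for j using z that by (auto simp: PiE_def Pi_def)
      have "z j \<in> (if j = 0 then {0} else {-M..M} - {0})" if "j < Suc n" for j
        using zR[OF that] zR[of 0] inj_onD[OF abs_inj, of j 0] that by (auto split: if_splits)
      then have "z \<in> ?A" using z abs_inj by (simp add: PiE_def Pi_def)
      then show False using z by simp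
    qed
  qed
  also have "\<dots> = (\<Sum>s | s \<in> PiE ?I (\<lambda>j. if j = 0 then {0} else {1..M}) \<and> ?P s.
      \<Sum>z\<in>PiE ?I (\<lambda>j. {s j, - s j}). ?g z)"
    by (rule sum_PiE_signs) (auto simp: inj_on_def)
  also have "\<dots> = (\<Sum>s | s \<in> PiE ?I (\<lambda>j. if j = 0 then {0} else {1..M}) \<and> ?P s. 2 ^ n * ?g s)"
  proof (rule sum.cong[OF refl])
    fix s assume "s \<in> {s. s \<in> PiE ?I (\<lambda>j. if j = 0 then {0} else {1..M}) \<and> ?P s}"
    then have sR: "s j \<in> (if j = 0 then {0} else {1..M})" if "j < Suc n" for j using that by (auto simp: PiE_def Pi_def)
    have "(\<Sum>z\<in>PiE ?I (\<lambda>j. {s j, - s j}). ?g z) = (\<Sum>z\<in>PiE ?I (\<lambda>j. {s j, - s j}). ?g s)"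
    proof (intro sum.cong refl arg_cong[where f="\<lambda>x. x\<^sup>2"])
      fix z assume "z \<in> PiE ?I (\<lambda>j. {s j, - s j})"
      then have "(real_of_int (z j))\<^sup>2 = (real_of_int (s j))\<^sup>2" if "j < Suc n" for j
        using that by (auto simp: PiE_def Pi_def)
      then show "vdm (Suc n) (\<lambda>j. (real_of_int (z j))\<^sup>2) = vdm (Suc n) (\<lambda>j. (real_of_int (s j))\<^sup>2)"
        by (simp add: vdm_def)
    qed
    also have "\<dots> = real (\<Prod>j<Suc n. card {s j, - s j}) * ?g s"
      by (simp add: card_PiE del: prod.lessThan_Suc lessThan_Suc)
    also have "(\<Prod>j<Suc n. card {s j, - s j}) = (\<Prod>j<Suc n. if j = 0 then 1 else 2)"
    proof (rule prod.cong[OF refl])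
      fix j assume "j \<in> ?I"
      then show "card {s j, - s j} = (if j = 0 then 1 else 2)" using sR[of j] by (cases "j = 0") auto
    qed
    also have "\<dots> = 2 ^ n" by (simp add: prod.lessThan_Suc_shift del: prod.lessThan_Suc)
    finally show "(\<Sum>z\<in>PiE ?I (\<lambda>j. {s j, - s j}). ?g z) = 2 ^ n * ?g s" by simp
  qed
  also have "\<dots> = (\<Sum>u\<in>strict_seqs (Suc n) M. \<Sum>p | p permutes {1..<Suc n}. 2 ^ n * ?g (u \<circ> p))"
    by (rule sum_strict_seqs_permutations)
  also have "\<dots> = (\<Sum>u\<in>strict_seqs (Suc n) M. \<Sum>p | p permutes {1..<Suc n}. 2 ^ n * ?g u)"
  proof (intro sum.cong refl arg_cong2[where f="(*)"])
    fix u :: "nat \<Rightarrow> int" and p assume "p \<in> {p. p permutes {1..<Suc n}}"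
    then have "p permutes ?I" by (auto intro: permutes_subset)
    from vdm_square_permute[OF this, of "\<lambda>j. real_of_int (u j)"] show "?g (u \<circ> p) = ?g u" by simp
  qed
  also have "\<dots> = 2 ^ n * fact n * (\<Sum>u\<in>strict_seqs (Suc n) M. ?g u)"
    by (simp add: card_permutations sum_distrib_left mult_ac)
  finally show ?thesis .
qed

text \<open>Andreief's argument: expand one of the two determinants and use orthogonality in the
  columns other than the one fixed at \<open>0\<close>.\<close>

lemma sum_tuples_gram:
  assumes "n \<le> M"
  shows "(\<Sum>z\<in>PiE {..<Suc n} (\<lambda>j. if j = 0 then {0} else {-int M..int M}).
      (vdm (Suc n) (\<lambda>j. (real_of_int (z j))\<^sup>2))\<^sup>2) =
    fact n * (\<Prod>i\<le>n. gram_norm M (2*i)) * (\<Sum>k\<le>n. (gram M (2*k) 0)\<^sup>2 / gram_norm M (2*k))"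
proof -
  let ?I = "{..<Suc n}"
  let ?A = "\<lambda>j::nat. if j = 0 then {0} else {-int M..int M}"
  let ?E = "\<lambda>i. gram M (2*i)"
  let ?h = "\<lambda>i. gram_norm M (2*i)"
  let ?D = "\<lambda>z :: nat \<Rightarrow> int. dt (Suc n) (\<lambda>i j. ?E i (real_of_int (z j)))"
  have h: "?h i \<noteq> 0" if "i \<le> n" for i using gram_norm_pos[of "2*i" M] that assms by simp
  have "(\<Sum>z\<in>PiE ?I ?A. (vdm (Suc n) (\<lambda>j. (real_of_int (z j))\<^sup>2))\<^sup>2) = (\<Sum>z\<in>PiE ?I ?A. (?D z)\<^sup>2)"
    by (simp only: dt_gram)
  also have "\<dots> = (\<Sum>z\<in>PiE ?I ?A. \<Sum>p | p permutes ?I. signof p * ((\<Prod>j<Suc n. ?E (p j) (real_of_int (z j))) * ?D z))"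
    by (simp only: power2_eq_square) (subst (1) dt_leibniz, simp only: sum_distrib_right mult.assoc)
  also have "\<dots> = (\<Sum>p | p permutes ?I. signof p * (\<Sum>z\<in>PiE ?I ?A. (\<Prod>j<Suc n. ?E (p j) (real_of_int (z j))) * ?D z))"
    by (subst sum.swap) (simp only: sum_distrib_left)
  also have "\<dots> = (\<Sum>p | p permutes ?I. (?E (p 0) 0)\<^sup>2 / ?h (p 0) * (\<Prod>i\<le>n. ?h i))"
  proof (rule sum.cong[OF refl])
    fix p assume "p \<in> {p. p permutes ?I}"
    then have p: "p permutes ?I" by simp
    have plt: "p j \<le> n" if "j \<le> n" for j using permutes_in_image[OF p, of j] that by auto
    \<comment> \<open>With its rows permuted by \<open>p\<close> as well, the matrix is diagonal in
      every column but column 0, where the point is pinned and no sum creates orthogonality. It is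
      thus lower triangular, so only the diagonal counts, and the two signs of \<open>p\<close>
      cancel.\<close>
    define G where "G i j = (\<Sum>y\<in>?A j. ?E (p j) (real_of_int y) * ?E (p i) (real_of_int y))" for i j
    have G0: "G i 0 = ?E (p 0) 0 * ?E (p i) 0" for i by (simp add: G_def)
    have G: "G i j = (if i = j then ?h (p j) else 0)" if "j \<noteq> 0" for i j
    proof (cases "i = j")
      case True
      then show ?thesis using that by (simp add: G_def gram_norm_def gram_ip_def)
    next
      case False
      then have "2 * p j \<noteq> 2 * p i" using permutes_inj[OF p] by (auto dest: injD)
      then show ?thesis using that False gram_orthogonal[of "2 * p j" "2 * p i" M] by (simp add: G_def gram_ip_def)
    qed
    have "(\<Sum>z\<in>PiE ?I ?A. (\<Prod>j<Suc n. ?E (p j) (real_of_int (z j))) * ?D z) =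
        dt (Suc n) (\<lambda>i j. \<Sum>y\<in>?A j. ?E (p j) (real_of_int y) * ?E i (real_of_int y))"
      by (rule dt_sum_columns[symmetric]) simp
    also have "\<dots> = signof p * dt (Suc n) G"
    proof -
      have "dt (Suc n) G = signof p * dt (Suc n) (\<lambda>i j. \<Sum>y\<in>?A j. ?E (p j) (real_of_int y) * ?E i (real_of_int y))"
        unfolding G_def by (rule dt_permute_rows[OF p, of "\<lambda>i j. \<Sum>y\<in>?A j. ?E (p j) (real_of_int y) * ?E i (real_of_int y)"])
      then show ?thesis by (simp add: sign_def)
    qed
    also have "dt (Suc n) G = (\<Prod>j<Suc n. G j j)"
      by (rule dt_lower_triangular) (simp add: G)
    also have "\<dots> = (?E (p 0) 0)\<^sup>2 * (\<Prod>j<n. ?h (p (Suc j)))"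
      by (simp add: prod.lessThan_Suc_shift G0 G power2_eq_square del: prod.lessThan_Suc)
    also have "(\<Prod>j<n. ?h (p (Suc j))) = (\<Prod>i\<le>n. ?h i) / ?h (p 0)"
    proof -
      have "(\<Prod>i\<le>n. ?h i) = (\<Prod>j<Suc n. ?h (p j))"
        using prod.permute[OF p, of ?h] by (simp add: lessThan_Suc_atMost comp_def)
      also have "\<dots> = ?h (p 0) * (\<Prod>j<n. ?h (p (Suc j)))" by (rule prod.lessThan_Suc_shift)
      finally show ?thesis using h[OF plt[of 0]] by simp
    qed
    finally show "signof p * (\<Sum>z\<in>PiE ?I ?A. (\<Prod>j<Suc n. ?E (p j) (real_of_int (z j))) * ?D z) =
        (?E (p 0) 0)\<^sup>2 / ?h (p 0) * (\<Prod>i\<le>n. ?h i)" by (simp add: sign_def)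
  qed
  \<comment> \<open>The summand depends on \<open>p\<close> only through \<open>p 0\<close>. Writing
    \<open>p\<close> as a transposition of 0 and b after a permutation that fixes 0 gives n! equal
    terms for each b.\<close>
  also have "?I = insert 0 {1..<Suc n}" by auto
  also have "(\<Sum>p | p permutes insert 0 {1..<Suc n}. (?E (p 0) 0)\<^sup>2 / ?h (p 0) * (\<Prod>i\<le>n. ?h i)) =
     (\<Sum>b\<in>insert 0 {1..<Suc n}. \<Sum>q | q permutes {1..<Suc n}. (?E b 0)\<^sup>2 / ?h b * (\<Prod>i\<le>n. ?h i))"
  proof (subst sum_over_permutations_insert)
    have "(Transposition.transpose 0 b \<circ> q) 0 = b" if "q permutes {1..<Suc n}" for b q
      using permutes_not_in[OF that, of 0] by (simp add: Transposition.transpose_def)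
    then show "(\<Sum>b\<in>insert 0 {1..<Suc n}. \<Sum>q | q permutes {1..<Suc n}.
        (?E ((Transposition.transpose 0 b \<circ> q) 0) 0)\<^sup>2 / ?h ((Transposition.transpose 0 b \<circ> q) 0) * (\<Prod>i\<le>n. ?h i)) =
      (\<Sum>b\<in>insert 0 {1..<Suc n}. \<Sum>q | q permutes {1..<Suc n}. (?E b 0)\<^sup>2 / ?h b * (\<Prod>i\<le>n. ?h i))"
      by (intro sum.cong refl) (simp only: mem_Collect_eq)
  qed auto
  also have "insert 0 {1..<Suc n} = {..n}" by auto
  also have "(\<Sum>b\<le>n. \<Sum>q | q permutes {1..<Suc n}. (?E b 0)\<^sup>2 / ?h b * (\<Prod>i\<le>n. ?h i)) =
      fact n * (\<Prod>i\<le>n. ?h i) * (\<Sum>k\<le>n. (?E k 0)\<^sup>2 / ?h k)"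
    by (simp add: card_permutations sum_distrib_left mult_ac)
  finally show ?thesis by (simp only: lessThan_Suc_atMost)
qed

lemma sum_set_vdm_gram:
  assumes "n \<le> M"
  shows "(\<Sum>S | S \<subseteq> {-int M..int M} \<and> card S = 2*n+1 \<and> 0 \<in> S. set_vdm S) =
    (\<Prod>i\<le>n. gram_norm M (2*i)) / fact n * (\<Sum>k\<le>n. (gram M (2*k) 0)\<^sup>2 / gram_norm M (2*k))"
proof -
  let ?U = "\<Sum>u\<in>strict_seqs (Suc n) (int M). (vdm (Suc n) (\<lambda>k. (real_of_int (u k))\<^sup>2))\<^sup>2"
  have "2 ^ n * fact n * ?U = fact n * (\<Prod>i\<le>n. gram_norm M (2*i)) * (\<Sum>k\<le>n. (gram M (2*k) 0)\<^sup>2 / gram_norm M (2*k))"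
    using sum_tuples_vdm_square[of "int M" n] sum_tuples_gram[OF assms] by simp
  then have "2 ^ n * ?U = (\<Prod>i\<le>n. gram_norm M (2*i)) * (\<Sum>k\<le>n. (gram M (2*k) 0)\<^sup>2 / gram_norm M (2*k))"
    by simp
  then show ?thesis by (subst sum_set_vdm_zero_mem) (simp_all add: field_simps)
qed

section \<open>Closed forms\<close>

lemma fact_ratio_prod: "(\<Prod>i=1..a. real (i + m)) = fact (a + m) / fact m"
proof (induction a)
  case (Suc a)
  have "(\<Prod>i=1..Suc a. real (i + m)) = (\<Prod>i=1..a. real (i + m)) * real (Suc a + m)" by simp
  also have "\<dots> = real (Suc (a + m)) * fact (a + m) / fact m" unfolding Suc.IH by simp
  also have "real (Suc (a + m)) * fact (a + m) = fact (Suc a + m)" by (simp only: fact_Suc add_Suc)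
  finally show ?case .
qed simp

lemma ST_0: "ST 0 b = 1"
proof -
  have "{(i::nat, j::nat). 1 \<le> i \<and> i < j \<and> j \<le> 0} = {}" by auto
  then show ?thesis by (simp only: ST_def) simp
qed

text \<open>The new factors are those with larger index a+1. Over the pairs they run through
  consecutive integers in numerator and denominator and are therefore quotients of
  factorials.\<close>

lemma ST_Suc: "ST (Suc a) b * (fact (a + b) * fact (2*a+1)) = ST a b * (fact (2*a+b+1) * fact a)"
proof -
  let ?I = "\<lambda>a. {(i::nat, j::nat). 1 \<le> i \<and> i < j \<and> j \<le> a}"
  let ?g = "\<lambda>(i, j). real (i + j + b - 1) / real (i + j - 1)"
  have I: "?I (Suc a) = ?I a \<union> (\<lambda>i. (i, Suc a)) ` {1..a}" by auto
  have fin: "finite (?I a)" by (rule finite_subset[of _ "{..a} \<times> {..a}"]) auto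
  have "(\<Prod>ij\<in>?I (Suc a). ?g ij) = (\<Prod>ij\<in>?I a. ?g ij) * (\<Prod>ij\<in>(\<lambda>i. (i, Suc a)) ` {1..a}. ?g ij)"
    unfolding I using fin by (intro prod.union_disjoint) auto
  also have "(\<Prod>ij\<in>(\<lambda>i. (i, Suc a)) ` {1..a}. ?g ij) = (\<Prod>i=1..a. real (i + (a + b)) / real (i + a))"
    by (subst prod.reindex) (auto simp: inj_on_def add_ac intro!: prod.cong)
  also have "\<dots> = fact (2*a+b) / fact (a+b) / (fact (2*a) / fact a)"
    unfolding prod_dividef fact_ratio_prod by (simp add: mult_2 add_ac)
  finally have E: "ST (Suc a) b = ST a b * (real (2*a+b+1) / real (2*a+1)) * (fact (2*a+b) / fact (a+b) / (fact (2*a) / fact a))"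
    by (simp add: ST_def)
  have f: "fact (2*a+b+1) = real (2*a+b+1) * fact (2*a+b)" "fact (2*a+1) = real (2*a+1) * fact (2*a)"
    by (simp_all only: fact_Suc Suc_eq_plus1[symmetric])
  have alg: "s * (p / q) * (u / v / (w / y)) * (v * (q * w)) = s * (p * u * y)"
    if "q \<noteq> 0" "v \<noteq> 0" "w \<noteq> 0" "y \<noteq> 0" for s p q u v w y :: real
    using that by (simp add: field_simps)
  show ?thesis unfolding E f by (rule alg) simp_all
qed

text \<open>The step is 2 because b = 2(M - n) drops by 2 when n increases with M fixed.\<close>

lemma ST_shift: "ST a b * (fact b * fact (2*a+b+1)) = ST a (b+2) * (fact (a+b+1) * fact (a+b))"
proof (induction a)
  case 0
  show ?case by (simp add: ST_0)
next
  case (Suc a)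
  have 1: "ST (Suc a) b = ST a b * (fact (2*a+b+1) * fact a) / (fact (a + b) * fact (2*a+1))"
    using ST_Suc[of a b] by (simp add: eq_divide_eq)
  have 2: "ST (Suc a) (b+2) = ST a (b+2) * (fact (2*a+b+3) * fact a) / (fact (a + b+2) * fact (2*a+1))"
    using ST_Suc[of a "b+2"] by (simp add: eq_divide_eq numeral_3_eq_3 del: fact_Suc)
  have 3: "ST a b = ST a (b+2) * (fact (a+b+1) * fact (a+b)) / (fact b * fact (2*a+b+1))"
    using Suc.IH by (simp add: eq_divide_eq)
  have "fact (2 * Suc a + b + 1) = fact (2*a+b+3)" "fact (Suc a + b + 1) = fact (a+b+2)" "fact (Suc a + b) = fact (a + b + 1)"
    by (simp_all add: numeral_3_eq_3 del: fact_Suc)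
  then show ?case unfolding 1 2 3 by (simp add: eval_nat_numeral del: fact_Suc)
qed

lemma gram_norm_closed:
  assumes "m \<le> 2 * M"
  shows "gram_norm M m = (fact m) ^ 4 * fact (2*M+1+m) / (fact (2*m) * fact (2*m+1) * fact (2*M-m))"
  using assms
proof (induction m)
  case 0
  show ?case by (simp add: gram_norm_0)
next
  case (Suc m)
  define d where "d = 2 * M - Suc m"
  have M: "2 * real M = real m + 1 + real d" and d1: "2*M - m = Suc d" and d2: "2*M - Suc m = d"
    using Suc.prems by (simp_all add: d_def)
  have c: "gram_coeff M (Suc m) = (real m + 1)^2 * ((2 * real m + 3 + real d) * (real d + 1)) / (4 * ((2 * real m + 1) * (2 * real m + 3)))"
    unfolding gram_coeff_def M by (simp add: power2_eq_square algebra_simps)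
  have f: "fact (2*M+1+Suc m) = (2 * real m + 3 + real d) * fact (2*M+1+m)"
  proof -
    have "real (2*M+1+Suc m) = 2 * real m + 3 + real d" using M by simp
    then show ?thesis by (simp only: add_Suc_right fact_Suc)
  qed
  have f2: "fact (2 * Suc m) = (2 * (real m + 1)) * ((2 * real m + 1) * fact (2*m))" 
    "fact (2 * Suc m + 1) = (2 * real m + 3) * ((2 * (real m + 1)) * fact (2*m+1))"
    "fact (Suc d) = (real d + 1) * fact d" "fact (Suc m) = (real m + 1) * fact m"
    by (simp_all add: algebra_simps)
  have nz: "2 * real m + 1 \<noteq> 0" "2 * real m + 3 \<noteq> 0" "real m + 1 \<noteq> 0" "real d + 1 \<noteq> 0" "2 * real m + 3 + real d \<noteq> 0"
    by linarith+
  have IH: "gram_norm M m = (fact m) ^ 4 * fact (2*M+1+m) / (fact (2*m) * fact (2*m+1) * ((real d + 1) * fact d))"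
    using Suc.IH Suc.prems unfolding d1 f2(3) by simp
  show ?case
    unfolding gram_norm_rec IH c d2 f f2(1,2,4)
    by (simp add: divide_simps nz del: fact_Suc) (simp add: power2_eq_square power4_eq_xxxx algebra_simps)
qed

text \<open>The induction step goes from \<open>ST (2*n+1) (b+2)\<close> to
  \<open>ST (2*n+3) b\<close> by one shift in b and two steps in a. The two extra factors cancel
  against the 1/n! of \<open>sum_set_vdm_gram\<close> and the superfactorial in the count of
  towers.\<close>

lemma prod_gram_norm_ST:
  assumes "n \<le> M"
  shows "(\<Prod>i\<le>n. gram_norm M (2*i)) = fact n * (\<Prod>r<2*n+1. fact r) * ST (2*n+1) (2*(M-n))"
  using assms
proof (induction n)
  case 0
  have "ST 1 b * fact b = fact (b + 1)" for b using ST_Suc[of 0 b] by (simp add: ST_0)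
  from this[of "2*M"] show ?case by (simp add: gram_norm_0)
next
  case (Suc n)
  define b where "b = 2 * (M - Suc n)"
  have b2: "2 * (M - n) = b + 2" and bM: "2 * M = b + 2*n + 2" using Suc.prems by (simp_all add: b_def)
  define S0 S1 S2 S3 where "S0 = ST (2*n+1) (b+2)" and "S1 = ST (2*n+1) b" and "S2 = ST (2*n+2) b" and "S3 = ST (2*n+3) b"
  have e1: "S1 = S0 * (fact (2*n+b+2) * fact (2*n+b+1)) / (fact b * fact (4*n+b+3))"
    using ST_shift[of "2*n+1" b] by (simp add: S0_def S1_def eq_divide_eq algebra_simps numeral_3_eq_3 del: fact_Suc)
  have e2: "S2 = S1 * (fact (4*n+b+3) * fact (2*n+1)) / (fact (2*n+b+1) * fact (4*n+3))"
    using ST_Suc[of "2*n+1" b] by (simp add: S2_def S1_def eq_divide_eq algebra_simps numeral_3_eq_3 del: fact_Suc)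
  have e3: "S3 = S2 * (fact (4*n+b+5) * fact (2*n+2)) / (fact (2*n+b+2) * fact (4*n+5))"
    using ST_Suc[of "2*n+2" b] by (simp add: S3_def S2_def eq_divide_eq algebra_simps eval_nat_numeral del: fact_Suc)
  have S3: "S3 = S0 * (fact (4*n+b+5) * fact (2*n+1) * fact (2*n+2)) / (fact b * fact (4*n+3) * fact (4*n+5))"
  proof -
    have alg: "s * (A * B) / (b' * C) * (C * D) / (B * E) * (F * G) / (A * H) = s * (F * D * G) / (b' * E * H)"
      if "A \<noteq> 0" "B \<noteq> 0" "C \<noteq> 0" for s A B b' C D E F G H :: real
      using that by (simp add: mult_ac)
    show ?thesis unfolding e3 e2 e1 by (rule alg) simp_all
  qed
  have "2 * Suc n \<le> 2 * M" using Suc.prems by simp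
  from gram_norm_closed[OF this]
  have h: "gram_norm M (2 * Suc n) = (fact (2*n+2))^4 * fact (4*n+b+5) / (fact (4*n+4) * fact (4*n+5) * fact b)"
    unfolding bM by (simp add: algebra_simps eval_nat_numeral del: fact_Suc power_Suc)
  have f4: "fact (4*n+4) = (4 * (real n + 1)) * fact (4*n+3)" by (simp add: eval_nat_numeral algebra_simps)
  have f2: "fact (2*n+2) = (2 * (real n + 1)) * fact (2*n+1)" by (simp add: algebra_simps)
  have key: "(fact (2*n+2))^4 / fact (4*n+4) = (real n + 1) * (fact (2*n+1))^2 * (fact (2*n+2))^2 / fact (4*n+3)"
  proof -
    have alg: "(2 * k * A) ^ 4 / (4 * k * C) = k * A\<^sup>2 * (2 * k * A)\<^sup>2 / C" if "k \<noteq> 0" for k A C :: real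
      using that by (simp add: power4_eq_xxxx power2_eq_square)
    show ?thesis unfolding f4 f2 by (rule alg) simp
  qed
  have "(\<Prod>i\<le>Suc n. gram_norm M (2*i)) = fact n * (\<Prod>r<2*n+1. fact r) * S0 * gram_norm M (2 * Suc n)"
    using Suc.IH Suc.prems by (simp add: b2 S0_def)
  also have "gram_norm M (2 * Suc n) = (fact (2*n+2))^4 / fact (4*n+4) * fact (4*n+b+5) / (fact (4*n+5) * fact b)"
    unfolding h by simp
  also have "fact n * (\<Prod>r<2*n+1. fact r) * S0 * \<dots> =
      (real n + 1) * fact n * ((\<Prod>r<2*n+1. fact r) * fact (2*n+1) * fact (2*n+2)) * S3"
  proof -
    have alg: "f * p * s * (k * A\<^sup>2 * B\<^sup>2 / C * D / (E * F)) = k * f * (p * A * B) * (s * (D * A * B) / (F * C * E))"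
      for f p s k A B C D E F :: real by (simp add: power2_eq_square mult_ac)
    show ?thesis unfolding key S3 by (rule alg)
  qed
  also have "(\<Prod>r<2*n+1. fact r) * fact (2*n+1) * fact (2*n+2) = (\<Prod>r<2*Suc n+1. fact r :: real)"
    by (simp add: mult_ac)
  also have "(real n + 1) * fact n = fact (Suc n)" by (simp add: algebra_simps)
  also have "S3 = ST (2 * Suc n + 1) (2 * (M - Suc n))" by (simp add: S3_def b_def eval_nat_numeral)
  finally show ?case .
qed


text \<open>This is \<open>(M choose i) * (M + i choose i)\<close>, the coefficient of \<open>s ^ i\<close> in the Legendre polynomial
  \<open>P\<^sub>M (1 + 2 s)\<close>.\<close>

definition legendre_coeff :: "nat \<Rightarrow> nat \<Rightarrow> real" where
  "legendre_coeff M i = pochhammer (real (M + 1 - i)) (2*i) / (fact i)\<^sup>2"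

text \<open>The sum in \<open>Q N (M + 1 - N)\<close>, with \<open>q_factor\<close> below as its
  prefactor. In these parameters N can vary while M stays fixed.\<close>

definition legendre_sum :: "nat \<Rightarrow> nat \<Rightarrow> real" where
  "legendre_sum M N = (\<Sum>i<N. (-1) ^ (N - i - 1) / real (2*N - 2*i - 1) * legendre_coeff M i)"

definition q_factor :: "nat \<Rightarrow> nat \<Rightarrow> real" where
  "q_factor M N = 1/2 * (fact (2*N))\<^sup>2 * fact (2 * (M + 1 - N)) * fact (M + N) / ((fact N)\<^sup>2 * fact (M + 1 - N) * fact (2*M + 2*N))"

lemma legendre_coeff_Suc:
  assumes "i \<le> M"
  shows "legendre_coeff M (Suc i) * (real i + 1)\<^sup>2 = legendre_coeff M i * ((real M - real i) * (real M + 1 + real i))"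
proof -
  have r: "real (M + 1 - Suc i) = real M - real i" "real (M + 1 - i) = real M - real i + 1"
    using assms by (simp_all add: of_nat_diff)
  have "pochhammer (real M - real i) (2 * Suc i) = (real M - real i) * pochhammer (real M - real i + 1) (Suc (2*i))"
    by (simp add: pochhammer_rec)
  also have "\<dots> = (real M - real i) * (pochhammer (real M - real i + 1) (2*i) * (real M + 1 + real i))"
    by (subst pochhammer_Suc) (simp add: algebra_simps)
  finally have e: "pochhammer (real M - real i) (2 * Suc i) =
      (real M - real i) * (pochhammer (real M - real i + 1) (2*i) * (real M + 1 + real i))" .
  have alg: "m * (p * q) / (k * f)\<^sup>2 * k\<^sup>2 = p / f\<^sup>2 * (m * q)" if "k \<noteq> 0" for m p q k f :: real
    using that by (simp add: power_mult_distrib)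
  have "fact (Suc i) = (real i + 1) * fact i" by simp
  then show ?thesis
    unfolding legendre_coeff_def r e by (simp only:) (rule alg, simp)
qed

text \<open>The sequence \<open>G\<close> in the proof is a Zeilberger certificate for the summand.\<close>

lemma legendre_sum_rec:
  assumes "N \<le> M"
  shows "(2 * real N + 1)\<^sup>2 * legendre_sum M (Suc N) =
    ((2 * real M + 1)\<^sup>2 - 4 * (real N)\<^sup>2) * legendre_sum M N + (4 * real N + 1) * legendre_coeff M N"
proof -
  define G where "G i = (-1) ^ (N - i) * (real i)\<^sup>2 * legendre_coeff M i / (2 * real N - 2 * real i + 1)" for i
  define A B where "A = (2 * real N + 1)\<^sup>2" and "B = (2 * real M + 1)\<^sup>2 - 4 * (real N)\<^sup>2"
  have step: "A * ((-1) ^ (N - i) / real (2 * Suc N - 2*i - 1) * legendre_coeff M i) -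
      B * ((-1) ^ (N - i - 1) / real (2*N - 2*i - 1) * legendre_coeff M i) = - 4 * (G (Suc i) - G i)"
    if i: "i < N" for i
  proof -
    define d where "d = N - Suc i"
    have N: "real N = real d + 1 + real i" and Ni: "N - i = Suc d" using i by (simp_all add: d_def)
    have d1: "real (2 * Suc N - 2*i - 1) = 2 * real d + 3" "real (2*N - 2*i - 1) = 2 * real d + 1"
      using i by (simp_all add: d_def of_nat_diff)
    have d3: "2 * real N - 2 * real i + 1 = 2 * real d + 3" "2 * real N - 2 * real (Suc i) + 1 = 2 * real d + 1"
      using N by simp_all
    have p: "(-1) ^ (N - i - 1) = (-1 :: real) ^ d" "(-1) ^ (N - i) = - ((-1 :: real) ^ d)" "(-1) ^ (N - Suc i) = (-1 :: real) ^ d"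
      using Ni by (simp_all add: d_def)
    have c: "(real (Suc i))\<^sup>2 * legendre_coeff M (Suc i) = legendre_coeff M i * ((real M - real i) * (real M + 1 + real i))"
      using legendre_coeff_Suc[of i M] i assms by (simp add: algebra_simps)
    define a s where "a = legendre_coeff M i" and "s = (-1 :: real) ^ d"
    have GS: "G (Suc i) = s * (a * ((real M - real i) * (real M + 1 + real i))) / (2 * real d + 1)"
      unfolding G_def p d3 mult.assoc c by (simp add: a_def s_def)
    have Gi: "G i = - s * (real i)\<^sup>2 * a / (2 * real d + 3)"
      unfolding G_def p d3 by (simp add: a_def s_def)
    have alg: "A * (- s / e3 * a) - B * (s / e1 * a) = - 4 * (s * (a * W) / e1 - - s * I2 * a / e3)"
      if "- A * e1 - B * e3 = - 4 * (W * e3 + I2 * e1)" "e1 \<noteq> 0" "e3 \<noteq> 0" for e1 e3 W I2 :: real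
    proof -
      have "A * (- s / e3 * a) - B * (s / e1 * a) = s * a * (- A * e1 - B * e3) / (e1 * e3)"
        using that(2,3) by (simp add: field_simps)
      also have "\<dots> = - 4 * (s * (a * W) / e1 - - s * I2 * a / e3)"
        unfolding that(1) using that(2,3) by (simp add: field_simps)
      finally show ?thesis .
    qed
    show ?thesis
      unfolding d1 p GS Gi a_def[symmetric] s_def[symmetric]
    proof (rule alg)
      show "- A * (2 * real d + 1) - B * (2 * real d + 3) =
         - 4 * ((real M - real i) * (real M + 1 + real i) * (2 * real d + 3) + (real i)\<^sup>2 * (2 * real d + 1))"
        unfolding A_def B_def N by (simp add: power2_eq_square algebra_simps)
    qed linarith+
  qed
  have "A * legendre_sum M (Suc N) = A * legendre_coeff M N +
      (\<Sum>i<N. A * ((-1) ^ (N - i) / real (2 * Suc N - 2*i - 1) * legendre_coeff M i))"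
    unfolding legendre_sum_def sum.lessThan_Suc distrib_left sum_distrib_left by simp
  moreover have "B * legendre_sum M N = (\<Sum>i<N. B * ((-1) ^ (N - i - 1) / real (2*N - 2*i - 1) * legendre_coeff M i))"
    unfolding legendre_sum_def sum_distrib_left ..
  ultimately have "A * legendre_sum M (Suc N) - B * legendre_sum M N = A * legendre_coeff M N + (\<Sum>i<N. - 4 * (G (Suc i) - G i))"
    using step by (simp add: sum_subtractf[symmetric])
  also have "(\<Sum>i<N. - 4 * (G (Suc i) - G i)) = - 4 * (G N - G 0)"
    by (simp only: sum_distrib_left[symmetric] sum_lessThan_telescope)
  \<comment> \<open>\<open>G 0\<close> vanishes through its factor i^2. Together with the unpaired
    last term this yields the coefficient (2N+1)^2 - 4N^2 = 4N+1.\<close>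
  also have "\<dots> = - 4 * (real N)\<^sup>2 * legendre_coeff M N" by (simp add: G_def)
  finally show ?thesis by (simp add: A_def B_def power2_eq_square algebra_simps)
qed

text \<open>The prefactor of \<open>Q\<close> is a summation factor for the recurrence of
  \<open>legendre_sum\<close>: multiplying by it makes the homogeneous part telescope.\<close>

lemma q_factor_Suc:
  assumes "N \<le> M"
  shows "q_factor M (Suc N) * ((2 * real M + 1)\<^sup>2 - 4 * (real N)\<^sup>2) = q_factor M N * (2 * real N + 1)\<^sup>2"
proof -
  define d where "d = M - N"
  have M: "M = N + d" using assms by (simp add: d_def)
  have e: "M + 1 - Suc N = d" "M + 1 - N = Suc d" using M by simp_all
  define a b c x y z where "a = (fact (2*N) :: real)" and "b = (fact N :: real)" and "c = (fact (2*d) :: real)"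
    and "x = (fact d :: real)" and "y = (fact (M + N) :: real)" and "z = (fact (2*M + 2*N) :: real)"
  have nz: "a \<noteq> 0" "b \<noteq> 0" "c \<noteq> 0" "x \<noteq> 0" "y \<noteq> 0" "z \<noteq> 0"
    by (simp_all add: a_def b_def c_def x_def y_def z_def)
  have f: "fact (2 * Suc N) = 2 * (real N + 1) * (2 * real N + 1) * a" "fact (Suc N) = (real N + 1) * b"
    "fact (2 * Suc d) = 2 * (real d + 1) * (2 * real d + 1) * c" "fact (Suc d) = (real d + 1) * x"
    "fact (M + Suc N) = (2 * real N + real d + 1) * y"
    "fact (2*M + 2 * Suc N) = 2 * (2 * real N + real d + 1) * (4 * real N + 2 * real d + 1) * z"
    by (simp_all add: a_def b_def c_def x_def y_def z_def M algebra_simps)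
  have nz': "real N + 1 \<noteq> 0" "real d + 1 \<noteq> 0" "2 * real N + real d + 1 \<noteq> 0" "4 * real N + 2 * real d + 1 \<noteq> 0" "2 * real d + 1 \<noteq> 0"
    by linarith+
  have r: "(2 * real M + 1)\<^sup>2 - 4 * (real N)\<^sup>2 = (2 * real d + 1) * (4 * real N + 2 * real d + 1)"
    unfolding M by (simp add: power2_eq_square algebra_simps)
  have qS: "q_factor M (Suc N) = (2 * real N + 1)\<^sup>2 * (a\<^sup>2 * c * y) / (b\<^sup>2 * x * z * (4 * real N + 2 * real d + 1))"
    unfolding q_factor_def e f c_def[symmetric] x_def[symmetric] using nz nz'
    by (simp add: power2_eq_square divide_simps) (simp add: algebra_simps)
  have qN: "q_factor M N = (2 * real d + 1) * (a\<^sup>2 * c * y) / (b\<^sup>2 * x * z)"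
    unfolding q_factor_def e f a_def[symmetric] b_def[symmetric] y_def[symmetric] z_def[symmetric] using nz nz'
    by (simp add: power2_eq_square divide_simps)
  show ?thesis unfolding r qS qN using nz nz' by (simp add: divide_simps)
qed

section \<open>The Christoffel kernel at 0 and \<open>Q\<close>\<close>

definition gram_density :: "nat \<Rightarrow> nat \<Rightarrow> real" where
  "gram_density M k = (gram M (2*k) 0)\<^sup>2 / gram_norm M (2*k)"

text \<open>At x = 0 the recurrence loses its middle term, so two steps multiply the value by minus
  one coefficient and the norm by two coefficients.\<close>

lemma gram_density_Suc:
  assumes "k < M"
  shows "gram_density M (Suc k) * gram_coeff M (2*k+2) = gram_density M k * gram_coeff M (2*k+1)"
proof -
  have "gram M (2 * Suc k) 0 = - gram_coeff M (2*k+1) * gram M (2*k) 0" by simp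
  moreover have "gram_norm M (2 * Suc k) = gram_coeff M (2*k+2) * (gram_coeff M (2*k+1) * gram_norm M (2*k))"
    using gram_norm_rec[of M "2*k+1"] gram_norm_rec[of M "2*k"] by simp
  moreover have "gram_coeff M (2*k+1) > 0" "gram_coeff M (2*k+2) > 0" "gram_norm M (2*k) > 0"
    using assms by (auto intro!: gram_coeff_pos gram_norm_pos)
  ultimately show ?thesis unfolding gram_density_def
    by (simp add: power2_eq_square divide_simps)
qed

text \<open>The right side is the inhomogeneous term of \<open>legendre_sum_rec\<close> times the
  summation factor, so this identifies the increments of the two sides of
  \<open>sum_gram_density\<close>. Both sides have the same rational ratio in k, assembled from
  \<open>D\<close>, \<open>q\<close> and \<open>l\<close>.\<close>

lemma gram_density_closed:
  assumes "k \<le> M"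
  shows "gram_density M k * (2 * real k + 1)\<^sup>2 = q_factor M (Suc k) * (4 * real k + 1) * legendre_coeff M k"
  using assms
proof (induction k)
  case 0
  have "q_factor M (Suc 0) * (2 * real M + 1)\<^sup>2 = q_factor M 0" using q_factor_Suc[of 0 M] by simp
  moreover have "q_factor M 0 = 2 * real M + 1"
  proof -
    have alg: "1/2 * 1\<^sup>2 * (2 * m * q * A) * B / (1\<^sup>2 * (m * B) * A) = q"
      if "m \<noteq> 0" "A \<noteq> 0" "B \<noteq> 0" for m q A B :: real
      using that by simp
    have "fact (2 * (M + 1)) = 2 * (real M + 1) * (2 * real M + 1) * fact (2*M)" "fact (M + 1) = (real M + 1) * fact M"
      by (simp_all add: algebra_simps)
    then show ?thesis unfolding q_factor_def mult_0_right diff_zero add_0_right fact_0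
      by (simp only:) (rule alg, simp_all)
  qed
  ultimately have "q_factor M (Suc 0) * (2 * real M + 1) = 1" by (simp add: power2_eq_square)
  then show ?case by (simp add: gram_density_def gram_norm_0 legendre_coeff_def field_simps)
next
  case (Suc k)
  define K where "K = real k"
  define X where "X = (2 * real M + 1)\<^sup>2"
  have k: "k < M" "k \<le> M" "Suc k \<le> M" using Suc.prems by simp_all
  have K0: "K \<ge> 0" by (simp add: K_def)
  have XK: "X - (2*K+1)\<^sup>2 = 4 * ((real M - K) * (real M + 1 + K))" by (simp add: X_def power2_eq_square algebra_simps)
  have "(2*K+2)\<^sup>2 < X" unfolding X_def K_def using k by (intro power_strict_mono) auto
  then have X2: "X - (2*K+2)\<^sup>2 \<noteq> 0" by simp
  have b1: "gram_coeff M (2*k+1) = (2*K+1)\<^sup>2 * (X - (2*K+1)\<^sup>2) / (4 * ((4*K+1) * (4*K+3)))"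
    unfolding gram_coeff_def X_def K_def by (simp add: power2_eq_square algebra_simps)
  have b2: "gram_coeff M (2*k+2) = (2*K+2)\<^sup>2 * (X - (2*K+2)\<^sup>2) / (4 * ((4*K+3) * (4*K+5)))"
    unfolding gram_coeff_def X_def K_def by (simp add: power2_eq_square algebra_simps)
  have D: "gram_density M (Suc k) * ((2*K+2)\<^sup>2 * (X - (2*K+2)\<^sup>2)) * (4*K+1) =
      gram_density M k * (2*K+1)\<^sup>2 * (X - (2*K+1)\<^sup>2) * (4*K+5)"
  proof -
    have "u * (p / (4 * (c2 * c3))) = v * (q * r / (4 * (c1 * c2))) \<Longrightarrow> u * p * c1 = v * q * r * c3"
      if "c1 \<noteq> 0" "c2 \<noteq> 0" "c3 \<noteq> 0" for u v p q r c1 c2 c3 :: real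
      using that by (simp add: field_simps)
    from this[OF _ _ _ gram_density_Suc[OF k(1), unfolded b1 b2]] show ?thesis using K0 by simp
  qed
  have q: "q_factor M (Suc (Suc k)) * (X - (2*K+2)\<^sup>2) = q_factor M (Suc k) * (2*K+3)\<^sup>2"
    using q_factor_Suc[OF k(3)] by (simp add: X_def K_def power2_eq_square algebra_simps)
  have l: "legendre_coeff M (Suc k) * (2*K+2)\<^sup>2 = legendre_coeff M k * (X - (2*K+1)\<^sup>2)"
    using legendre_coeff_Suc[OF k(2)] unfolding XK by (simp add: K_def power2_eq_square algebra_simps)
  have IH: "gram_density M k * (2*K+1)\<^sup>2 = q_factor M (Suc k) * (4*K+1) * legendre_coeff M k"
    using Suc.IH k by (simp add: K_def)
  let ?c = "(2*K+2)\<^sup>2 * (X - (2*K+2)\<^sup>2) * (4*K+1)"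
  have c: "?c \<noteq> 0" using X2 K0 by simp
  have "gram_density M (Suc k) * (2*K+3)\<^sup>2 * ?c = (2*K+3)\<^sup>2 * (gram_density M k * (2*K+1)\<^sup>2 * (X - (2*K+1)\<^sup>2) * (4*K+5))"
    unfolding D[symmetric] by (simp only: mult_ac)
  also have "\<dots> = (q_factor M (Suc k) * (2*K+3)\<^sup>2) * (4*K+5) * (legendre_coeff M k * (X - (2*K+1)\<^sup>2)) * (4*K+1)"
    unfolding IH by (simp only: mult_ac)
  also have "\<dots> = q_factor M (Suc (Suc k)) * (4*K+5) * legendre_coeff M (Suc k) * ?c"
    unfolding q[symmetric] l[symmetric] by (simp only: mult_ac)
  finally have "gram_density M (Suc k) * (2*K+3)\<^sup>2 = q_factor M (Suc (Suc k)) * (4*K+5) * legendre_coeff M (Suc k)"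
    using c by simp
  then show ?case by (simp add: K_def add_ac)
qed

lemma sum_gram_density:
  assumes "N \<le> Suc M"
  shows "(\<Sum>k<N. gram_density M k) = q_factor M N * legendre_sum M N"
  using assms
proof (induction N)
  case 0
  show ?case by (simp add: legendre_sum_def)
next
  case (Suc N)
  define c where "c = (2 * real N + 1)\<^sup>2"
  have N: "N \<le> M" using Suc.prems by simp
  have c: "c \<noteq> 0" by (simp add: c_def)
  have "(\<Sum>k<Suc N. gram_density M k) * c = q_factor M N * c * legendre_sum M N + gram_density M N * c"
    using Suc by (simp add: algebra_simps)
  also have "\<dots> = q_factor M (Suc N) * (((2 * real M + 1)\<^sup>2 - 4 * (real N)\<^sup>2) * legendre_sum M N + (4 * real N + 1) * legendre_coeff M N)"
    unfolding c_def q_factor_Suc[OF N, symmetric] gram_density_closed[OF N] by (simp add: algebra_simps)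
  also have "\<dots> = q_factor M (Suc N) * legendre_sum M (Suc N) * c"
    unfolding legendre_sum_rec[OF N, symmetric] c_def by simp
  finally show ?case using c by simp
qed

lemma Q_eq_sum_gram_density: "Q (n+1) x = (\<Sum>k\<le>n. gram_density (n + x) k)"
proof -
  have "(\<Sum>k\<le>n. gram_density (n + x) k) = q_factor (n + x) (n+1) * legendre_sum (n + x) (n+1)"
    using sum_gram_density[of "n+1" "n+x"] by (simp add: lessThan_Suc_atMost)
  also have "\<dots> = Q (n+1) x"
    unfolding Q_def q_factor_def legendre_sum_def legendre_coeff_def atLeast0LessThan
  proof (rule arg_cong2[where f="(*)"])
    have "n + x + 1 - (n + 1) = x" "n + x + (n + 1) = x + 2 * (n + 1) - 1" "2 * (n + x) + 2 * (n + 1) = 2 * x + 4 * (n + 1) - 2"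
      by simp_all
    then show "1/2 * (fact (2 * (n + 1)))\<^sup>2 * fact (2 * (n + x + 1 - (n + 1))) * fact (n + x + (n + 1)) /
          ((fact (n + 1))\<^sup>2 * fact (n + x + 1 - (n + 1)) * fact (2 * (n + x) + 2 * (n + 1))) =
        (1/2 * (fact (2 * (n + 1)))\<^sup>2 * fact (2 * x) * fact (x + 2 * (n + 1) - 1) /
          ((fact (n + 1))\<^sup>2 * fact x * fact (2 * x + 4 * (n + 1) - 2)) :: real)"
      by (simp only:)
  qed (simp add: add_ac)
  finally show ?thesis by simp
qed

lemma sum_set_vdm_Q_ST:
  "(\<Sum>S | S \<subseteq> {-int (n+x)..int (n+x)} \<and> card S = 2*n+1 \<and> 0 \<in> S. set_vdm S) / (\<Prod>r<2*n+1. fact r) =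
    Q (n+1) x * ST (2*n+1) (2*x)"
proof -
  have "(\<Prod>r<2*n+1. fact r :: real) \<noteq> 0" by simp
  then show ?thesis
    unfolding Q_eq_sum_gram_density gram_density_def sum_set_vdm_gram[OF le_add1[of n x]] prod_gram_norm_ST[OF le_add1[of n x]]
    by (simp del: prod.lessThan_Suc)
qed

section \<open>Lozenge tilings as matchings\<close>

text \<open>Triangles are indexed by integer pairs; a lozenge is recorded as the pair of the index of
  its right triangle and the index of its left triangle.\<close>

type_synonym cell = "int \<times> int"

definition rt :: "cell \<Rightarrow> cell set" where "rt p = right_tri (fst p) (snd p)"
definition lt :: "cell \<Rightarrow> cell set" where "lt p = left_tri (fst p) (snd p)"

definition adj :: "cell \<Rightarrow> cell \<Rightarrow> bool" where
  "adj r l \<longleftrightarrow> l = (fst r - 1, snd r) \<or> l = r \<or> l = (fst r, snd r - 1)"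

definition loz :: "cell \<times> cell \<Rightarrow> cell set set" where
  "loz = (\<lambda>(r, l). {rt r, lt l})"

definition in_r :: "nat \<Rightarrow> nat \<Rightarrow> cell \<Rightarrow> bool" where
  "in_r a b = (\<lambda>(i, j). 0 \<le> i \<and> i + 1 \<le> 2 * int a \<and> - int a \<le> j \<and> j + 1 \<le> int b \<and> 0 \<le> i + j \<and> i + j + 1 \<le> int a + int b)"

definition in_l :: "nat \<Rightarrow> nat \<Rightarrow> cell \<Rightarrow> bool" where
  "in_l a b = (\<lambda>(i, j). 0 \<le> i \<and> i + 1 \<le> 2 * int a \<and> - int a \<le> j \<and> j + 1 \<le> int b \<and> 0 \<le> i + j + 1 \<and> i + j + 2 \<le> int a + int b)"

definition matching :: "nat \<Rightarrow> nat \<Rightarrow> (cell \<times> cell) set \<Rightarrow> bool" where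
  "matching a b E \<longleftrightarrow> (\<forall>(r, l)\<in>E. adj r l \<and> in_r a b r \<and> in_l a b l) \<and>
     (\<forall>r. in_r a b r \<longrightarrow> (\<exists>!l. (r, l) \<in> E)) \<and> (\<forall>l. in_l a b l \<longrightarrow> (\<exists>!r. (r, l) \<in> E))"

text \<open>The coordinate sums of the vertices recover the index of a triangle; their residue
  modulo 3 later separates right triangles from left ones.\<close>

lemma rt_inj [simp]: "rt p = rt q \<longleftrightarrow> p = q"
proof -
  have "(\<Sum>v\<in>rt p. fst v) = 3 * fst p + 1" "(\<Sum>v\<in>rt p. snd v) = 3 * snd p + 1" for p
    by (cases p; simp add: rt_def right_tri_def)+
  then show ?thesis by (metis add_right_cancel mult_left_cancel prod.collapse zero_neq_numeral)
qed

lemma lt_sums: "(\<Sum>v\<in>lt p. fst v) = 3 * fst p + 2" "(\<Sum>v\<in>lt p. snd v) = 3 * snd p + 2"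
  by (cases p; simp add: lt_def left_tri_def)+

lemma lt_inj [simp]: "lt p = lt q \<longleftrightarrow> p = q"
  using lt_sums[of p] lt_sums[of q] by (metis add_right_cancel mult_left_cancel prod.collapse zero_neq_numeral)

lemma rt_neq_lt [simp]: "rt p \<noteq> lt q" "lt q \<noteq> rt p"
proof -
  have "(\<Sum>v\<in>rt p. fst v) = 3 * fst p + 1" by (cases p) (simp add: rt_def right_tri_def)
  then show "rt p \<noteq> lt q" "lt q \<noteq> rt p" using lt_sums(1)[of q] by auto presburger+
qed

lemma unit_tri_iff: "unit_tri t \<longleftrightarrow> (\<exists>p. t = rt p \<or> t = lt p)"
  by (auto simp: unit_tri_def rt_def lt_def)

lemma loz_inj [simp]: "loz p = loz q \<longleftrightarrow> p = q"
  by (cases p; cases q) (auto simp: loz_def doubleton_eq_iff)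

lemma rt_mem_loz: "rt r \<in> loz p \<longleftrightarrow> fst p = r"
  by (cases p) (auto simp: loz_def)

lemma lt_mem_loz: "lt l \<in> loz p \<longleftrightarrow> snd p = l"
  by (cases p) (auto simp: loz_def)

lemma card_2_two_points:
  assumes "card A = 2"
  shows "\<exists>p q. p \<in> A \<and> q \<in> A \<and> p \<noteq> q"
  using assms by (auto simp: card_2_iff)

lemma rt_rt_inter: "card (rt p \<inter> rt q) = 2 \<Longrightarrow> p = q"
  by (drule card_2_two_points, cases p, cases q) (auto simp: rt_def right_tri_def)

lemma lt_lt_inter: "card (lt p \<inter> lt q) = 2 \<Longrightarrow> p = q"
  by (drule card_2_two_points, cases p, cases q) (auto simp: lt_def left_tri_def)

lemma rt_lt_inter: "card (rt r \<inter> lt l) = 2 \<longleftrightarrow> adj r l"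
proof
  show "adj r l" if "card (rt r \<inter> lt l) = 2"
    using card_2_two_points[OF that]
    by (cases r; cases l) (auto simp: lt_def left_tri_def rt_def right_tri_def adj_def)
  show "card (rt r \<inter> lt l) = 2" if adj: "adj r l"
  proof -
    obtain i j where r: "r = (i, j)" by (cases r)
    consider "l = (i - 1, j)" | "l = (i, j)" | "l = (i, j - 1)" using adj r by (auto simp: adj_def)
    then show ?thesis
    proof cases
      case 1
      have "rt r \<inter> lt l = {(i, j), (i, j+1)}"
        unfolding r 1 by (auto simp: rt_def right_tri_def lt_def left_tri_def)
      then show ?thesis by simp
    next
      case 2
      have "rt r \<inter> lt l = {(i+1, j), (i, j+1)}"
        unfolding r 2 by (auto simp: rt_def right_tri_def lt_def left_tri_def)
      then show ?thesis by simp
    next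
      case 3
      have "rt r \<inter> lt l = {(i, j), (i+1, j)}"
        unfolding r 3 by (auto simp: rt_def right_tri_def lt_def left_tri_def)
      then show ?thesis by simp
    qed
  qed
qed

lemma lozenge_iff: "lozenge A \<longleftrightarrow> (\<exists>r l. A = loz (r, l) \<and> adj r l)"
proof
  assume "lozenge A"
  then obtain t1 t2 where t: "A = {t1, t2}" "unit_tri t1" "unit_tri t2" "t1 \<noteq> t2" "card (t1 \<inter> t2) = 2"
    by (auto simp: lozenge_def)
  from t(2,3) obtain p q where pq: "t1 = rt p \<or> t1 = lt p" "t2 = rt q \<or> t2 = lt q" by (auto simp: unit_tri_iff)
  then consider "t1 = rt p" "t2 = lt q" | "t1 = lt p" "t2 = rt q"
    using t(4,5) rt_rt_inter lt_lt_inter by metis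
  then show "\<exists>r l. A = loz (r, l) \<and> adj r l"
  proof cases
    case 1
    then show ?thesis using t rt_lt_inter[of p q] by (intro exI[of _ p] exI[of _ q]) (auto simp: loz_def)
  next
    case 2
    then show ?thesis using t rt_lt_inter[of q p]
      by (intro exI[of _ q] exI[of _ p]) (auto simp: loz_def Int_commute)
  qed
next
  assume "\<exists>r l. A = loz (r, l) \<and> adj r l"
  then obtain r l where rl: "A = loz (r, l)" "adj r l" by blast
  show "lozenge A" unfolding lozenge_def
    by (rule exI[of _ "rt r"], rule exI[of _ "lt l"]) (use rl rt_lt_inter in \<open>auto simp: loz_def unit_tri_iff\<close>)
qed

lemma hex_rt: "hex_tri a b a (rt p) \<longleftrightarrow> in_r a b p"
proof -
  have "hex_tri a b a (rt p) \<longleftrightarrow> (\<forall>v\<in>rt p. in_hex a b a v)" by (auto simp: hex_tri_def unit_tri_iff)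
  also have "\<dots> \<longleftrightarrow> in_r a b p" by (cases p) (auto simp: in_r_def rt_def right_tri_def in_hex_def)
  finally show ?thesis .
qed

lemma hex_lt: "hex_tri a b a (lt p) \<longleftrightarrow> in_l a b p"
proof -
  have "hex_tri a b a (lt p) \<longleftrightarrow> (\<forall>v\<in>lt p. in_hex a b a v)" by (auto simp: hex_tri_def unit_tri_iff)
  also have "\<dots> \<longleftrightarrow> in_l a b p" by (cases p) (auto simp: in_l_def lt_def left_tri_def in_hex_def)
  finally show ?thesis .
qed

lemma hex_tri_iff: "hex_tri a b a t \<longleftrightarrow> (\<exists>p. t = rt p \<and> in_r a b p \<or> t = lt p \<and> in_l a b p)"
  by (metis hex_rt hex_lt hex_tri_def unit_tri_iff)

lemma rhombus_tiling_iff: "rhombus_tiling a b a T \<longleftrightarrow> (\<exists>E. T = loz ` E \<and> matching a b E)"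
proof
  assume T: "rhombus_tiling a b a T"
  define E where "E = {p. loz p \<in> T}"
  have TE: "T = loz ` E"
    using T by (force simp: rhombus_tiling_def lozenge_iff E_def)
  have 1: "adj r l \<and> in_r a b r \<and> in_l a b l" if "(r, l) \<in> E" for r l
  proof -
    have m: "loz (r, l) \<in> T" using that by (simp add: E_def)
    then have "lozenge (loz (r, l))" "\<forall>t\<in>loz (r, l). hex_tri a b a t" using T by (auto simp: rhombus_tiling_def)
    moreover from this(2) have "hex_tri a b a (rt r)" "hex_tri a b a (lt l)" by (auto simp: rt_mem_loz lt_mem_loz)
    ultimately show ?thesis by (auto simp: lozenge_iff hex_rt hex_lt)
  qed
  have 2: "\<exists>!l. (r, l) \<in> E" if "in_r a b r" for r
  proof -
    have "\<exists>!A. A \<in> T \<and> rt r \<in> A" using T that by (simp add: rhombus_tiling_def hex_rt)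
    then obtain A where A: "A \<in> T" "rt r \<in> A" and uniq: "\<And>B. B \<in> T \<Longrightarrow> rt r \<in> B \<Longrightarrow> B = A" by blast
    obtain p where p: "p \<in> E" "A = loz p" using A TE by auto
    have "(r, l) \<in> E \<Longrightarrow> (r, l) = p" for l
      using uniq[of "loz (r, l)"] TE p by (auto simp: rt_mem_loz)
    then show ?thesis using p A by (intro ex1I[of _ "snd p"]) (auto simp: rt_mem_loz)
  qed
  have 3: "\<exists>!r. (r, l) \<in> E" if "in_l a b l" for l
  proof -
    have "\<exists>!A. A \<in> T \<and> lt l \<in> A" using T that by (simp add: rhombus_tiling_def hex_lt)
    then obtain A where A: "A \<in> T" "lt l \<in> A" and uniq: "\<And>B. B \<in> T \<Longrightarrow> lt l \<in> B \<Longrightarrow> B = A" by blast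
    obtain p where p: "p \<in> E" "A = loz p" using A TE by auto
    have "(r, l) \<in> E \<Longrightarrow> (r, l) = p" for r
      using uniq[of "loz (r, l)"] TE p by (auto simp: lt_mem_loz)
    then show ?thesis using p A by (intro ex1I[of _ "fst p"]) (auto simp: lt_mem_loz)
  qed
  have "matching a b E"
    unfolding matching_def by (intro conjI allI impI 2 3) (use 1 in auto)
  with TE show "\<exists>E. T = loz ` E \<and> matching a b E" by blast
next
  assume "\<exists>E. T = loz ` E \<and> matching a b E"
  then obtain E where T: "T = loz ` E" and m: "matching a b E" by blast
  have "lozenge A \<and> (\<forall>t\<in>A. hex_tri a b a t)" if A: "A \<in> T" for A
  proof -
    obtain r l where "(r, l) \<in> E" "A = loz (r, l)" using A T by auto
    then have A: "A = loz (r, l)" and "adj r l" and "in_r a b r" "in_l a b l" using m by (auto simp: matching_def)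
    then have "lozenge A" unfolding lozenge_iff by blast
    moreover have "\<forall>t\<in>A. hex_tri a b a t"
      using \<open>in_r a b r\<close> \<open>in_l a b l\<close> unfolding A loz_def by (simp add: hex_rt hex_lt)
    ultimately show ?thesis ..
  qed
  moreover have "\<exists>!A. A \<in> T \<and> t \<in> A" if t: "hex_tri a b a t" for t
  proof -
    from t obtain p where "t = rt p \<and> in_r a b p \<or> t = lt p \<and> in_l a b p" by (auto simp: hex_tri_iff)
    then show ?thesis
    proof
      assume p: "t = rt p \<and> in_r a b p"
      then obtain l where l: "(p, l) \<in> E" "\<And>l'. (p, l') \<in> E \<Longrightarrow> l' = l" using m unfolding matching_def by metis
      show ?thesis
      proof (rule ex1I[of _ "loz (p, l)"])
        show "loz (p, l) \<in> T \<and> t \<in> loz (p, l)" using l(1) p T by (simp add: rt_mem_loz)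
        fix A assume A: "A \<in> T \<and> t \<in> A"
        then obtain q where q: "q \<in> E" "A = loz q" using T by blast
        then have "fst q = p" using A p by (simp add: rt_mem_loz)
        then have "q = (p, l)" using l(2)[of "snd q"] q(1) by (metis prod.collapse)
        then show "A = loz (p, l)" using q by simp
      qed
    next
      assume p: "t = lt p \<and> in_l a b p"
      then obtain r where r: "(r, p) \<in> E" "\<And>r'. (r', p) \<in> E \<Longrightarrow> r' = r" using m unfolding matching_def by metis
      show ?thesis
      proof (rule ex1I[of _ "loz (r, p)"])
        show "loz (r, p) \<in> T \<and> t \<in> loz (r, p)" using r(1) p T by (simp add: lt_mem_loz)
        fix A assume A: "A \<in> T \<and> t \<in> A"
        then obtain q where q: "q \<in> E" "A = loz q" using T by blast
        then have "snd q = p" using A p by (simp add: lt_mem_loz)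
        then have "q = (r, p)" using r(2)[of "fst q"] q(1) by (metis prod.collapse)
        then show "A = loz (r, p)" using q by simp
      qed
    qed
  qed
  ultimately show "rhombus_tiling a b a T" by (simp add: rhombus_tiling_def)
qed

section \<open>Reflection in the axis\<close>

definition refl_r :: "nat \<Rightarrow> cell \<Rightarrow> cell" where
  "refl_r a = (\<lambda>(i, j). (2 * int a - 1 - i, i + j - int a))"

definition refl_l :: "nat \<Rightarrow> cell \<Rightarrow> cell" where
  "refl_l a = (\<lambda>(i, j). (2 * int a - 1 - i, i + j - int a + 1))"

text \<open>The components are exchanged because a reflected right triangle is a left triangle and
  conversely; this is also why each kind needs its own index map.\<close>

definition refl_pair :: "nat \<Rightarrow> cell \<times> cell \<Rightarrow> cell \<times> cell" where
  "refl_pair a = (\<lambda>(r, l). (refl_l a l, refl_r a r))"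

lemma refl_l_r [simp]: "refl_l a (refl_r a p) = p" "refl_r a (refl_l a p) = p"
  by (cases p; simp add: refl_l_def refl_r_def)+

lemma refl_pair_invol [simp]: "refl_pair a (refl_pair a p) = p"
  by (cases p) (simp add: refl_pair_def)

lemma in_refl: "in_l a b (refl_r a p) \<longleftrightarrow> in_r a b p" "in_r a b (refl_l a p) \<longleftrightarrow> in_l a b p"
  by (cases p; auto simp: in_l_def in_r_def refl_r_def refl_l_def)+

lemma adj_refl: "adj (refl_l a l) (refl_r a r) \<longleftrightarrow> adj r l"
  by (cases r; cases l) (auto simp: adj_def refl_r_def refl_l_def)

lemma refl_rt: "refl_pt a ` rt p = lt (refl_r a p)"
  by (cases p) (auto simp: refl_pt_def rt_def right_tri_def lt_def left_tri_def refl_r_def)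

lemma refl_lt: "refl_pt a ` lt p = rt (refl_l a p)"
  by (cases p) (auto simp: refl_pt_def rt_def right_tri_def lt_def left_tri_def refl_l_def)

lemma refl_loz: "(\<lambda>t. refl_pt a ` t) ` loz p = loz (refl_pair a p)"
  by (cases p) (auto simp: loz_def refl_pair_def refl_rt refl_lt)

lemma refl_tiling_loz: "refl_tiling a (loz ` E) = loz ` refl_pair a ` E"
  by (simp add: refl_tiling_def image_image refl_loz)

definition sym_matchings :: "nat \<Rightarrow> nat \<Rightarrow> int \<Rightarrow> (cell \<times> cell) set set" where
  "sym_matchings a b c = {E. matching a b E \<and> (\<forall>p. refl_pair a p \<in> E \<longleftrightarrow> p \<in> E) \<and> ((int a, c), (int a - 1, c)) \<in> E}"

lemma inj_image_loz: "loz ` E = loz ` F \<longleftrightarrow> E = F"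
  by (rule inj_image_eq_iff) (simp add: inj_def)

lemma card_tilings_eq:
  "card {T. vsym_tiling a b T \<and> central_rhombus a b \<in> T} = card (sym_matchings a b ((int b - int a - 1) div 2))"
proof -
  let ?c = "(int b - int a - 1) div 2"
  have sym: "refl_pair a ` E = E \<longleftrightarrow> (\<forall>p. refl_pair a p \<in> E \<longleftrightarrow> p \<in> E)" for E
  proof
    assume E: "refl_pair a ` E = E"
    show "\<forall>p. refl_pair a p \<in> E \<longleftrightarrow> p \<in> E"
    proof
      fix p
      have "q \<in> E \<Longrightarrow> refl_pair a q \<in> E" for q using E by blast
      from this[of p] this[of "refl_pair a p"] show "refl_pair a p \<in> E \<longleftrightarrow> p \<in> E" by auto
    qed
  next
    assume E: "\<forall>p. refl_pair a p \<in> E \<longleftrightarrow> p \<in> E"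
    show "refl_pair a ` E = E"
    proof (intro equalityI subsetI)
      fix p assume "p \<in> E"
      then have "refl_pair a p \<in> E" using E by blast
      then show "p \<in> refl_pair a ` E" by (rule rev_image_eqI) simp
    qed (use E in blast)
  qed
  have central: "central_rhombus a b = loz ((int a, ?c), (int a - 1, ?c))"
    by (auto simp: central_rhombus_def Let_def loz_def rt_def lt_def)
  have mem: "loz p \<in> loz ` E \<longleftrightarrow> p \<in> E" for p E by auto
  have iff: "vsym_tiling a b T \<and> central_rhombus a b \<in> T \<longleftrightarrow> (\<exists>E\<in>sym_matchings a b ?c. T = loz ` E)" for T
  proof
    assume T: "vsym_tiling a b T \<and> central_rhombus a b \<in> T"
    then obtain E where "T = loz ` E" "matching a b E" by (auto simp: vsym_tiling_def rhombus_tiling_iff)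
    moreover from this T have "refl_pair a ` E = E" by (simp add: vsym_tiling_def refl_tiling_loz inj_image_loz)
    ultimately show "\<exists>E\<in>sym_matchings a b ?c. T = loz ` E"
      using T sym[of E] unfolding sym_matchings_def central by (intro bexI[of _ E]) (simp_all add: mem)
  next
    assume "\<exists>E\<in>sym_matchings a b ?c. T = loz ` E"
    then obtain E where E: "E \<in> sym_matchings a b ?c" "T = loz ` E" by blast
    then have m: "matching a b E" "((int a, ?c), (int a - 1, ?c)) \<in> E" and r: "refl_pair a ` E = E"
      using sym[of E] unfolding sym_matchings_def by blast+
    have "rhombus_tiling a b a T" using m(1) E(2) unfolding rhombus_tiling_iff by blast
    moreover have "refl_tiling a T = T" by (simp only: E(2) refl_tiling_loz r)
    moreover have "central_rhombus a b \<in> T" using m(2) by (simp only: E(2) central mem)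
    ultimately show "vsym_tiling a b T \<and> central_rhombus a b \<in> T" by (simp add: vsym_tiling_def)
  qed
  have "{T. vsym_tiling a b T \<and> central_rhombus a b \<in> T} = {T. \<exists>E\<in>sym_matchings a b ?c. T = loz ` E}"
    by (rule Collect_cong) (rule iff)
  also have "\<dots> = (\<lambda>E. loz ` E) ` sym_matchings a b ?c" by (rule image_def[symmetric])
  finally show ?thesis by (simp add: card_image inj_on_def inj_image_loz)
qed

section \<open>Tilings and towers\<close>

lemma below_Suc: "finite X \<Longrightarrow> below X (j + 1) = below X j + (if j \<in> X then 1 else 0)"
proof -
  assume fin: "finite X"
  have "x < j + 1 \<longleftrightarrow> x < j \<or> x = j" for x by auto
  then have "{x \<in> X. x < j + 1} = {x \<in> X. x < j} \<union> (if j \<in> X then {j} else {})" by auto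
  then show ?thesis using fin by (auto simp: below_def)
qed

lemma below_eq_0: "(\<And>x. x \<in> X \<Longrightarrow> j \<le> x) \<Longrightarrow> below X j = 0"
proof -
  assume "\<And>x. x \<in> X \<Longrightarrow> j \<le> x"
  then have "{x \<in> X. x < j} = {}" by fastforce
  then show ?thesis by (simp only: below_def card.empty)
qed

lemma below_eq_card: "(\<And>x. x \<in> X \<Longrightarrow> x < j) \<Longrightarrow> below X j = card X"
  unfolding below_def by (rule arg_cong[where f = card]) auto

lemma below_gt_0: "finite X \<Longrightarrow> x \<in> X \<Longrightarrow> x < j \<Longrightarrow> 0 < below X j"
  by (auto simp: below_def card_gt_0_iff)

text \<open>Gaps are open below and closed above, so only the lower bound moves. In skew coordinates
  this is the southwestern side of the hexagon, where the line \<open>k\<close> begins at height -k,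
  while the upper bound stays constant along the northwestern side.\<close>

lemma interlaces_range:
  assumes "interlaces X Y" "finite Y" "Y \<subseteq> {lo..hi}"
  shows "X \<subseteq> {lo+1..hi}"
proof
  fix x assume x: "x \<in> X"
  have fin: "finite X" and b: "below X (x+1) \<le> below Y x" "below Y (x+1) \<le> Suc (below X (x+1))" "below Y x \<le> Suc (below X x)"
    and card: "card Y = Suc (card X)" using assms(1) by (auto simp: interlaces_def)
  have "0 < below X (x+1)" using below_gt_0[OF fin x] by simp
  then have "0 < below Y x" using b by simp
  then have "\<not> (\<forall>y\<in>Y. x \<le> y)" using below_eq_0[of Y x] by auto
  then have lo: "lo + 1 \<le> x" using assms(3) by force
  have "x \<le> hi"
  proof (rule ccontr)
    assume "\<not> x \<le> hi"
    then have "below Y x = card Y" using assms(3) by (intro below_eq_card) force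
    then have "card X \<le> below X x" using b card by simp
    moreover have "below X x < card X"
      unfolding below_def using fin x by (intro psubset_card_mono) auto
    ultimately show False by simp
  qed
  with lo show "x \<in> {lo+1..hi}" by simp
qed

lemma towers_range:
  assumes "X \<in> towers a Y" "finite Y" "Y \<subseteq> {- int a..int b - 1}" "k \<le> a"
  shows "finite (X k) \<and> X k \<subseteq> {- int k..int b - 1}"
  using assms(4)
proof (induction k rule: inc_induct)
  case base
  then show ?case using assms by (simp add: towers_def)
next
  case (step k)
  have i: "interlaces (X k) (X (Suc k))" using assms(1) step by (simp add: towers_def)
  then show ?case using interlaces_range[OF i, of "- int (Suc k)" "int b - 1"] step by (simp add: interlaces_def)
qed

text \<open>The height j stands for the vertical edge from (k, j) to (k, j+1), the short diagonal of
  the lozenge. Beyond the axis the value is {}, as \<open>towers\<close> prescribes.\<close>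

definition crossings :: "nat \<Rightarrow> (cell \<times> cell) set \<Rightarrow> nat \<Rightarrow> int set" where
  "crossings a E k = (if k \<le> a then {j. ((int k, j), (int k - 1, j)) \<in> E} else {})"

text \<open>The three families are the lozenges crossing the line \<open>k\<close> and those inside a strip whose left
  triangle lies above, respectively below, the right one.\<close>

definition left_pairs :: "nat \<Rightarrow> nat \<Rightarrow> (nat \<Rightarrow> int set) \<Rightarrow> (cell \<times> cell) set" where
  "left_pairs a b X =
     {((int k, j), (int k - 1, j)) | k j. k \<le> a \<and> j \<in> X k} \<union>
     {((int k, j), (int k, j)) | k j. k < a \<and> - int k \<le> j \<and> j < int b \<and> j \<notin> X k \<and> below (X (Suc k)) j \<noteq> below (X k) j} \<union>
     {((int k, j), (int k, j - 1)) | k j. k < a \<and> - int k \<le> j \<and> j < int b \<and> below (X (Suc k)) j = below (X k) j}"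

definition all_pairs :: "nat \<Rightarrow> nat \<Rightarrow> (nat \<Rightarrow> int set) \<Rightarrow> (cell \<times> cell) set" where
  "all_pairs a b X = {p. p \<in> left_pairs a b X \<or> refl_pair a p \<in> left_pairs a b X}"

lemma left_pairs_V: "((i, j), (i - 1, j')) \<in> left_pairs a b X \<longleftrightarrow> j' = j \<and> 0 \<le> i \<and> i \<le> int a \<and> j \<in> X (nat i)"
proof (cases "0 \<le> i")
  case True
  then obtain k where "i = int k" by (rule nonneg_int_cases)
  then show ?thesis by (auto simp: left_pairs_def)
qed (auto simp: left_pairs_def)

lemma left_pairs_U: "((i, j), (i, j)) \<in> left_pairs a b X \<longleftrightarrow> 0 \<le> i \<and> i < int a \<and> - i \<le> j \<and> j < int b \<and>
    j \<notin> X (nat i) \<and> below (X (Suc (nat i))) j \<noteq> below (X (nat i)) j"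
proof (cases "0 \<le> i")
  case True
  then obtain k where "i = int k" by (rule nonneg_int_cases)
  then show ?thesis by (auto simp: left_pairs_def)
qed (auto simp: left_pairs_def)

lemma left_pairs_D: "((i, j), (i, j - 1)) \<in> left_pairs a b X \<longleftrightarrow> 0 \<le> i \<and> i < int a \<and> - i \<le> j \<and> j < int b \<and>
    below (X (Suc (nat i))) j = below (X (nat i)) j"
proof (cases "0 \<le> i")
  case True
  then obtain k where "i = int k" by (rule nonneg_int_cases)
  then show ?thesis by (auto simp: left_pairs_def)
qed (auto simp: left_pairs_def)

lemma left_pairs_adj: "(r, l) \<in> left_pairs a b X \<Longrightarrow> adj r l \<and> fst r \<le> int a \<and> fst l < int a"
  by (auto simp: left_pairs_def adj_def)

text \<open>If a pair meets the left half and its mirror image is listed in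
  \<open>left_pairs\<close>, it crosses the axis; such a pair is its own mirror image, so reflecting
  adds nothing new on the left.\<close>

lemma all_pairs_left:
  assumes "fst r < int a \<or> fst l < int a"
  shows "(r, l) \<in> all_pairs a b X \<longleftrightarrow> (r, l) \<in> left_pairs a b X"
proof
  assume "(r, l) \<in> all_pairs a b X"
  then show "(r, l) \<in> left_pairs a b X" unfolding all_pairs_def mem_Collect_eq
  proof
    assume q: "refl_pair a (r, l) \<in> left_pairs a b X"
    then have q': "(refl_l a l, refl_r a r) \<in> left_pairs a b X" by (simp add: refl_pair_def)
    have "adj (refl_l a l) (refl_r a r)" "fst (refl_l a l) \<le> int a" "fst (refl_r a r) < int a"
      using left_pairs_adj[OF q'] by blast+
    then have 1: "adj r l" "2 * int a - 1 - fst l \<le> int a" "2 * int a - 1 - fst r < int a"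
      by (simp_all add: adj_refl) (simp_all add: refl_l_def refl_r_def case_prod_unfold)
    then have "fst r = int a" "fst l = int a - 1" using assms by (auto simp: adj_def)
    then have "refl_pair a (r, l) = (r, l)" using 1(1)
      by (cases r; cases l) (auto simp: refl_pair_def refl_l_def refl_r_def adj_def)
    then show ?thesis using q by simp
  qed
qed (simp add: all_pairs_def)

lemma all_pairs_sym: "refl_pair a p \<in> all_pairs a b X \<longleftrightarrow> p \<in> all_pairs a b X"
  by (auto simp: all_pairs_def)

text \<open>The triangles of the strip between the lines \<open>k\<close> and \<open>k + 1\<close> form a vertical chain.  Going up this
  chain, the difference of the numbers of crossings below height \<open>j\<close> on the two lines decides whether the
  right triangle at \<open>j\<close> is joined to the left triangle below it.\<close>

lemma matching_strip:
  assumes m: "matching a b E" and k: "k < a"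
  defines "X \<equiv> crossings a E k" and "Y \<equiv> crossings a E (Suc k)"
  shows "X \<subseteq> {- int k..int b - 1}" "Y \<subseteq> {- int (Suc k)..int b - 1}"
    and "- int k \<le> j \<Longrightarrow> j \<le> int b \<Longrightarrow>
      below Y j + (if ((int k, j), (int k, j - 1)) \<in> E then 1 else 0) = Suc (below X j)"
    and "- int k \<le> j \<Longrightarrow> j < int b \<Longrightarrow>
      (if j \<in> X then 1 else 0) + (if ((int k, j), (int k, j)) \<in> E then 1 else 0) +
      (if ((int k, j), (int k, j - 1)) \<in> E then 1 else 0) = (1 :: nat)"
proof -
  have E: "adj r l" "in_r a b r" "in_l a b l" if "(r, l) \<in> E" for r l
    using m that by (auto simp: matching_def)
  have XE: "j \<in> X \<longleftrightarrow> ((int k, j), (int k - 1, j)) \<in> E" and YE: "j \<in> Y \<longleftrightarrow> ((int k + 1, j), (int k, j)) \<in> E" for j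
    using k by (auto simp: X_def Y_def crossings_def add.commute)
  show X: "X \<subseteq> {- int k..int b - 1}"
    using E(2) by (fastforce simp: XE in_r_def)
  show Y: "Y \<subseteq> {- int (Suc k)..int b - 1}"
    using E(2) by (fastforce simp: YE in_r_def)
  have fin: "finite X" "finite Y" using X Y finite_subset by blast+
  have R: "(if j \<in> X then 1 else 0) + (if ((int k, j), (int k, j)) \<in> E then 1 else 0) +
      (if ((int k, j), (int k, j - 1)) \<in> E then 1 else 0) = (1 :: nat)" if "- int k \<le> j" "j < int b" for j
  proof -
    have "in_r a b (int k, j)" using that k by (simp add: in_r_def)
    then obtain l where l: "((int k, j), l) \<in> E" and u: "\<And>l'. ((int k, j), l') \<in> E \<Longrightarrow> l' = l"
      using m unfolding matching_def by metis
    have "l = (int k - 1, j) \<or> l = (int k, j) \<or> l = (int k, j - 1)" using E(1)[OF l] by (simp add: adj_def)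
    then show ?thesis unfolding XE
      using l u[of "(int k - 1, j)"] u[of "(int k, j)"] u[of "(int k, j - 1)"] by auto
  qed
  have L: "(if j \<in> Y then 1 else 0) + (if ((int k, j), (int k, j)) \<in> E then 1 else 0) +
      (if ((int k, j + 1), (int k, j)) \<in> E then 1 else 0) = (1 :: nat)" if "- int k - 1 \<le> j" "j < int b" for j
  proof -
    have "in_l a b (int k, j)" using that k by (simp add: in_l_def)
    then obtain r where r: "(r, (int k, j)) \<in> E" and u: "\<And>r'. (r', (int k, j)) \<in> E \<Longrightarrow> r' = r"
      using m unfolding matching_def by metis
    have "r = (int k + 1, j) \<or> r = (int k, j) \<or> r = (int k, j + 1)"
      using E(1)[OF r] by (cases r) (auto simp: adj_def)
    then show ?thesis unfolding YE
      using r u[of "(int k + 1, j)"] u[of "(int k, j)"] u[of "(int k, j + 1)"] by auto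
  qed
  show "- int k \<le> j \<Longrightarrow> j < int b \<Longrightarrow>
      (if j \<in> X then 1 else 0) + (if ((int k, j), (int k, j)) \<in> E then 1 else 0) +
      (if ((int k, j), (int k, j - 1)) \<in> E then 1 else 0) = (1 :: nat)" by (rule R)
  \<comment> \<open>Climb the strip one unit at a time, using that the right triangle
    (\<open>R\<close>) and the left triangle (\<open>L\<close>) at the current height are each
    matched exactly once.\<close>
  have "int d \<le> int b + int k \<Longrightarrow> below Y (- int k + int d) +
      (if ((int k, - int k + int d), (int k, - int k + int d - 1)) \<in> E then 1 else 0) = Suc (below X (- int k + int d))" for d
  proof (induction d)
    case 0
    have "below X (- int k) = 0" using X by (intro below_eq_0) auto
    moreover have "below Y (- int k) = (if - int k - 1 \<in> Y then 1 else 0)"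
    proof -
      have "below Y (- int k - 1) = 0" using Y by (intro below_eq_0) auto
      then show ?thesis using below_Suc[OF fin(2), of "- int k - 1"] by simp
    qed
    \<comment> \<open>The strip starts with a left triangle at height -k-1 whose right neighbour of
      the same index lies outside the hexagon. This extra left triangle is the source of the
      \<open>Suc\<close> in the identity.\<close>
    moreover have "((int k, - int k - 1), (int k, - int k - 1)) \<notin> E" using E(2) by (fastforce simp: in_r_def)
    ultimately show ?case using L[of "- int k - 1"] by auto
  next
    case (Suc d)
    let ?j = "- int k + int d"
    have j: "- int k + int (Suc d) = ?j + 1" by simp
    have "below X (?j + 1) = below X ?j + (if ?j \<in> X then 1 else 0)" "below Y (?j + 1) = below Y ?j + (if ?j \<in> Y then 1 else 0)"
      using fin by (simp_all add: below_Suc)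
    moreover have "int d \<le> int b + int k" "- int k \<le> ?j" "?j < int b" "- int k - 1 \<le> ?j" using Suc.prems by auto
    ultimately show ?case unfolding j using Suc.IH R[of ?j] L[of ?j] by (simp split: if_splits)
  qed
  from this[of "nat (j + int k)"]
  show "- int k \<le> j \<Longrightarrow> j \<le> int b \<Longrightarrow>
      below Y j + (if ((int k, j), (int k, j - 1)) \<in> E then 1 else 0) = Suc (below X j)" by simp
qed

lemma matching_interlaces:
  assumes m: "matching a b E" and k: "k < a"
  shows "interlaces (crossings a E k) (crossings a E (Suc k))"
proof -
  define X Y where "X = crossings a E k" and "Y = crossings a E (Suc k)"
  note s = matching_strip[OF m k, folded X_def Y_def]
  have fin: "finite X" "finite Y" using s(1,2) finite_subset by blast+
  have nb: "((int k, int b), l) \<notin> E" for l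
    using m by (fastforce simp: matching_def in_r_def)
  have top: "below Y j = card Y \<and> below X j = card X" if "int b \<le> j" for j
    using s(1,2) that by (intro conjI below_eq_card) force+
  \<comment> \<open>At height b the strip contains no right triangle, so the strip identity has no
    correction term there and compares the full cardinalities.\<close>
  have card: "card Y = Suc (card X)" using s(3)[of "int b"] top[of "int b"] nb by simp
  have "below X (j+1) \<le> below Y j \<and> below Y j \<le> Suc (below X j)" for j
  proof -
    consider "j < - int k" | "- int k \<le> j" "j < int b" | "int b \<le> j" by linarith
    then show ?thesis
    proof cases
      case 1
      have "below X (j+1) = 0" using s(1) 1 by (intro below_eq_0) force
      moreover have "below Y j = 0" using s(2) 1 by (intro below_eq_0) force
      ultimately show ?thesis by simp
    next
      case 2
      then show ?thesis using s(3)[of j] s(4)[of j] below_Suc[OF fin(1), of j] by (simp split: if_splits)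
    next
      case 3
      then show ?thesis using top[of j] top[of "j+1"] card by simp
    qed
  qed
  then show ?thesis using fin card unfolding X_def[symmetric] Y_def[symmetric] by (simp add: interlaces_def)
qed

lemma crossings_towers:
  assumes m: "matching a b E"
  shows "crossings a E \<in> towers a (crossings a E a)" "finite (crossings a E a)" "card (crossings a E a) = a"
    "0 < a \<Longrightarrow> crossings a E a \<subseteq> {- int a..int b - 1}"
proof -
  have 0: "crossings a E 0 = {}" using m by (fastforce simp: crossings_def matching_def in_l_def)
  have "\<forall>i>a. crossings a E i = {}" by (simp add: crossings_def)
  then show "crossings a E \<in> towers a (crossings a E a)"
    using matching_interlaces[OF m] 0 by (simp add: towers_def)
  have "k \<le> a \<Longrightarrow> card (crossings a E k) = k" for k
    by (induction k) (use 0 matching_interlaces[OF m] in \<open>auto simp: interlaces_def\<close>)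
  then show "card (crossings a E a) = a" by simp
  show "0 < a \<Longrightarrow> crossings a E a \<subseteq> {- int a..int b - 1}"
    using matching_strip(2)[OF m, of "a - 1"] by simp
  then show "finite (crossings a E a)" using 0 finite_subset by (cases "a = 0") auto
qed

text \<open>In every strip left of the axis the identities of \<open>matching_strip\<close> read off
  the partner of each right triangle from the crossings. Pairs on the axis are crossings themselves,
  and the right half follows by symmetry.\<close>

lemma matching_eq_all_pairs:
  assumes m: "matching a b E" and sym: "\<And>p. refl_pair a p \<in> E \<longleftrightarrow> p \<in> E"
  shows "E = all_pairs a b (crossings a E)"
proof -
  let ?X = "crossings a E"
  have E: "adj r l" "in_r a b r" "in_l a b l" if "(r, l) \<in> E" for r l
    using m that by (auto simp: matching_def)
  have left: "((i, j), l) \<in> E \<longleftrightarrow> ((i, j), l) \<in> left_pairs a b ?X" if i: "0 \<le> i" "i < int a" for i j l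
  proof -
    define k where "k = nat i"
    have ik: "i = int k" "k < a" using i by (simp_all add: k_def)
    have rng: "in_r a b (int k, j) \<longleftrightarrow> - int k \<le> j \<and> j < int b" using ik by (auto simp: in_r_def)
    note s = matching_strip[OF m ik(2)]
    consider (V) "l = (i - 1, j)" | (U) "l = (i, j)" | (D) "l = (i, j - 1)" | (N) "\<not> adj (i, j) l"
      by (auto simp: adj_def)
    then show ?thesis
    proof cases
      case V
      then show ?thesis using ik unfolding V left_pairs_V by (auto simp: crossings_def)
    next
      case U
      have "((int k, j), (int k, j)) \<in> E \<Longrightarrow> - int k \<le> j \<and> j < int b" using E(2) rng by blast
      then show ?thesis unfolding U left_pairs_U ik
        using s(3)[of j] s(4)[of j] ik by (auto split: if_splits)
    next
      case D
      have "((int k, j), (int k, j - 1)) \<in> E \<Longrightarrow> - int k \<le> j \<and> j < int b" using E(2) rng by blast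
      then show ?thesis unfolding D left_pairs_D ik
        using s(3)[of j] s(4)[of j] ik by (auto split: if_splits)
    next
      case N
      then show ?thesis using E(1) left_pairs_adj by blast
    qed
  qed
  have axis: "((int a, j), (int a - 1, j)) \<in> left_pairs a b ?X \<longleftrightarrow> ((int a, j), (int a - 1, j)) \<in> E" for j
    unfolding left_pairs_V by (simp add: crossings_def)
  have sub: "p \<in> E" if "p \<in> left_pairs a b ?X" for p
  proof -
    obtain i j l where p: "p = ((i, j), l)" by (metis prod.collapse)
    have "0 \<le> i" using that by (auto simp: p left_pairs_def)
    moreover have "i \<le> int a" "fst l < int a" "adj (i, j) l"
      using left_pairs_adj[OF that[unfolded p]] by auto
    ultimately show ?thesis
      using left[of i j l] axis[of j] that unfolding p by (cases "i < int a") (auto simp: adj_def)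
  qed
  show ?thesis
  proof (intro equalityI subsetI)
    fix p assume p: "p \<in> E"
    obtain i j l where pe: "p = ((i, j), l)" by (metis prod.collapse)
    have i0: "0 \<le> i" "i < 2 * int a" and adj: "adj (i, j) l"
      using E(1,2)[OF p[unfolded pe]] by (auto simp: in_r_def)
    show "p \<in> all_pairs a b ?X"
    proof (cases "i < int a")
      case True
      then show ?thesis using left[OF i0(1)] p pe by (simp add: all_pairs_def)
    next
      case False
      show ?thesis
      proof (cases "l = (i - 1, j) \<and> i = int a")
        case True
        then show ?thesis using axis[of j] p pe by (simp add: all_pairs_def)
      next
        case nax: False
        obtain i' j' l' where q: "refl_pair a p = ((i', j'), l')" by (metis prod.collapse)
        have qE: "((i', j'), l') \<in> E" using sym[of p] p q by simp
        have "i' = 2 * int a - 1 - fst l" using q pe by (cases l) (auto simp: refl_pair_def refl_l_def)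
        then have "i' < int a" using nax False adj by (auto simp: adj_def)
        moreover have "0 \<le> i'" using E(2)[OF qE] by (simp add: in_r_def)
        ultimately show ?thesis using left[of i' j' l'] qE q by (simp add: all_pairs_def)
      qed
    qed
  next
    fix p assume "p \<in> all_pairs a b ?X"
    then show "p \<in> E" unfolding all_pairs_def using sub sym by blast
  qed
qed


section \<open>From towers back to matchings\<close>

lemma interlaces_below: "interlaces A B \<Longrightarrow> j \<in> A \<Longrightarrow> below B j = Suc (below A j)"
proof -
  assume i: "interlaces A B" and j: "j \<in> A"
  have "below A (j+1) \<le> below B j" "below B j \<le> Suc (below A j)" "finite A"
    using i unfolding interlaces_def by blast+
  then show ?thesis using below_Suc[of A j] j by simp
qed

text \<open>Unique partners are checked for right and left triangles of the left half only.
  Reflection exchanges the two kinds, so a right triangle of the right half is handled by the result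
  for left triangles, and conversely.\<close>

lemma all_pairs_matching:
  assumes X: "X \<in> towers a Y" and Y: "finite Y" "Y \<subseteq> {- int a..int b - 1}" and a: "0 < a"
  shows "matching a b (all_pairs a b X)"
proof -
  let ?L = "left_pairs a b X" and ?E = "all_pairs a b X"
  have rng: "finite (X k)" "X k \<subseteq> {- int k..int b - 1}" if "k \<le> a" for k
    using towers_range[OF X Y that] by auto
  have il: "interlaces (X k) (X (Suc k))" if "k < a" for k using X that by (simp add: towers_def)
  have X0: "X 0 = {}" using X by (simp add: towers_def)
  have strip: "adj r l \<and> in_r a b r \<and> in_l a b l" if "(r, l) \<in> ?L" for r l
  proof -
    obtain i j where r: "r = (i, j)" by (cases r)
    have adj: "adj (i, j) l" using left_pairs_adj that r by blast
    then consider "l = (i - 1, j)" | "l = (i, j)" | "l = (i, j - 1)" by (auto simp: adj_def)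
    then show ?thesis
    proof cases
      case 1
      then have i: "0 \<le> i" "i \<le> int a" "j \<in> X (nat i)" using that by (simp_all add: r left_pairs_V)
      then have "nat i \<noteq> 0" using X0 by (metis empty_iff)
      moreover have "- i \<le> j" "j \<le> int b - 1"
      proof -
        have "nat i \<le> a" "int (nat i) = i" using i by simp_all
        then have "X (nat i) \<subseteq> {- i..int b - 1}" using rng(2)[of "nat i"] by simp
        then show "- i \<le> j" "j \<le> int b - 1" using i(3) by auto
      qed
      ultimately show ?thesis using adj i a by (simp add: r 1 in_r_def in_l_def)
    next
      case 2
      then show ?thesis using that adj by (auto simp: r left_pairs_U in_r_def in_l_def)
    next
      case 3
      then show ?thesis using that adj by (auto simp: r left_pairs_D in_r_def in_l_def)
    qed
  qed
  have all: "adj r l \<and> in_r a b r \<and> in_l a b l" if "(r, l) \<in> ?E" for r l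
    using that strip[of r l] strip[of "refl_l a l" "refl_r a r"]
    by (auto simp: all_pairs_def refl_pair_def adj_refl in_refl)
  have uniq_r: "\<exists>!l. (r, l) \<in> ?E" if r: "in_r a b r" "fst r < int a" for r
  proof -
    obtain k j where k: "r = (int k, j)" "k < a" using r
      by (cases r) (auto simp: in_r_def dest: zero_le_imp_eq_int)
    have j: "- int k \<le> j" "j < int b" using r k by (auto simp: in_r_def)
    have "(r, l) \<in> ?E \<longleftrightarrow> l = (int k - 1, j) \<and> j \<in> X k \<or>
        l = (int k, j) \<and> j \<notin> X k \<and> below (X (Suc k)) j \<noteq> below (X k) j \<or>
        l = (int k, j - 1) \<and> below (X (Suc k)) j = below (X k) j" for l
    proof -
      have "(r, l) \<in> ?E \<longleftrightarrow> (r, l) \<in> ?L" using r by (intro all_pairs_left) simp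
      also have "\<dots> \<longleftrightarrow> adj r l \<and> (r, l) \<in> ?L" using left_pairs_adj by blast
      also have "\<dots> \<longleftrightarrow> (l = (int k - 1, j) \<and> (r, (int k - 1, j)) \<in> ?L) \<or> (l = (int k, j) \<and> (r, (int k, j)) \<in> ?L) \<or>
          (l = (int k, j - 1) \<and> (r, (int k, j - 1)) \<in> ?L)" by (auto simp: adj_def k)
      finally show ?thesis using j k unfolding k left_pairs_V left_pairs_U left_pairs_D by auto
    qed
    then show ?thesis using interlaces_below[OF il[OF k(2)], of j]
      by (cases "j \<in> X k"; cases "below (X (Suc k)) j = below (X k) j") auto
  qed
  have uniq_l: "\<exists>!r. (r, l) \<in> ?E" if l: "in_l a b l" "fst l < int a" for l
  proof -
    obtain k j where k: "l = (int k, j)" "k < a" using l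
      by (cases l) (auto simp: in_l_def dest: zero_le_imp_eq_int)
    have j: "- int k - 1 \<le> j" "j < int b" using l k by (auto simp: in_l_def)
    define A B where "A = X k" and "B = X (Suc k)"
    have A: "finite A" "A \<subseteq> {- int k..int b - 1}" and B: "finite B" "B \<subseteq> {- int (Suc k)..int b - 1}"
      using rng[of k] rng[of "Suc k"] k by (auto simp: A_def B_def)
    have i: "interlaces A B" using il[OF k(2)] by (simp add: A_def B_def)
    have iff: "(r, l) \<in> ?E \<longleftrightarrow> r = (int k + 1, j) \<and> j \<in> B \<or>
        r = (int k, j) \<and> - int k \<le> j \<and> j \<notin> A \<and> below B j \<noteq> below A j \<or>
        r = (int k, j + 1) \<and> j + 1 < int b \<and> below B (j + 1) = below A (j + 1)" for r
    proof -
      have "(r, l) \<in> ?E \<longleftrightarrow> (r, l) \<in> ?L" using l by (intro all_pairs_left) simp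
      also have "\<dots> \<longleftrightarrow> adj r l \<and> (r, l) \<in> ?L" using left_pairs_adj by blast
      also have "\<dots> \<longleftrightarrow> (r = (int k + 1, j) \<and> ((int k + 1, j), (int k + 1 - 1, j)) \<in> ?L) \<or> (r = (int k, j) \<and> ((int k, j), (int k, j)) \<in> ?L) \<or>
          (r = (int k, j + 1) \<and> ((int k, j + 1), (int k, j + 1 - 1)) \<in> ?L)" by (cases r) (auto simp: adj_def k)
      finally show ?thesis using j k unfolding k left_pairs_V left_pairs_U left_pairs_D
        by (auto simp: A_def B_def nat_add_distrib)
    qed
    \<comment> \<open>At height b the two counts are the cardinalities and differ by one, so the
      equality of counts in the third alternative already implies j + 1 < b.\<close>
    have top: "below B (int b) = Suc (below A (int b))"
    proof -
      have "below B (int b) = card B" using B by (intro below_eq_card) auto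
      moreover have "below A (int b) = card A" using A by (intro below_eq_card) auto
      ultimately show ?thesis using i by (simp add: interlaces_def)
    qed
    have D: "j + 1 < int b \<and> below B (j + 1) = below A (j + 1) \<longleftrightarrow> below B (j + 1) = below A (j + 1)"
      using top j by (cases "j + 1 = int b") auto
    have S: "below A (j+1) = below A j + (if j \<in> A then 1 else 0)" "below B (j+1) = below B j + (if j \<in> B then 1 else 0)"
      using A B by (simp_all add: below_Suc)
    have i': "below A (t+1) \<le> below B t \<and> below B t \<le> Suc (below A t)" for t
      using i unfolding interlaces_def by blast
    have I: "below A (j+1) \<le> below B j" "below B j \<le> Suc (below A j)" "below B (j+1) \<le> Suc (below A (j+1))"
      "below A (j+1) \<le> below B (j+1)"
      using i'[of j] i'[of "j+1"] S by linarith+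
    have uni: "\<exists>!r. r = p \<and> P \<or> r = q \<and> Q' \<or> r = s \<and> R" if "(P \<and> \<not> Q' \<and> \<not> R) \<or> (\<not> P \<and> Q' \<and> \<not> R) \<or> (\<not> P \<and> \<not> Q' \<and> R)"
      for p q s :: cell and P Q' R using that by blast
    show ?thesis unfolding iff
    proof (rule uni)
      show "(j \<in> B \<and> \<not> (- int k \<le> j \<and> j \<notin> A \<and> below B j \<noteq> below A j) \<and> \<not> (j + 1 < int b \<and> below B (j + 1) = below A (j + 1))) \<or>
        (\<not> j \<in> B \<and> (- int k \<le> j \<and> j \<notin> A \<and> below B j \<noteq> below A j) \<and> \<not> (j + 1 < int b \<and> below B (j + 1) = below A (j + 1))) \<or>
        (\<not> j \<in> B \<and> \<not> (- int k \<le> j \<and> j \<notin> A \<and> below B j \<noteq> below A j) \<and> (j + 1 < int b \<and> below B (j + 1) = below A (j + 1)))"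
      \<comment> \<open>The negative case is j = -k-1, the lowest left triangle of the strip, which
        has no right triangle of the same index in the hexagon.\<close>
      proof (cases "- int k \<le> j")
        case True
        then show ?thesis unfolding D using S I by (auto split: if_splits)
      next
        case False
        then have "below A j = 0" "below B j = 0" "j \<notin> A"
          using A B j by (auto intro!: below_eq_0)
        then show ?thesis unfolding D using S False by (auto split: if_splits)
      qed
    qed
  qed
  have sym: "(refl_l a l, refl_r a r) \<in> ?E \<longleftrightarrow> (r, l) \<in> ?E" for r l
    using all_pairs_sym[of a "(r, l)" b X] by (simp add: refl_pair_def)
  have "\<exists>!l. (r, l) \<in> ?E" if r: "in_r a b r" for r
  proof (cases "fst r < int a")
    case False
    have "fst (refl_r a r) < int a" using False by (simp add: refl_r_def case_prod_unfold)
    then obtain s where s: "(s, refl_r a r) \<in> ?E" "\<And>s'. (s', refl_r a r) \<in> ?E \<Longrightarrow> s' = s"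
      using uniq_l[of "refl_r a r"] r by (auto simp: in_refl)
    show ?thesis
    proof (rule ex1I[of _ "refl_r a s"])
      show "(r, refl_r a s) \<in> ?E" using s(1) sym[of "refl_r a s" r] by simp
      fix l assume "(r, l) \<in> ?E"
      then have "refl_l a l = s" using s(2) sym by blast
      then show "l = refl_r a s" by auto
    qed
  qed (use r uniq_r in blast)
  moreover have "\<exists>!r. (r, l) \<in> ?E" if l: "in_l a b l" for l
  proof (cases "fst l < int a")
    case False
    have "fst (refl_l a l) < int a" using False by (simp add: refl_l_def case_prod_unfold)
    then obtain s where s: "(refl_l a l, s) \<in> ?E" "\<And>s'. (refl_l a l, s') \<in> ?E \<Longrightarrow> s' = s"
      using uniq_r[of "refl_l a l"] l by (auto simp: in_refl)
    show ?thesis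
    proof (rule ex1I[of _ "refl_l a s"])
      show "(refl_l a s, l) \<in> ?E" using s(1) sym[of l "refl_l a s"] by simp
      fix r assume "(r, l) \<in> ?E"
      then have "refl_r a r = s" using s(2) sym by blast
      then show "r = refl_l a s" by auto
    qed
  qed (use l uniq_l in blast)
  ultimately show ?thesis using all by (auto simp: matching_def)
qed

lemma crossings_all_pairs:
  assumes "X \<in> towers a Y"
  shows "crossings a (all_pairs a b X) = X"
proof
  fix k
  show "crossings a (all_pairs a b X) k = X k"
  proof (cases "k \<le> a")
    case True
    then have "((int k, j), (int k - 1, j)) \<in> all_pairs a b X \<longleftrightarrow> j \<in> X k" for j
      by (subst all_pairs_left) (auto simp: left_pairs_V)
    then show ?thesis using True by (simp add: crossings_def)
  next
    case False
    then show ?thesis using assms by (simp add: crossings_def towers_def)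
  qed
qed

text \<open>\<open>crossings\<close> and \<open>all_pairs\<close> are mutually inverse between
  symmetric matchings and towers whose top is the crossing set on the axis; the prescribed central
  lozenge becomes the condition that this top contains \<open>c\<close>.\<close>

lemma card_sym_matchings:
  assumes a: "0 < a"
  shows "real (card (sym_matchings a b c)) =
    (\<Sum>Y | Y \<subseteq> {- int a..int b - 1} \<and> card Y = a \<and> c \<in> Y. set_vdm Y) / (\<Prod>r<a. fact r)"
proof -
  let ?F = "{Y. Y \<subseteq> {- int a..int b - 1} \<and> card Y = a \<and> c \<in> Y}"
  have finF: "finite ?F" by (rule finite_subset[of _ "Pow {- int a..int b - 1}"]) auto
  have finY: "finite Y" if "Y \<in> ?F" for Y using that finite_subset[of Y "{- int a..int b - 1}"] by auto
  have ct: "finite (towers a Y) \<and> real (card (towers a Y)) = set_vdm Y / (\<Prod>r<a. fact r)" if "Y \<in> ?F" for Y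
  proof (rule card_towers)
    show "finite Y" by (rule finY[OF that])
    show "card Y = a" using that by simp
  qed
  have "bij_betw (crossings a) (sym_matchings a b c) (\<Union>Y\<in>?F. towers a Y)"
  proof (rule bij_betw_byWitness[where f' = "all_pairs a b"])
    show "\<forall>E\<in>sym_matchings a b c. all_pairs a b (crossings a E) = E"
    proof
      fix E assume "E \<in> sym_matchings a b c"
      from this[unfolded sym_matchings_def mem_Collect_eq]
      have *: "matching a b E \<and> (\<forall>p. refl_pair a p \<in> E \<longleftrightarrow> p \<in> E) \<and> ((int a, c), (int a - 1, c)) \<in> E" .
      note m = *[THEN conjunct1] and s = *[THEN conjunct2, THEN conjunct1]
      show "all_pairs a b (crossings a E) = E" by (rule matching_eq_all_pairs[symmetric, OF m s[rule_format]])
    qed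
    show "\<forall>X\<in>\<Union>Y\<in>?F. towers a Y. crossings a (all_pairs a b X) = X"
      using crossings_all_pairs by blast
    show "crossings a ` sym_matchings a b c \<subseteq> (\<Union>Y\<in>?F. towers a Y)"
    proof
      fix X assume "X \<in> crossings a ` sym_matchings a b c"
      then obtain E where E: "E \<in> sym_matchings a b c" "X = crossings a E" by blast
      from E(1)[unfolded sym_matchings_def mem_Collect_eq]
      have *: "matching a b E \<and> (\<forall>p. refl_pair a p \<in> E \<longleftrightarrow> p \<in> E) \<and> ((int a, c), (int a - 1, c)) \<in> E" .
      note m = *[THEN conjunct1] and c = *[THEN conjunct2, THEN conjunct2]
      have "c \<in> crossings a E a" using c by (simp add: crossings_def)
      then have "crossings a E a \<in> ?F" using crossings_towers(3,4)[OF m] a by simp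
      then show "X \<in> (\<Union>Y\<in>?F. towers a Y)" using crossings_towers(1)[OF m] E(2) by blast
    qed
    show "all_pairs a b ` (\<Union>Y\<in>?F. towers a Y) \<subseteq> sym_matchings a b c"
    proof
      fix E assume "E \<in> all_pairs a b ` (\<Union>Y\<in>?F. towers a Y)"
      then obtain X Y where Y: "Y \<in> ?F" and X: "X \<in> towers a Y" and E: "E = all_pairs a b X" by blast
      have "matching a b E" using all_pairs_matching[OF X finY[OF Y] _ a] Y E by simp
      moreover have "((int a, c), (int a - 1, c)) \<in> left_pairs a b X"
        unfolding left_pairs_V using X Y by (simp add: towers_def)
      moreover from this have "((int a, c), (int a - 1, c)) \<in> all_pairs a b X" by (simp add: all_pairs_def)
      ultimately show "E \<in> sym_matchings a b c"
        unfolding sym_matchings_def mem_Collect_eq E by (intro conjI allI all_pairs_sym)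
    qed
  qed
  then have "card (sym_matchings a b c) = card (\<Union>Y\<in>?F. towers a Y)" by (rule bij_betw_same_card)
  also have "\<dots> = (\<Sum>Y\<in>?F. card (towers a Y))"
  proof (rule card_UN_disjoint[OF finF])
    show "\<forall>Y\<in>?F. finite (towers a Y)" using ct by blast
    have "X a = Y" if "X \<in> towers a Y" for X Y using that by (simp add: towers_def)
    then show "\<forall>Y\<in>?F. \<forall>Y'\<in>?F. Y \<noteq> Y' \<longrightarrow> towers a Y \<inter> towers a Y' = {}" by blast
  qed
  also have "real \<dots> = (\<Sum>Y\<in>?F. set_vdm Y / (\<Prod>r<a. fact r))"
    unfolding of_nat_sum by (rule sum.cong[OF refl]) (rule ct[THEN conjunct2])
  finally have "real (card (sym_matchings a b c)) = (\<Sum>Y\<in>?F. set_vdm Y / (\<Prod>r<a. fact r))" .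
  then show ?thesis by (simp only: sum_divide_distrib)
qed

section \<open>Recentring the axis\<close>

lemma set_vdm_shift: "set_vdm ((\<lambda>x. x + c) ` S) = set_vdm S"
proof -
  let ?f = "\<lambda>(p, q). (p + c, q + c)"
  have "bij_betw ?f {(p,q). p \<in> S \<and> q \<in> S \<and> p < q}
    {(p,q). p \<in> (\<lambda>x. x + c) ` S \<and> q \<in> (\<lambda>x. x + c) ` S \<and> p < q}"
    by (rule bij_betw_byWitness[where f' = "\<lambda>(p, q). (p - c, q - c)"]) auto
  from prod.reindex_bij_betw[OF this, of "\<lambda>(p,q). real_of_int (q - p)"]
  show ?thesis by (simp add: set_vdm_def case_prod_unfold)
qed

lemma sum_set_vdm_shift:
  "(\<Sum>Y | Y \<subseteq> {lo + c..hi + c} \<and> card Y = m \<and> c \<in> Y. set_vdm Y) =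
   (\<Sum>Y | Y \<subseteq> {lo..hi} \<and> card Y = m \<and> 0 \<in> Y. set_vdm Y)" for c :: int
proof -
  let ?f = "\<lambda>d :: int. (`) (\<lambda>x. x + d)"
  have inv: "?f (- d) (?f d S) = S" for d S by (simp add: image_image)
  have card: "card (?f d S) = card S" for d S by (simp add: card_image inj_on_def)
  have card': "card ((\<lambda>x. x - d) ` S) = card S" for d :: int and S using card[of "- d" S] by simp
  have "bij_betw (?f c) {Y. Y \<subseteq> {lo..hi} \<and> card Y = m \<and> 0 \<in> Y} {Y. Y \<subseteq> {lo + c..hi + c} \<and> card Y = m \<and> c \<in> Y}"
  proof (rule bij_betw_byWitness[where f' = "?f (- c)"])
    show "?f c ` {Y. Y \<subseteq> {lo..hi} \<and> card Y = m \<and> 0 \<in> Y} \<subseteq> {Y. Y \<subseteq> {lo + c..hi + c} \<and> card Y = m \<and> c \<in> Y}"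
      by (auto simp: card)
    show "?f (- c) ` {Y. Y \<subseteq> {lo + c..hi + c} \<and> card Y = m \<and> c \<in> Y} \<subseteq> {Y. Y \<subseteq> {lo..hi} \<and> card Y = m \<and> 0 \<in> Y}"
      by (auto simp: card')
  qed (use inv[of c] inv[of "- c"] in simp_all)
  from sum.reindex_bij_betw[OF this, of set_vdm] show ?thesis by (simp add: set_vdm_shift)
qed

theorem theorem2:
  fixes n x :: nat
  assumes "x \<ge> 1"
  shows "real (card {T. vsym_tiling (2*n+1) (2*x) T \<and> central_rhombus (2*n+1) (2*x) \<in> T})
           = Q (n+1) x * ST (2*n+1) (2*x)"
proof -
  \<comment> \<open>The height of the central edge. The axis has 2(n+x)+1 unit edges, so translating
    by \<open>c\<close> makes their range symmetric about 0.\<close>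
  define c where "c = (int (2*x) - int (2*n+1) - 1) div 2"
  have c: "c = int x - int n - 1" by (simp add: c_def)
  have ends: "- int (2*n+1) = - int (n+x) + c" "int (2*x) - 1 = int (n+x) + c" by (simp_all add: c)
  have "real (card (sym_matchings (2*n+1) (2*x) c)) =
      (\<Sum>S | S \<subseteq> {- int (2*n+1)..int (2*x) - 1} \<and> card S = 2*n+1 \<and> c \<in> S. set_vdm S) / (\<Prod>r<2*n+1. fact r)"
    by (rule card_sym_matchings) simp
  also have "\<dots> = Q (n+1) x * ST (2*n+1) (2*x)"
    unfolding ends sum_set_vdm_shift by (rule sum_set_vdm_Q_ST)
  finally show ?thesis unfolding card_tilings_eq c_def .
qed

end
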